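(* The $G_2$-Laplacian $\varphi\mapsto\Delta_\varphi\varphi$ is an orientation-preserving bijection of the space of positive $Sp(2)\cdot Sp(1)$-invariant 3-forms on $S^7$ onto itself, and it has exactly two fixed points.
   Context: $Sp(2)\cdot Sp(1)=(Sp(2)\times Sp(1))/\mathbb{Z}_2$ acts transitively on $S^7\subset\mathbb{H}^2$ (by $[(A,q)]\cdot v=Av\bar q$), with isotropy $Sp(1)\cdot Sp(1)$. A 3-form $\varphi$ on a 7-dimensional space is positive if there exist a positive definite inner product $g$ and a volume form $\mathrm{dvol}_g$ of $g$ (for one of the two orientations) with $\frac16\iota_X\varphi\wedge\iota_Y\varphi\wedge\varphi=g(X,Y)\mathrm{dvol}_g$; this determines $g_\varphi$ and an orientation. $\Delta_\varphi=*_\varphi d*_\varphi d-d*_\varphi d*_\varphi$ is the Hodge Laplacian on 3-forms for $g_\varphi$ and the induced orientation. Orientation-preserving means $\Delta_\varphi\varphi$ induces the same orientation as $\varphi$; a fixed point is $\varphi$ with $\Delta_\varphi\varphi=\varphi$. *)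

theory Defs
  imports "HOL-Analysis.Analysis" "HOL-Combinatorics.Permutations"
begin

type_synonym quat = "real \<times> real \<times> real \<times> real"
type_synonym V = "quat \<times> quat"

definition qmul :: "quat \<Rightarrow> quat \<Rightarrow> quat" where
  "qmul p q = (case p of (a1,b1,c1,d1) \<Rightarrow> case q of (a2,b2,c2,d2) \<Rightarrow>
     (a1*a2 - b1*b2 - c1*c2 - d1*d2,
      a1*b2 + b1*a2 + c1*d2 - d1*c2,
      a1*c2 - b1*d2 + c1*a2 + d1*b2,
      a1*d2 + b1*c2 - c1*b2 + d1*a2))"

definition qconj :: "quat \<Rightarrow> quat" where
  "qconj p = (case p of (a,b,c,d) \<Rightarrow> (a,-b,-c,-d))"

definition qone :: quat where "qone = (1,0,0,0)"
definition qzero :: quat where "qzero = (0,0,0,0)"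

type_synonym qmat2 = "quat \<times> quat \<times> quat \<times> quat"

definition qmat_apply :: "qmat2 \<Rightarrow> V \<Rightarrow> V" where
  "qmat_apply A v = (case A of (a,b,c,d) \<Rightarrow> case v of (v1,v2) \<Rightarrow>
     (qmul a v1 + qmul b v2, qmul c v1 + qmul d v2))"

text \<open>Sp(2): quaternionic 2x2 matrices with A^* A = I.\<close>
definition Sp2 :: "qmat2 set" where
  "Sp2 = {(a,b,c,d). qmul (qconj a) a + qmul (qconj c) c = qone
                   \<and> qmul (qconj a) b + qmul (qconj c) d = qzero
                   \<and> qmul (qconj b) a + qmul (qconj d) c = qzero
                   \<and> qmul (qconj b) b + qmul (qconj d) d = qone}"

definition Sp1 :: "quat set" where
  "Sp1 = {q. norm q = 1}"

definition sp_act :: "qmat2 \<Rightarrow> quat \<Rightarrow> V \<Rightarrow> V" where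
  "sp_act A q v = (case qmat_apply A v of (w1,w2) \<Rightarrow> (qmul w1 (qconj q), qmul w2 (qconj q)))"

definition S7 :: "V set" where "S7 = sphere 0 1"

definition tangent :: "V \<Rightarrow> V set" where
  "tangent x = {v. inner v x = 0}"

definition proj :: "V \<Rightarrow> V \<Rightarrow> V" where
  "proj x v = v - (inner v x) *\<^sub>R x"

text \<open>k-forms at a point are functions of lists of vectors. A form at x of degree k
  is normalised: it vanishes on lists of length other than k and only depends on
  the tangential parts of its arguments; on T_x it is multilinear and alternating.\<close>

definition tlists :: "V \<Rightarrow> nat \<Rightarrow> V list set" where
  "tlists x k = {vs. length vs = k \<and> set vs \<subseteq> tangent x}"

definition alt_form :: "V \<Rightarrow> nat \<Rightarrow> (V list \<Rightarrow> real) \<Rightarrow> bool" where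
  "alt_form x k \<alpha> \<longleftrightarrow>
     (\<forall>vs. \<alpha> vs = (if length vs = k then \<alpha> (map (proj x) vs) else 0))
   \<and> (\<forall>vs\<in>tlists x k. \<forall>i<k. \<forall>u\<in>tangent x. \<forall>w\<in>tangent x. \<forall>a b.
        \<alpha> (vs[i := a *\<^sub>R u + b *\<^sub>R w]) = a * \<alpha> (vs[i := u]) + b * \<alpha> (vs[i := w]))
   \<and> (\<forall>vs\<in>tlists x k. \<forall>i j. i < j \<and> j < k \<and> vs ! i = vs ! j \<longrightarrow> \<alpha> vs = 0)"

definition wedge :: "nat \<Rightarrow> nat \<Rightarrow> (V list \<Rightarrow> real) \<Rightarrow> (V list \<Rightarrow> real) \<Rightarrow> V list \<Rightarrow> real" where
  "wedge k l \<alpha> \<beta> vs =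
     (if length vs = k + l then
        (\<Sum>\<sigma> | \<sigma> permutes {..<k+l}.
            of_int (sign \<sigma>) * \<alpha> (take k (map (\<lambda>i. vs ! \<sigma> i) [0..<k+l]))
                             * \<beta> (drop k (map (\<lambda>i. vs ! \<sigma> i) [0..<k+l])))
        / (fact k * fact l)
      else 0)"

definition interior :: "V \<Rightarrow> (V list \<Rightarrow> real) \<Rightarrow> V list \<Rightarrow> real" where
  "interior X \<alpha> vs = \<alpha> (X # vs)"

definition inner_on :: "V \<Rightarrow> (V \<Rightarrow> V \<Rightarrow> real) \<Rightarrow> bool" where
  "inner_on x g \<longleftrightarrow>
     (\<forall>u v. g u v = g (proj x u) (proj x v))
   \<and> (\<forall>u\<in>tangent x. \<forall>v\<in>tangent x. g u v = g v u)
   \<and> (\<forall>u\<in>tangent x. \<forall>v\<in>tangent x. \<forall>w\<in>tangent x. \<forall>a b.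
        g (a *\<^sub>R u + b *\<^sub>R v) w = a * g u w + b * g v w)
   \<and> (\<forall>u\<in>tangent x. u \<noteq> 0 \<longrightarrow> g u u > 0)"

definition onb :: "V \<Rightarrow> (V \<Rightarrow> V \<Rightarrow> real) \<Rightarrow> V list \<Rightarrow> bool" where
  "onb x g e \<longleftrightarrow> e \<in> tlists x 7 \<and>
     (\<forall>i<7. \<forall>j<7. g (e ! i) (e ! j) = (if i = j then 1 else 0))"

definition vol_form :: "V \<Rightarrow> (V \<Rightarrow> V \<Rightarrow> real) \<Rightarrow> (V list \<Rightarrow> real) \<Rightarrow> bool" where
  "vol_form x g \<mu> \<longleftrightarrow> alt_form x 7 \<mu> \<and> (\<exists>e. onb x g e \<and> \<bar>\<mu> e\<bar> = 1)"

definition pos_data :: "V \<Rightarrow> (V list \<Rightarrow> real) \<Rightarrow> (V \<Rightarrow> V \<Rightarrow> real) \<Rightarrow> (V list \<Rightarrow> real) \<Rightarrow> bool" where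
  "pos_data x \<phi> g \<mu> \<longleftrightarrow> inner_on x g \<and> vol_form x g \<mu> \<and>
     (\<forall>X\<in>tangent x. \<forall>Y\<in>tangent x. \<forall>vs\<in>tlists x 7.
        wedge 4 3 (wedge 2 2 (interior X \<phi>) (interior Y \<phi>)) \<phi> vs / 6 = g X Y * \<mu> vs)"

definition positive_at :: "V \<Rightarrow> (V list \<Rightarrow> real) \<Rightarrow> bool" where
  "positive_at x \<phi> \<longleftrightarrow> alt_form x 3 \<phi> \<and> (\<exists>g \<mu>. pos_data x \<phi> g \<mu>)"

definition metric_of :: "V \<Rightarrow> (V list \<Rightarrow> real) \<Rightarrow> V \<Rightarrow> V \<Rightarrow> real" where
  "metric_of x \<phi> = fst (THE (g, \<mu>). pos_data x \<phi> g \<mu>)"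

definition vol_of :: "V \<Rightarrow> (V list \<Rightarrow> real) \<Rightarrow> V list \<Rightarrow> real" where
  "vol_of x \<phi> = snd (THE (g, \<mu>). pos_data x \<phi> g \<mu>)"

definition form_inner :: "V \<Rightarrow> (V \<Rightarrow> V \<Rightarrow> real) \<Rightarrow> nat \<Rightarrow> (V list \<Rightarrow> real) \<Rightarrow> (V list \<Rightarrow> real) \<Rightarrow> real" where
  "form_inner x g k \<alpha> \<beta> =
     (let e = (SOME e. onb x g e) in
       (\<Sum>is\<in>{is. length is = k \<and> set is \<subseteq> {..<7}}.
           \<alpha> (map ((!) e) is) * \<beta> (map ((!) e) is)) / fact k)"

definition hodge_at :: "V \<Rightarrow> (V \<Rightarrow> V \<Rightarrow> real) \<Rightarrow> (V list \<Rightarrow> real) \<Rightarrow> nat \<Rightarrow> (V list \<Rightarrow> real) \<Rightarrow> V list \<Rightarrow> real" where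
  "hodge_at x g \<mu> k \<alpha> = (THE \<gamma>. alt_form x (7 - k) \<gamma> \<and>
      (\<forall>\<beta>. alt_form x k \<beta> \<longrightarrow>
         (\<forall>vs\<in>tlists x 7. wedge k (7 - k) \<beta> \<gamma> vs = form_inner x g k \<beta> \<alpha> * \<mu> vs)))"

definition diff_form :: "nat \<Rightarrow> (V \<Rightarrow> V list \<Rightarrow> real) \<Rightarrow> bool" where
  "diff_form k \<omega> \<longleftrightarrow> (\<forall>x. if x \<in> S7 then alt_form x k (\<omega> x) else \<omega> x = (\<lambda>_. 0))"

text \<open>Extension of a form on S^7 to R^8 - {0}: pull-back along the retraction r(y) = y/|y|.
  Its derivative at y maps w to proj (y/|y|) w / |y|.\<close>
definition radial_ext :: "(V \<Rightarrow> V list \<Rightarrow> real) \<Rightarrow> V \<Rightarrow> V list \<Rightarrow> real" where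
  "radial_ext \<omega> y ws =
     \<omega> (y /\<^sub>R norm y) (map (\<lambda>w. proj (y /\<^sub>R norm y) w /\<^sub>R norm y) ws)"

text \<open>Exterior derivative of a k-form on S^7: since i^* r^* = id, d omega = i^* d(r^* omega),
  and on R^8 d is given by the constant-vector-field formula.\<close>
definition ext_d :: "nat \<Rightarrow> (V \<Rightarrow> V list \<Rightarrow> real) \<Rightarrow> V \<Rightarrow> V list \<Rightarrow> real" where
  "ext_d k \<omega> x vs =
     (if x \<in> S7 \<and> length vs = Suc k then
        (let us = map (proj x) vs in
          \<Sum>i<Suc k. (-1) ^ i *
             deriv (\<lambda>t. radial_ext \<omega> (x + t *\<^sub>R (us ! i)) (take i us @ drop (Suc i) us)) 0)
      else 0)"

definition star :: "(V \<Rightarrow> V list \<Rightarrow> real) \<Rightarrow> nat \<Rightarrow> (V \<Rightarrow> V list \<Rightarrow> real) \<Rightarrow> V \<Rightarrow> V list \<Rightarrow> real" where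
  "star \<phi> k \<omega> x =
     (if x \<in> S7 then hodge_at x (metric_of x (\<phi> x)) (vol_of x (\<phi> x)) k (\<omega> x) else (\<lambda>_. 0))"

definition G2_laplacian :: "(V \<Rightarrow> V list \<Rightarrow> real) \<Rightarrow> V \<Rightarrow> V list \<Rightarrow> real" where
  "G2_laplacian \<phi> x vs =
     star \<phi> 4 (ext_d 3 (star \<phi> 4 (ext_d 3 \<phi>))) x vs
   - ext_d 2 (star \<phi> 5 (ext_d 4 (star \<phi> 3 \<phi>))) x vs"

definition invariant :: "(V \<Rightarrow> V list \<Rightarrow> real) \<Rightarrow> bool" where
  "invariant \<omega> \<longleftrightarrow> (\<forall>A\<in>Sp2. \<forall>q\<in>Sp1. \<forall>x\<in>S7. \<forall>vs.
       \<omega> (sp_act A q x) (map (sp_act A q) vs) = \<omega> x vs)"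

definition pos_inv_3forms :: "(V \<Rightarrow> V list \<Rightarrow> real) set" where
  "pos_inv_3forms = {\<phi>. diff_form 3 \<phi> \<and> (\<forall>x\<in>S7. positive_at x (\<phi> x)) \<and> invariant \<phi>}"

definition same_orientation :: "(V \<Rightarrow> V list \<Rightarrow> real) \<Rightarrow> (V \<Rightarrow> V list \<Rightarrow> real) \<Rightarrow> bool" where
  "same_orientation \<phi> \<psi> \<longleftrightarrow>
     (\<forall>x\<in>S7. \<exists>c>0. \<forall>vs\<in>tlists x 7. vol_of x (\<psi> x) vs = c * vol_of x (\<phi> x) vs)"

end

theory Submission
  imports Defs "Jordan_Normal_Form.Determinant"
begin

text \<open>The isotropy representation of \<open>Sp(1)Sp(1)\<close> on the tangent space \<open>Im H \<oplus> H\<close> at \<open>(1, 0)\<close> leaves a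
  two-dimensional space of 3-forms invariant, so an invariant 3-form is
  \<open>\<phi> = a \<eta>\<^sub>1\<^sub>2\<^sub>3 + b \<Sum> \<eta>\<^sub>i \<and> \<omega>\<^sub>i\<close>; finitely many elements of the isotropy group suffice to see this.
  It is positive iff \<open>a b > 0\<close>. Writing \<open>a = \<epsilon> s\<^sup>3\<close> and \<open>b = \<epsilon> s t\<^sup>2\<close>, the induced metric scales the round one by
  \<open>s\<^sup>2\<close> along the fibres of the Hopf map and by \<open>t\<^sup>2\<close> orthogonally to them, and \<open>\<epsilon>\<close> is the orientation. From
  \<open>d\<eta>\<^sub>1 = 2(\<omega>\<^sub>1 - \<eta>\<^sub>2\<^sub>3)\<close> one finds that \<open>d*\<phi> = 0\<close>, so the Laplacian is \<open>*d*d\<phi>\<close>, and with \<open>r = a / b = s\<^sup>2 / t\<^sup>2\<close>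
  it maps \<open>(a, b)\<close> to \<open>\<epsilon> (24 s r (r + 1), 4 s (6 r\<^sup>2 + r + 1) / r)\<close>. The ratio of the new coefficients,
  \<open>6 r\<^sup>2 (r + 1) / (6 r\<^sup>2 + r + 1)\<close>, is an increasing bijection of the positive reals with fixed point \<open>1 / 5\<close> (the
  squashed metric), and for given \<open>r\<close> the scale \<open>s\<close> is read off the first coefficient.\<close>

section \<open>Alternating forms\<close>

text \<open>Definite descriptions (\<open>metric_of\<close>, \<open>hodge_at\<close>) and the
  permutation sum in \<open>wedge\<close> stand between the definitions and any explicit number.
  Therefore all forms are polynomials in the values of one quaternionic product \<open>hq\<close>:
  they make sense on ambient vectors, so d is computed with constant vector fields and without local
  frames, and at a point they are determined by the table of \<open>hq\<close> on seven vectors.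
  Equality of two forms becomes the vanishing of a sum of squares over such a frame. The polynomials
  use the constant ambient 2-forms \<open>s\<^sub>i\<close>, which on the sphere restrict to
  \<open>\<omega>\<^sub>i - \<eta>\<^sub>j\<^sub>k\<close>. Since the sum of
  \<open>\<eta>\<^sub>i \<and> s\<^sub>i\<close> is that of
  \<open>\<eta>\<^sub>i \<and> \<omega>\<^sub>i\<close> minus
  \<open>3 \<eta>\<^sub>1\<^sub>2\<^sub>3\<close>, and half the sum of the squares of the
  \<open>s\<^sub>i\<close> is three times \<open>\<omega>\<^sub>1\<^sup>2 / 2\<close> minus the sum
  of \<open>\<eta>\<^sub>j\<^sub>k \<and> \<omega>\<^sub>i\<close>, the coefficients
  \<open>a + 3 * b\<close> and \<open>c + d / 3\<close> arise. That the dual of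
  \<open>\<phi>\<close> is closed reflects the absence of invariant 2-forms, hence of invariant
  5-forms; here it is verified by computation.\<close>

text \<open>Composing with the projection extends an alternating form on a tangent space to all of \<open>V\<close>, so that
  side conditions on tangency disappear.\<close>

definition malt :: "nat \<Rightarrow> ('a::real_vector list \<Rightarrow> real) \<Rightarrow> bool" where
  "malt k \<alpha> \<longleftrightarrow> (\<forall>vs. length vs \<noteq> k \<longrightarrow> \<alpha> vs = 0)
     \<and> (\<forall>xs ys u w a b. \<alpha> (xs @ (a *\<^sub>R u + b *\<^sub>R w) # ys) = a * \<alpha> (xs @ u # ys) + b * \<alpha> (xs @ w # ys))
     \<and> (\<forall>xs ys u. \<alpha> (xs @ u # u # ys) = 0)"

lemma malt_length: "malt k \<alpha> \<Longrightarrow> length vs \<noteq> k \<Longrightarrow> \<alpha> vs = 0"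
  by (simp add: malt_def)

lemma malt_lin: "malt k \<alpha> \<Longrightarrow>
    \<alpha> (xs @ (a *\<^sub>R u + b *\<^sub>R w) # ys) = a * \<alpha> (xs @ u # ys) + b * \<alpha> (xs @ w # ys)"
  by (simp add: malt_def)

lemma malt_rep: "malt k \<alpha> \<Longrightarrow> \<alpha> (xs @ u # u # ys) = 0"
  by (simp add: malt_def)

lemma malt_add: "malt k \<alpha> \<Longrightarrow> \<alpha> (xs @ (u + w) # ys) = \<alpha> (xs @ u # ys) + \<alpha> (xs @ w # ys)"
  using malt_lin[of k \<alpha> xs 1 u 1 w ys] by simp

lemma malt_scale: "malt k \<alpha> \<Longrightarrow> \<alpha> (xs @ (a *\<^sub>R u) # ys) = a * \<alpha> (xs @ u # ys)"
  using malt_lin[of k \<alpha> xs a u 0 u ys] by simp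

lemma malt_zero: "malt k \<alpha> \<Longrightarrow> \<alpha> (xs @ 0 # ys) = 0"
  using malt_scale[of k \<alpha> xs 0 0 ys] by simp

lemma malt_swap:
  assumes "malt k \<alpha>"
  shows "\<alpha> (xs @ u # v # ys) = - \<alpha> (xs @ v # u # ys)"
proof -
  have "0 = \<alpha> (xs @ (u + v) # (u + v) # ys)"
    using malt_rep[OF assms] by simp
  also have "\<dots> = \<alpha> (xs @ u # (u + v) # ys) + \<alpha> (xs @ v # (u + v) # ys)"
    by (rule malt_add[OF assms])
  also have "\<dots> = \<alpha> (xs @ u # v # ys) + \<alpha> (xs @ v # u # ys)"
    using malt_add[OF assms, of "xs @ [u]" u v ys] malt_add[OF assms, of "xs @ [v]" u v ys]
      malt_rep[OF assms, of xs u ys] malt_rep[OF assms, of xs v ys] by simp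
  finally show ?thesis by simp
qed

lemma malt_front:
  assumes "malt k \<alpha>"
  shows "\<alpha> (xs @ v # ys) = (-1) ^ length xs * \<alpha> (v # xs @ ys)"
proof (induction xs arbitrary: ys rule: rev_induct)
  case (snoc z xs)
  have "\<alpha> ((xs @ [z]) @ v # ys) = - \<alpha> (xs @ v # z # ys)"
    using malt_swap[OF assms, of xs z v ys] by simp
  then show ?case using snoc[of "z # ys"] by simp
qed simp

lemma malt_front_take:
  "malt k \<alpha> \<Longrightarrow> p \<le> length xs \<Longrightarrow> \<alpha> (take p xs @ v # drop p xs) = (-1) ^ p * \<alpha> (v # xs)"
  using malt_front[of k \<alpha> "take p xs" v "drop p xs"] by (simp add: min_def)

text \<open>Both copies of \<open>u\<close> are moved to the front, where they are adjacent.\<close>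

lemma malt_eq_entries:
  assumes "malt k \<alpha>"
  shows "\<alpha> (xs @ u # ys @ u # zs) = 0"
  using malt_front[OF assms, of "xs @ u # ys" u zs] malt_front[OF assms, of "u # xs" u "ys @ zs"]
    malt_rep[OF assms, of "[]" u "xs @ ys @ zs"] malt_front[OF assms, of "xs" u "ys @ zs"]
    malt_front[OF assms, of "[u] @ xs" u "ys @ zs"]
  by simp

lemma malt_interior:
  fixes \<alpha> :: "'a::real_vector list \<Rightarrow> real"
  assumes "malt k \<alpha>"
  shows "malt (k - 1) (\<lambda>ws. \<alpha> (v # ws))"
  unfolding malt_def
proof (intro conjI allI impI)
  fix vs :: "'a list" assume "length vs \<noteq> k - 1"
  then show "\<alpha> (v # vs) = 0" using malt_length[OF assms, of "v # vs"] by auto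
next
  fix xs ys u w a b
  show "\<alpha> (v # xs @ (a *\<^sub>R u + b *\<^sub>R w) # ys) = a * \<alpha> (v # xs @ u # ys) + b * \<alpha> (v # xs @ w # ys)"
    using malt_lin[OF assms, of "v # xs"] by simp
next
  fix xs ys u
  show "\<alpha> (v # xs @ u # u # ys) = 0" using malt_rep[OF assms, of "v # xs"] by simp
qed

lemma malt_0: "malt k \<alpha> \<Longrightarrow> k = 0 \<Longrightarrow> \<alpha> (v # vs) = 0"
  by (simp add: malt_def)

lemma malt_zero_form: "malt k (\<lambda>_. 0)"
  by (simp add: malt_def)

lemma malt_lincomb: "malt k \<alpha> \<Longrightarrow> malt k \<beta> \<Longrightarrow> malt k (\<lambda>vs. a * \<alpha> vs + b * \<beta> vs)"
  unfolding malt_def by (auto simp: algebra_simps)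

lemma malt_diff: "malt k \<alpha> \<Longrightarrow> malt k \<beta> \<Longrightarrow> malt k (\<lambda>vs. \<alpha> vs - \<beta> vs)"
  unfolding malt_def by (auto simp: algebra_simps)

lemma malt_cmult: "malt k \<alpha> \<Longrightarrow> malt k (\<lambda>vs. a * \<alpha> vs)"
  unfolding malt_def by (auto simp: algebra_simps)

section \<open>Wedge products expanded along the first vector\<close>

lemma map_permutation_insert_0:
  assumes "length vs = n" "p \<le> n"
  shows "map (\<lambda>i. (v # vs) ! permutation_insert p 0 \<rho> i) [0..<Suc n]
       = take p (map (\<lambda>i. vs ! \<rho> i) [0..<n]) @ v # drop p (map (\<lambda>i. vs ! \<rho> i) [0..<n])"
  using assms
  by (intro nth_equalityI)
    (auto simp: permutation_insert_expand nth_append nth_Cons' min_def less_Suc_eq not_less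
      simp del: upt_Suc)

text \<open>Permutations are grouped by the position \<open>p\<close> that is sent to 0; deleting
  this position leaves an arbitrary permutation of one point fewer.\<close>

lemma sum_permutes_insert_0:
  fixes t :: "(nat \<Rightarrow> nat) \<Rightarrow> real"
  shows "(\<Sum>\<sigma> | \<sigma> permutes {0..<Suc n}. t \<sigma>)
       = (\<Sum>p<Suc n. \<Sum>\<rho> | \<rho> permutes {0..<n}. t (permutation_insert p 0 \<rho>))"
proof -
  let ?A = "{\<sigma>. \<sigma> permutes {0..<Suc n}}"
  have fin: "finite ?A" by (rule finite_permutations) simp
  have "sum t ?A = (\<Sum>p<Suc n. sum t {\<sigma> \<in> ?A. inv_into UNIV \<sigma> 0 = p})"
    using permutes_in_image[OF permutes_inv, of _ "{0..<Suc n}" 0]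
    by (intro sum.group[symmetric, OF fin]) (auto simp: lessThan_atLeast0)
  also have "\<dots> = (\<Sum>p<Suc n. \<Sum>\<rho> | \<rho> permutes {0..<n}. t (permutation_insert p 0 \<rho>))"
  proof (rule sum.cong[OF refl])
    fix p assume p: "p \<in> {..<Suc n}"
    have "{\<sigma> \<in> ?A. inv_into UNIV \<sigma> 0 = p} = {\<sigma>. \<sigma> permutes {0..<Suc n} \<and> \<sigma> p = 0}"
      by (auto simp: permutes_inv_eq)
    also have "\<dots> = permutation_insert p 0 ` {\<rho>. \<rho> permutes {0..<n}}"
      using p by (intro permutation_fix) auto
    finally show "sum t {\<sigma> \<in> ?A. inv_into UNIV \<sigma> 0 = p} = (\<Sum>\<rho> | \<rho> permutes {0..<n}. t (permutation_insert p 0 \<rho>))"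
      using p sum.reindex[OF permutation_insert_inj_on[of p n 0], of t] by (simp add: o_def)
  qed
  finally show ?thesis .
qed

text \<open>The unnormalised wedge product: expanding it along the first vector yields the derivation rule
  for the contraction, from which all values of wedge products are computed.\<close>

definition asum :: "nat \<Rightarrow> nat \<Rightarrow> ('a list \<Rightarrow> real) \<Rightarrow> ('a list \<Rightarrow> real) \<Rightarrow> 'a list \<Rightarrow> real" where
  "asum n k \<alpha> \<beta> vs = (\<Sum>\<sigma> | \<sigma> permutes {0..<n}.
     of_int (sign \<sigma>) * \<alpha> (take k (map (\<lambda>i. vs ! \<sigma> i) [0..<n])) * \<beta> (drop k (map (\<lambda>i. vs ! \<sigma> i) [0..<n])))"

lemma wedge_asum: "wedge k l \<alpha> \<beta> vs = (if length vs = k + l then asum (k + l) k \<alpha> \<beta> vs / (fact k * fact l) else 0)"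
  by (simp add: wedge_def asum_def lessThan_atLeast0)

text \<open>If \<open>v\<close> lands at a position \<open>p < k\<close>, it is an argument of
  \<open>\<alpha>\<close>, and moving it to the front costs \<open>(-1) ^ p\<close>, which cancels
  the sign of the inserted permutation. If \<open>k \<le> p\<close>, it is an argument of
  \<open>\<beta>\<close> and the signs combine to \<open>(-1) ^ k\<close>. The summand does not
  depend on the position within each range, whence the factors \<open>k\<close> and
  \<open>l\<close>.\<close>

lemma asum_Cons:
  assumes \<alpha>: "malt k \<alpha>" and \<beta>: "malt l \<beta>" and len: "length vs = n" and n: "Suc n = k + l"
  shows "asum (Suc n) k \<alpha> \<beta> (v # vs) =
     real k * asum n (k - 1) (\<lambda>ws. \<alpha> (v # ws)) \<beta> vs
     + (-1) ^ k * (real l * asum n k \<alpha> (\<lambda>ws. \<beta> (v # ws)) vs)"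
proof -
  define L where "L \<rho> = map (\<lambda>i. vs ! \<rho> i) [0..<n]" for \<rho> :: "nat \<Rightarrow> nat"
  have lenL: "length (L \<rho>) = n" for \<rho> by (simp add: L_def)
  define t where "t \<sigma> = of_int (sign \<sigma>) * \<alpha> (take k (map (\<lambda>i. (v # vs) ! \<sigma> i) [0..<Suc n]))
      * \<beta> (drop k (map (\<lambda>i. (v # vs) ! \<sigma> i) [0..<Suc n]))" for \<sigma>
  have low: "t (permutation_insert p 0 \<rho>)
      = of_int (sign \<rho>) * \<alpha> (v # take (k - 1) (L \<rho>)) * \<beta> (drop (k - 1) (L \<rho>))"
    if p: "p < k" and \<rho>: "\<rho> permutes {0..<n}" for p \<rho>
  proof -
    have pn: "p \<le> n" "p < Suc n" "k - 1 \<le> n" using p n \<beta> by auto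
    have 1: "take k (take p (L \<rho>) @ v # drop p (L \<rho>)) = take p (take (k - 1) (L \<rho>)) @ v # drop p (take (k - 1) (L \<rho>))"
      using p pn lenL[of \<rho>] by (cases k) (auto simp: min_def take_Cons' drop_take Suc_diff_le)
    have 2: "drop k (take p (L \<rho>) @ v # drop p (L \<rho>)) = drop (k - 1) (L \<rho>)"
      using p pn lenL[of \<rho>] by (cases k) (auto simp: min_def drop_Cons' Suc_diff_le)
    have 3: "\<alpha> (take p (take (k - 1) (L \<rho>)) @ v # drop p (take (k - 1) (L \<rho>)))
        = (-1) ^ p * \<alpha> (v # take (k - 1) (L \<rho>))"
      using p pn lenL[of \<rho>] by (intro malt_front_take[OF \<alpha>]) simp
    have s: "of_int (sign (permutation_insert p 0 \<rho>)) = (-1::real) ^ p * of_int (sign \<rho>)"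
      using signof_permutation_insert[OF \<rho>, of p 0] pn by simp
    have pp: "(-1::real) ^ p * (-1) ^ p = 1" by (metis power_add power_minus1_even mult_2)
    show ?thesis unfolding t_def map_permutation_insert_0[OF len pn(1)] L_def[symmetric] 1 2 3 s
      using pp by (simp add: algebra_simps)
  qed
  have high: "t (permutation_insert p 0 \<rho>)
      = (-1) ^ k * (of_int (sign \<rho>) * \<alpha> (take k (L \<rho>)) * \<beta> (v # drop k (L \<rho>)))"
    if p: "k \<le> p" "p < Suc n" and \<rho>: "\<rho> permutes {0..<n}" for p \<rho>
  proof -
    have pn: "p \<le> n" using p by simp
    have 1: "take k (take p (L \<rho>) @ v # drop p (L \<rho>)) = take k (L \<rho>)"
      using p pn lenL[of \<rho>] by (auto simp: min_def)
    have 2: "drop k (take p (L \<rho>) @ v # drop p (L \<rho>)) = take (p - k) (drop k (L \<rho>)) @ v # drop (p - k) (drop k (L \<rho>))"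
      using p pn lenL[of \<rho>] by (auto simp: min_def drop_take)
    have 3: "\<beta> (take (p - k) (drop k (L \<rho>)) @ v # drop (p - k) (drop k (L \<rho>)))
        = (-1) ^ (p - k) * \<beta> (v # drop k (L \<rho>))"
      using p pn lenL[of \<rho>] by (intro malt_front_take[OF \<beta>]) simp
    have s: "of_int (sign (permutation_insert p 0 \<rho>)) = (-1::real) ^ p * of_int (sign \<rho>)"
      using signof_permutation_insert[OF \<rho>, of p 0] p by simp
    have pp: "(-1::real) ^ p * (-1) ^ (p - k) = (-1) ^ k"
    proof -
      have "p + (p - k) = k + 2 * (p - k)" using p by simp
      then show ?thesis by (metis power_add power_minus1_even mult.right_neutral)
    qed
    have "t (permutation_insert p 0 \<rho>) = ((-1) ^ p * (-1) ^ (p - k)) * (of_int (sign \<rho>) * \<alpha> (take k (L \<rho>)) * \<beta> (v # drop k (L \<rho>)))"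
      unfolding t_def map_permutation_insert_0[OF len pn] L_def[symmetric] 1 2 3 s
      by (simp add: algebra_simps)
    then show ?thesis unfolding pp .
  qed
  have split: "{..<Suc n} = {..<k} \<union> {k..<Suc n}" "{..<k} \<inter> {k..<Suc n} = {}"
    using n by auto
  have "asum (Suc n) k \<alpha> \<beta> (v # vs) = (\<Sum>\<sigma> | \<sigma> permutes {0..<Suc n}. t \<sigma>)"
    unfolding asum_def t_def ..
  also have "\<dots> = (\<Sum>p<k. \<Sum>\<rho> | \<rho> permutes {0..<n}. t (permutation_insert p 0 \<rho>))
      + (\<Sum>p=k..<Suc n. \<Sum>\<rho> | \<rho> permutes {0..<n}. t (permutation_insert p 0 \<rho>))"
    unfolding sum_permutes_insert_0 unfolding split(1)
    by (rule sum.union_disjoint) auto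
  also have "(\<Sum>p<k. \<Sum>\<rho> | \<rho> permutes {0..<n}. t (permutation_insert p 0 \<rho>))
      = (\<Sum>p<k. asum n (k - 1) (\<lambda>ws. \<alpha> (v # ws)) \<beta> vs)"
    unfolding asum_def L_def[symmetric] by (intro sum.cong refl) (auto simp: low)
  also have "(\<Sum>p=k..<Suc n. \<Sum>\<rho> | \<rho> permutes {0..<n}. t (permutation_insert p 0 \<rho>))
      = (\<Sum>p=k..<Suc n. (-1) ^ k * asum n k \<alpha> (\<lambda>ws. \<beta> (v # ws)) vs)"
    unfolding asum_def L_def[symmetric] sum_distrib_left by (intro sum.cong refl) (auto simp: high)
  finally show ?thesis using n by simp
qed

text \<open>The factors \<open>k\<close> and \<open>l\<close> are absorbed by the factorials. The
  truncated \<open>k - 1\<close> is harmless at \<open>k = 0\<close>: a form of degree 0 vanishes on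
  nonempty lists, so its contraction is the zero form; likewise for \<open>l\<close>.\<close>

lemma wedge_Cons:
  assumes \<alpha>: "malt k \<alpha>" and \<beta>: "malt l \<beta>"
  shows "wedge k l \<alpha> \<beta> (v # vs) =
      wedge (k - 1) l (\<lambda>ws. \<alpha> (v # ws)) \<beta> vs + (-1) ^ k * wedge k (l - 1) \<alpha> (\<lambda>ws. \<beta> (v # ws)) vs"
proof (cases "Suc (length vs) = k + l")
  case True
  note A = asum_Cons[OF \<alpha> \<beta> refl True, of v]
  show ?thesis
  proof (cases k)
    case 0
    then obtain m where l: "l = Suc m" using True by (cases l) auto
    have "(\<lambda>ws. \<alpha> (v # ws)) = (\<lambda>_. 0)" using malt_0[OF \<alpha> 0] by auto
    then show ?thesis using True A 0 l by (simp add: wedge_asum)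
  next
    case (Suc k')
    show ?thesis
    proof (cases l)
      case 0
      then show ?thesis using True A Suc by (simp add: wedge_asum)
    next
      case (Suc m)
      then show ?thesis using True A \<open>k = Suc k'\<close> by (simp add: wedge_asum add_divide_distrib diff_divide_distrib)
    qed
  qed
next
  case False
  have 1: "wedge (k - 1) l (\<lambda>ws. \<alpha> (v # ws)) \<beta> vs = 0"
  proof (cases k)
    case 0
    have "(\<lambda>ws. \<alpha> (v # ws)) = (\<lambda>_. 0)" using malt_0[OF \<alpha> 0] by auto
    then show ?thesis by (simp add: wedge_def)
  qed (use False in \<open>auto simp: wedge_def\<close>)
  have 2: "wedge k (l - 1) \<alpha> (\<lambda>ws. \<beta> (v # ws)) vs = 0"
  proof (cases l)
    case 0
    have "(\<lambda>ws. \<beta> (v # ws)) = (\<lambda>_. 0)" using malt_0[OF \<beta> 0] by auto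
    then show ?thesis by (simp add: wedge_def)
  qed (use False in \<open>auto simp: wedge_def\<close>)
  show ?thesis using False 1 2 by (simp add: wedge_def)
qed

lemma maltI:
  assumes "\<And>vs. length vs \<noteq> k \<Longrightarrow> \<alpha> vs = 0"
    and "\<And>xs ys u w a b. \<alpha> (xs @ (a *\<^sub>R u + b *\<^sub>R w) # ys) = a * \<alpha> (xs @ u # ys) + b * \<alpha> (xs @ w # ys)"
    and "\<And>xs ys u. \<alpha> (xs @ u # u # ys) = 0"
  shows "malt k \<alpha>"
  using assms by (simp add: malt_def)

lemma wedge_lin_left:
  "wedge k l (\<lambda>ws. a * \<alpha> ws + b * \<alpha>' ws) \<beta> vs = a * wedge k l \<alpha> \<beta> vs + b * wedge k l \<alpha>' \<beta> vs"
  by (simp add: wedge_def sum.distrib sum_distrib_left add_divide_distrib algebra_simps)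

lemma wedge_lin_right:
  "wedge k l \<beta> (\<lambda>ws. a * \<alpha> ws + b * \<alpha>' ws) vs = a * wedge k l \<beta> \<alpha> vs + b * wedge k l \<beta> \<alpha>' vs"
  by (simp add: wedge_def sum.distrib sum_distrib_left add_divide_distrib algebra_simps)

lemma wedge_zero_left: "wedge k l (\<lambda>_. 0) \<beta> vs = 0"
  by (simp add: wedge_def)

lemma wedge_zero_right: "wedge k l \<beta> (\<lambda>_. 0) vs = 0"
  by (simp add: wedge_def)

lemma wedge_lin:
  assumes "malt k \<alpha>" "malt l \<beta>"
  shows "wedge k l \<alpha> \<beta> (xs @ (a *\<^sub>R u + b *\<^sub>R w) # ys)
       = a * wedge k l \<alpha> \<beta> (xs @ u # ys) + b * wedge k l \<alpha> \<beta> (xs @ w # ys)"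
  using assms
proof (induction xs arbitrary: k l \<alpha> \<beta>)
  case Nil
  have "(\<lambda>ws. \<alpha> ((a *\<^sub>R u + b *\<^sub>R w) # ws)) = (\<lambda>ws. a * \<alpha> (u # ws) + b * \<alpha> (w # ws))"
    "(\<lambda>ws. \<beta> ((a *\<^sub>R u + b *\<^sub>R w) # ws)) = (\<lambda>ws. a * \<beta> (u # ws) + b * \<beta> (w # ws))"
    using malt_lin[OF Nil(1), of "[]"] malt_lin[OF Nil(2), of "[]"] by auto
  then show ?case
    by (simp add: wedge_Cons[OF Nil] wedge_lin_left wedge_lin_right algebra_simps)
next
  case (Cons z xs)
  show ?case
    using Cons.IH[OF malt_interior[OF Cons.prems(1)] Cons.prems(2)]
      Cons.IH[OF Cons.prems(1) malt_interior[OF Cons.prems(2)]]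
    by (simp add: wedge_Cons[OF Cons.prems] algebra_simps)
qed

text \<open>Contracting twice with \<open>u\<close> leaves two mixed terms, which are the same
  product with the opposite signs \<open>(-1) ^ (k - 1)\<close> and \<open>(-1) ^ k\<close>.\<close>

lemma wedge_rep:
  assumes "malt k \<alpha>" "malt l \<beta>"
  shows "wedge k l \<alpha> \<beta> (xs @ u # u # ys) = 0"
  using assms
proof (induction xs arbitrary: k l \<alpha> \<beta>)
  case Nil
  have z: "(\<lambda>ws. \<alpha> (u # u # ws)) = (\<lambda>_. 0)" "(\<lambda>ws. \<beta> (u # u # ws)) = (\<lambda>_. 0)"
    using malt_rep[OF Nil(1), of "[]"] malt_rep[OF Nil(2), of "[]"] by auto
  let ?X = "wedge (k - 1) (l - 1) (\<lambda>ws. \<alpha> (u # ws)) (\<lambda>ws. \<beta> (u # ws)) ys"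
  have "wedge k l \<alpha> \<beta> (u # u # ys) = ((-1) ^ (k - 1) + (-1) ^ k) * ?X"
    by (simp add: wedge_Cons[OF Nil] wedge_Cons[OF malt_interior[OF Nil(1)] Nil(2)]
      wedge_Cons[OF Nil(1) malt_interior[OF Nil(2)]] z wedge_zero_left wedge_zero_right
      algebra_simps del: One_nat_def)
  \<comment> \<open>At \<open>k = 0\<close> truncated subtraction makes the two signs equal, so the
    term itself has to vanish.\<close>
  moreover have "?X = 0" if "k = 0"
    using malt_0[OF Nil(1) that] by (simp add: wedge_zero_left)
  moreover have "(-1::real) ^ (k - 1) = - ((-1) ^ k)" if "k \<noteq> 0"
    using that by (cases k) auto
  ultimately show ?case by (cases "k = 0") auto
next
  case (Cons z xs)
  show ?case
    using Cons.IH[OF malt_interior[OF Cons.prems(1)] Cons.prems(2)]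
      Cons.IH[OF Cons.prems(1) malt_interior[OF Cons.prems(2)]]
    by (simp add: wedge_Cons[OF Cons.prems])
qed

lemma malt_wedge:
  assumes "malt k \<alpha>" "malt l \<beta>"
  shows "malt (k + l) (wedge k l \<alpha> \<beta>)"
  using wedge_lin[OF assms] wedge_rep[OF assms] by (intro maltI) (auto simp: wedge_def)

text \<open>Signed sum over the (k,l)-shuffles of the argument list, in a recursive form that the
  simplifier evaluates on explicit lists, where \<open>wedge\<close> would sum over all
  permutations. The guards make it meaningful for arbitrary functions, so that identities in an
  undetermined \<open>\<beta>\<close> can be checked.\<close>

fun shuf :: "nat \<Rightarrow> nat \<Rightarrow> ('a list \<Rightarrow> real) \<Rightarrow> ('a list \<Rightarrow> real) \<Rightarrow> 'a list \<Rightarrow> real" where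
  "shuf k l \<alpha> \<beta> [] = (if k = 0 \<and> l = 0 then \<alpha> [] * \<beta> [] else 0)"
| "shuf k l \<alpha> \<beta> (v # vs) = (if k = 0 then 0 else shuf (k - 1) l (\<lambda>ws. \<alpha> (v # ws)) \<beta> vs)
      + (if l = 0 then 0 else (-1) ^ k * shuf k (l - 1) \<alpha> (\<lambda>ws. \<beta> (v # ws)) vs)"

lemma shuf_zero_left: "shuf k l (\<lambda>_. 0) \<beta> vs = 0"
  by (induction vs arbitrary: k l \<beta>) auto

lemma shuf_zero_right: "shuf k l \<beta> (\<lambda>_. 0) vs = 0"
  by (induction vs arbitrary: k l \<beta>) auto

lemma wedge_shuf:
  assumes "malt k \<alpha>" "malt l \<beta>"
  shows "wedge k l \<alpha> \<beta> vs = shuf k l \<alpha> \<beta> vs"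
  using assms
proof (induction vs arbitrary: k l \<alpha> \<beta>)
  case Nil
  then show ?case by (simp add: wedge_def)
next
  case (Cons v vs)
  have "(\<lambda>ws. \<alpha> (v # ws)) = (\<lambda>_. 0)" if "k = 0" using malt_0[OF Cons.prems(1) that] by auto
  moreover have "(\<lambda>ws. \<beta> (v # ws)) = (\<lambda>_. 0)" if "l = 0" using malt_0[OF Cons.prems(2) that] by auto
  ultimately show ?case
    using Cons.IH[OF malt_interior[OF Cons.prems(1), of v] Cons.prems(2)]
      Cons.IH[OF Cons.prems(1) malt_interior[OF Cons.prems(2), of v]]
    by (auto simp: wedge_Cons[OF Cons.prems] shuf_zero_left shuf_zero_right)
qed

text \<open>The inner product of forms sums over all index lists (\<open>tsum\<close>); for alternating forms this is
  \<open>fact k\<close> times the sum over increasing ones (\<open>ssum\<close>).\<close>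

primrec tsum :: "nat \<Rightarrow> ('a list \<Rightarrow> real) \<Rightarrow> 'a list \<Rightarrow> real" where
  "tsum 0 F e = F []"
| "tsum (Suc k) F e = (\<Sum>x\<leftarrow>e. tsum k (\<lambda>l. F (x # l)) e)"

fun ssum :: "nat \<Rightarrow> ('a list \<Rightarrow> real) \<Rightarrow> 'a list \<Rightarrow> real" where
  "ssum k F [] = (if k = 0 then F [] else 0)"
| "ssum k F (v # e) = ssum k F e + (if k = 0 then 0 else ssum (k - 1) (\<lambda>l. F (v # l)) e)"

text \<open>The behaviour of the product of two alternating forms of the same degree: the signs
  cancel under a swap, and repetitions still give 0.\<close>

definition sym_fun :: "('a list \<Rightarrow> real) \<Rightarrow> bool" where
  "sym_fun F \<longleftrightarrow> (\<forall>xs x y ys. F (xs @ x # y # ys) = F (xs @ y # x # ys)) \<and> (\<forall>xs x ys. F (xs @ x # x # ys) = 0)"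

lemma sym_fun_Cons:
  assumes "sym_fun F"
  shows "sym_fun (\<lambda>l. F (v # l))"
proof -
  have "F ((v # xs) @ x # y # ys) = F ((v # xs) @ y # x # ys)" "F ((v # xs) @ x # x # ys) = 0" for xs x y ys
    using assms unfolding sym_fun_def by blast+
  then show ?thesis by (simp add: sym_fun_def)
qed

lemma tsum_zero: "tsum k (\<lambda>_. 0) e = 0"
  by (induction k) (simp_all add: o_def)

text \<open>A list with a nonzero contribution contains \<open>v\<close> in at most one of its
  \<open>k\<close> positions, and by symmetry this entry can be moved to the front.\<close>

lemma tsum_Cons:
  assumes "sym_fun F"
  shows "tsum k F (v # e) = tsum k F e + real k * tsum (k - 1) (\<lambda>l. F (v # l)) e"
  using assms
proof (induction k arbitrary: F)
  case (Suc k)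
  have z: "(\<lambda>l. F (v # v # l)) = (\<lambda>_. 0)"
  proof
    fix l show "F (v # v # l) = 0" using Suc.prems unfolding sym_fun_def by (metis append_Nil)
  qed
  have sw: "F (x # v # l) = F (v # x # l)" for x l
    using Suc.prems unfolding sym_fun_def by (metis append_Nil)
  have 1: "tsum k (\<lambda>l. F (x # l)) (v # e) = tsum k (\<lambda>l. F (x # l)) e + real k * tsum (k - 1) (\<lambda>l. F (v # x # l)) e" for x
    using Suc.IH[OF sym_fun_Cons[OF Suc.prems, of x]] by (simp add: sw)
  have 2: "(\<Sum>x\<leftarrow>e. real k * tsum (k - 1) (\<lambda>l. F (v # x # l)) e) = real k * tsum k (\<lambda>l. F (v # l)) e"
  proof (cases k)
    case (Suc m)
    show ?thesis unfolding Suc tsum.simps sum_list_const_mult by simp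
  qed (simp add: sum_list_0)
  have "tsum (Suc k) F (v # e) = tsum k (\<lambda>l. F (v # l)) e
     + (\<Sum>x\<leftarrow>e. tsum k (\<lambda>l. F (x # l)) e + real k * tsum (k - 1) (\<lambda>l. F (v # x # l)) e)"
    using 1 z by (simp add: tsum_zero)
  also have "\<dots> = tsum (Suc k) F e + real (Suc k) * tsum k (\<lambda>l. F (v # l)) e"
    by (simp add: sum_list_addf 2 algebra_simps del: One_nat_def)
  finally show ?case by simp
qed simp

lemma ssum_0: "ssum 0 F e = F []"
  by (induction e) auto

lemma tsum_ssum:
  assumes "sym_fun F"
  shows "tsum k F e = fact k * ssum k F e"
  using assms
proof (induction e arbitrary: k F)
  case Nil
  then show ?case by (cases k) auto
next
  case (Cons v e)
  show ?case
  proof (cases k)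
    case (Suc m)
    then show ?thesis
      using Cons.IH[OF Cons.prems, of k] Cons.IH[OF sym_fun_Cons[OF Cons.prems, of v], of m]
      by (simp add: tsum_Cons[OF Cons.prems] algebra_simps del: tsum.simps)
  qed (simp add: ssum_0)
qed

lemma sym_fun_malt_mult:
  assumes "malt k \<alpha>" "malt k \<beta>"
  shows "sym_fun (\<lambda>l. \<alpha> l * \<beta> l)"
  unfolding sym_fun_def
  using malt_rep[OF assms(1)] malt_swap[OF assms(1)] malt_swap[OF assms(2)]
  by (metis minus_mult_minus mult_zero_left)

section \<open>Complementary sublists and forms tested on a basis\<close>

lemma shuf_few:
  assumes "f \<in> shuffles I J" "length I < k" "\<And>v xs ys. v \<in> set J \<Longrightarrow> \<beta> (xs @ v # ys) = 0"
  shows "shuf k l \<beta> \<gamma> f = 0"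
  using assms
proof (induction f arbitrary: I J k l \<beta> \<gamma>)
  case Nil
  then show ?case by simp
next
  case (Cons v f)
  from Cons.prems(1) consider I' where "I = v # I'" "f \<in> shuffles I' J" | J' where "J = v # J'" "f \<in> shuffles I J'"
    by (auto simp: Cons_in_shuffles_iff neq_Nil_conv)
  then show ?case
  proof cases
    case 1
    have van: "\<beta> (v # xs @ z # ys) = 0" if "z \<in> set J" for z xs ys
      using Cons.prems(3)[OF that, of "v # xs" ys] by simp
    have "shuf (k - 1) l (\<lambda>ws. \<beta> (v # ws)) \<gamma> f = 0"
      using 1 Cons.prems(2) van by (intro Cons.IH[OF 1(2)]) auto
    moreover have "shuf k (l - 1) \<beta> (\<lambda>ws. \<gamma> (v # ws)) f = 0"
      using 1 Cons.prems(2,3) by (intro Cons.IH[OF 1(2)]) auto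
    ultimately show ?thesis by auto
  next
    case 2
    have "(\<lambda>ws. \<beta> (v # ws)) = (\<lambda>_. 0)" using Cons.prems(3)[of v "[]"] 2 by auto
    moreover have "shuf k (l - 1) \<beta> (\<lambda>ws. \<gamma> (v # ws)) f = 0"
      using 2 Cons.prems(2,3) by (intro Cons.IH[OF 2(2)]) auto
    ultimately show ?thesis by (simp add: shuf_zero_left)
  qed
qed

text \<open>Every shuffle except the one that hands \<open>I\<close> to \<open>\<beta>\<close> gives
  \<open>\<beta>\<close> some entry of \<open>J\<close> and dies. The remaining sign is left
  unspecified, since only the vanishing of the product is read off from it.\<close>

lemma shuf_single:
  assumes "f \<in> shuffles I J" "length I = k" "length J = l" "\<And>v xs ys. v \<in> set J \<Longrightarrow> \<beta> (xs @ v # ys) = 0"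
  shows "\<exists>s. s \<noteq> 0 \<and> shuf k l \<beta> \<gamma> f = s * \<beta> I * \<gamma> J"
  using assms
proof (induction f arbitrary: I J k l \<beta> \<gamma>)
  case Nil
  then show ?case by (intro exI[of _ 1]) auto
next
  case (Cons v f)
  from Cons.prems(1) consider I' where "I = v # I'" "f \<in> shuffles I' J" | J' where "J = v # J'" "f \<in> shuffles I J'"
    by (auto simp: Cons_in_shuffles_iff neq_Nil_conv)
  then show ?case
  proof cases
    case 1
    have van: "\<beta> (v # xs @ z # ys) = 0" if "z \<in> set J" for z xs ys
      using Cons.prems(4)[OF that, of "v # xs" ys] by simp
    have "shuf k (l - 1) \<beta> (\<lambda>ws. \<gamma> (v # ws)) f = 0"
      using 1 Cons.prems(2,4) by (intro shuf_few[OF 1(2)]) auto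
    moreover have "\<exists>s. s \<noteq> 0 \<and> shuf (length I') l (\<lambda>ws. \<beta> (v # ws)) \<gamma> f = s * \<beta> (v # I') * \<gamma> J"
      by (rule Cons.IH[OF 1(2) refl Cons.prems(3)]) (rule van)
    moreover have "k = Suc (length I')" using 1 Cons.prems(2) by simp
    ultimately show ?thesis unfolding 1(1) by (cases "l = 0") simp_all
  next
    case 2
    have "(\<lambda>ws. \<beta> (v # ws)) = (\<lambda>_. 0)" using Cons.prems(4)[of v "[]"] 2 by auto
    moreover obtain s where s: "s \<noteq> 0" "shuf k (length J') \<beta> (\<lambda>ws. \<gamma> (v # ws)) f = s * \<beta> I * \<gamma> (v # J')"
      using Cons.IH[OF 2(2) Cons.prems(2) refl, of \<beta> "\<lambda>ws. \<gamma> (v # ws)"] Cons.prems(4)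
      unfolding 2(1) by (metis list.set_intros(2))
    moreover have "l = Suc (length J')" using 2 Cons.prems(3) by simp
    ultimately have "shuf k l \<beta> \<gamma> (v # f) = ((-1) ^ k * s) * \<beta> I * \<gamma> J"
      unfolding 2(1) by (simp add: shuf_zero_left)
    then show ?thesis using s(1) by (intro exI[of _ "(-1) ^ k * s"]) simp
  qed
qed

text \<open>Sorting the shuffle into \<open>I\<close> followed by \<open>J\<close> changes the value
  only by a sign.\<close>

lemma malt_shuffles:
  assumes "f \<in> shuffles I J" "malt n \<alpha>"
  shows "\<exists>s. s \<noteq> 0 \<and> \<alpha> (I @ J) = s * \<alpha> f"
  using assms
proof (induction f arbitrary: I J n \<alpha>)
  case Nil
  then show ?case by (intro exI[of _ 1]) auto
next
  case (Cons v f)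
  from Cons.prems(1) consider I' where "I = v # I'" "f \<in> shuffles I' J" | J' where "J = v # J'" "f \<in> shuffles I J'"
    by (auto simp: Cons_in_shuffles_iff neq_Nil_conv)
  then show ?case
  proof cases
    case 1
    then show ?thesis using Cons.IH[OF 1(2) malt_interior[OF Cons.prems(2), of v]] by auto
  next
    case 2
    obtain s where "s \<noteq> 0" "\<alpha> (v # I @ J') = s * \<alpha> (v # f)"
      using Cons.IH[OF 2(2) malt_interior[OF Cons.prems(2), of v]] by auto
    then show ?thesis using malt_front[OF Cons.prems(2), of I v J'] 2
      by (intro exI[of _ "(-1) ^ length I * s"]) auto
  qed
qed

text \<open>\<open>ssum\<close> runs over the sublists of \<open>f\<close>, and each sublist
  \<open>J\<close> has a complement \<open>I\<close> of which \<open>f\<close> is a shuffle with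
  \<open>J\<close>.\<close>

lemma ssum_zero_shuffles:
  assumes "\<And>I J. f \<in> shuffles I J \<Longrightarrow> length J = l \<Longrightarrow> F J = 0"
  shows "ssum l F f = 0"
  using assms
proof (induction f arbitrary: F l)
  case Nil
  then show ?case by auto
next
  case (Cons v f)
  have "F J = 0" if "f \<in> shuffles I J" "length J = l" for I J
    using Cons.prems[of "v # I" J] that by (auto simp: Cons_in_shuffles_iff)
  moreover have "F (v # J) = 0" if "f \<in> shuffles I J" "Suc (length J) = l" for I J
    using Cons.prems[of I "v # J"] that by (auto simp: Cons_in_shuffles_iff)
  ultimately show ?case using Cons.IH[of l F] Cons.IH[of "l - 1" "\<lambda>ws. F (v # ws)"] by auto
qed

lemma tsum_nonneg: "(\<And>l. F l \<ge> 0) \<Longrightarrow> tsum k F e \<ge> 0"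
  by (induction k arbitrary: F) (auto intro!: sum_list_nonneg)

lemma tsum_eq_0D:
  assumes "tsum k F e = 0" "\<And>l. F l \<ge> 0" "set ws \<subseteq> set e" "length ws = k"
  shows "F ws = 0"
  using assms
proof (induction k arbitrary: F ws)
  case (Suc k)
  then obtain w ws' where ws: "ws = w # ws'" by (cases ws) auto
  have "\<forall>y\<in>set (map (\<lambda>x. tsum k (\<lambda>l. F (x # l)) e) e). y = 0"
    using Suc.prems(1,2) by (subst sum_list_nonneg_eq_0_iff[symmetric]) (auto intro: tsum_nonneg)
  then have "tsum k (\<lambda>l. F (w # l)) e = 0" using Suc.prems(3) ws by auto
  from Suc.IH[OF this] show ?case using Suc.prems ws by auto
qed simp

text \<open>The vectors of the span are dealt with one slot at a time: the entries for which the
  form vanishes in a given slot constitute a subspace containing \<open>S\<close>.\<close>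

lemma malt_span_zero:
  assumes m: "malt k \<gamma>" and z: "\<And>ws. set ws \<subseteq> S \<Longrightarrow> \<gamma> ws = 0"
    and "set zs \<subseteq> span S" "set ys \<subseteq> S"
  shows "\<gamma> (zs @ ys) = 0"
  using assms(3,4)
proof (induction zs arbitrary: ys rule: rev_induct)
  case (snoc y zs)
  have y: "y \<in> span S" using snoc.prems by auto
  have "subspace {y. \<gamma> (zs @ y # ys) = 0}"
    using malt_zero[OF m] malt_add[OF m] malt_scale[OF m] by (auto simp: subspace_def)
  moreover have "S \<subseteq> {y. \<gamma> (zs @ y # ys) = 0}"
    using snoc.IH[of "_ # ys"] snoc.prems by auto
  ultimately have "y \<in> {y. \<gamma> (zs @ y # ys) = 0}" using y span_minimal by blast
  then show ?case by simp
qed (use z in auto)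

text \<open>A vanishing sum of squares makes the forms agree on lists of basis vectors, hence on the
  span. This packs all components into one equation that simplification settles from a table of
  values.\<close>

lemma malt_eqI:
  assumes \<alpha>: "malt k \<alpha>" and \<beta>: "malt k \<beta>" and s: "ssum k (\<lambda>l. (\<alpha> l - \<beta> l) * (\<alpha> l - \<beta> l)) f = 0"
    and vs: "set vs \<subseteq> span (set f)"
  shows "\<alpha> vs = \<beta> vs"
proof -
  let ?\<gamma> = "\<lambda>l. \<alpha> l - \<beta> l"
  have m: "malt k ?\<gamma>" by (rule malt_diff[OF \<alpha> \<beta>])
  have "tsum k (\<lambda>l. ?\<gamma> l * ?\<gamma> l) f = 0"
    using s tsum_ssum[OF sym_fun_malt_mult[OF m m]] by simp
  then have "?\<gamma> ws = 0" if "set ws \<subseteq> set f" for ws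
    using tsum_eq_0D[of k "\<lambda>l. ?\<gamma> l * ?\<gamma> l" f ws] that malt_length[OF m, of ws] by (cases "length ws = k") auto
  from malt_span_zero[OF m this vs, of "[]"] show ?thesis by simp
qed

section \<open>Metric, volume form and Hodge star at a point\<close>

lemma S7_inner: "x \<in> S7 \<Longrightarrow> inner x x = 1"
  by (simp add: S7_def dot_square_norm)

lemma proj_in_tangent: "x \<in> S7 \<Longrightarrow> proj x v \<in> tangent x"
  by (simp add: tangent_def proj_def inner_diff_left S7_inner)

lemma proj_tangent: "v \<in> tangent x \<Longrightarrow> proj x v = v"
  by (simp add: tangent_def proj_def)

lemma proj_lin: "proj x (a *\<^sub>R u + b *\<^sub>R w) = a *\<^sub>R proj x u + b *\<^sub>R proj x w"
  by (simp add: proj_def inner_add_left algebra_simps)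

lemma map_proj_tangent: "set vs \<subseteq> tangent x \<Longrightarrow> map (proj x) vs = vs"
  by (induction vs) (auto simp: proj_tangent)

lemma set_map_proj: "x \<in> S7 \<Longrightarrow> set (map (proj x) vs) \<subseteq> tangent x"
  by (induction vs) (auto simp: proj_in_tangent)

lemma subspace_tangent: "subspace (tangent x)"
  by (auto simp: subspace_def tangent_def inner_add_left)

lemma alt_form_malt:
  assumes x: "x \<in> S7" and "alt_form x k \<alpha>"
  shows "malt k \<alpha>"
proof -
  from assms(2) have n: "\<alpha> vs = (if length vs = k then \<alpha> (map (proj x) vs) else 0)"
    and l: "vs \<in> tlists x k \<Longrightarrow> i < k \<Longrightarrow> u \<in> tangent x \<Longrightarrow> w \<in> tangent x \<Longrightarrow>
        \<alpha> (vs[i := a *\<^sub>R u + b *\<^sub>R w]) = a * \<alpha> (vs[i := u]) + b * \<alpha> (vs[i := w])"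
    and r: "vs \<in> tlists x k \<Longrightarrow> i < j \<Longrightarrow> j < k \<Longrightarrow> vs ! i = vs ! j \<Longrightarrow> \<alpha> vs = 0"
    for vs i j u w a b
    unfolding alt_form_def by blast+
  show ?thesis
  proof (rule maltI)
    fix vs :: "V list" assume "length vs \<noteq> k"
    then show "\<alpha> vs = 0" by (subst n) simp
  next
    fix xs ys and u w :: V and a b
    show "\<alpha> (xs @ (a *\<^sub>R u + b *\<^sub>R w) # ys) = a * \<alpha> (xs @ u # ys) + b * \<alpha> (xs @ w # ys)"
    proof (cases "length (xs @ u # ys) = k")
      case True
      then have len: "length (xs @ v # ys) = k" for v by simp
      let ?vs = "map (proj x) (xs @ u # ys)"
      have upd: "?vs[length xs := v] = map (proj x) xs @ v # map (proj x) ys" for v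
        by (simp add: list_update_append)
      have "?vs \<in> tlists x k" using True proj_in_tangent[OF x] by (auto simp: tlists_def)
      from l[OF this, of "length xs" "proj x u" "proj x w" a b] proj_in_tangent[OF x] True
      have "\<alpha> (map (proj x) (xs @ (a *\<^sub>R u + b *\<^sub>R w) # ys))
          = a * \<alpha> (map (proj x) (xs @ u # ys)) + b * \<alpha> (map (proj x) (xs @ w # ys))"
        unfolding upd by (simp add: proj_lin)
      then show ?thesis using n[of "xs @ _ # ys"] len by metis
    next
      case False
      then show ?thesis using n[of "xs @ _ # ys"] by simp
    qed
  next
    fix xs ys and u :: V
    show "\<alpha> (xs @ u # u # ys) = 0"
    proof (cases "length (xs @ u # u # ys) = k")
      case True
      have "map (proj x) (xs @ u # u # ys) \<in> tlists x k"
        using True proj_in_tangent[OF x] by (auto simp: tlists_def)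
      from r[OF this, of "length xs" "Suc (length xs)"] True
      have "\<alpha> (map (proj x) (xs @ u # u # ys)) = 0" by (simp add: nth_append)
      then show ?thesis using n[of "xs @ u # u # ys"] True by simp
    next
      case False
      then show ?thesis using n[of "xs @ u # u # ys"] by simp
    qed
  qed
qed

lemma alt_form_proj:
  assumes "x \<in> S7" "alt_form x k \<alpha>"
  shows "\<alpha> (map (proj x) vs) = \<alpha> vs"
proof (cases "length vs = k")
  case True
  have "\<alpha> vs = (if length vs = k then \<alpha> (map (proj x) vs) else 0)"
    using assms(2) unfolding alt_form_def by blast
  then show ?thesis using True by simp
next
  case False
  then show ?thesis using malt_length[OF alt_form_malt[OF assms]] by simp
qed

lemma alt_formI:
  assumes m: "malt k \<alpha>" and p: "\<And>vs. length vs = k \<Longrightarrow> \<alpha> (map (proj x) vs) = \<alpha> vs"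
  shows "alt_form x k \<alpha>"
  unfolding alt_form_def
proof (intro conjI allI ballI impI)
  fix vs show "\<alpha> vs = (if length vs = k then \<alpha> (map (proj x) vs) else 0)"
    using p[of vs] malt_length[OF m, of vs] by simp
next
  fix vs i u w and a b :: real assume "vs \<in> tlists x k" "i < k"
  then have "vs[i := v] = take i vs @ v # drop (Suc i) vs" for v
    by (simp add: tlists_def upd_conv_take_nth_drop)
  then show "\<alpha> (vs[i := a *\<^sub>R u + b *\<^sub>R w]) = a * \<alpha> (vs[i := u]) + b * \<alpha> (vs[i := w])"
    using malt_lin[OF m] by metis
next
  fix vs i j assume "vs \<in> tlists x k" and ij: "i < j \<and> j < k \<and> vs ! i = vs ! j"
  then have len: "length vs = k" by (simp add: tlists_def)
  have "vs = take j vs @ vs ! j # drop (Suc j) vs" using ij len by (simp add: id_take_nth_drop)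
  moreover have "take j vs = take i (take j vs) @ take j vs ! i # drop (Suc i) (take j vs)"
    using ij len by (intro id_take_nth_drop) auto
  ultimately have "vs = take i (take j vs) @ vs ! j # drop (Suc i) (take j vs) @ vs ! j # drop (Suc j) vs"
    using ij by (metis append.assoc append_Cons nth_take)
  then show "\<alpha> vs = 0" using malt_eq_entries[OF m] by metis
qed

lemma shuf_map: "shuf k l \<alpha> \<beta> (map P vs) = shuf k l (\<lambda>ws. \<alpha> (map P ws)) (\<lambda>ws. \<beta> (map P ws)) vs"
  by (induction vs arbitrary: k l \<alpha> \<beta>) auto

lemma wedge_map_proj:
  assumes "malt k \<alpha>" "malt l \<beta>" "\<And>vs. \<alpha> (map P vs) = \<alpha> vs" "\<And>vs. \<beta> (map P vs) = \<beta> vs"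
  shows "wedge k l \<alpha> \<beta> (map P vs) = wedge k l \<alpha> \<beta> vs"
  by (simp add: wedge_shuf[OF assms(1,2)] shuf_map assms(3,4))

lemma ssum_short: "length e < k \<Longrightarrow> ssum k F e = 0"
  by (induction e arbitrary: k F) auto

lemma ssum_full: "ssum (length e) F e = F e"
  by (induction e arbitrary: F) (auto simp: ssum_short)

text \<open>In top degree the basis is its own only sublist of full length, so a single value
  determines the form.\<close>

lemma malt_top_eqI:
  assumes "malt 7 \<alpha>" "malt 7 \<beta>" "length f = 7" "\<alpha> f = \<beta> f" "set vs \<subseteq> span (set f)"
  shows "\<alpha> vs = \<beta> vs"
  using assms(4) ssum_full[where F = "\<lambda>l. (\<alpha> l - \<beta> l) * (\<alpha> l - \<beta> l)" and e = f] assms(3)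
  by (intro malt_eqI[OF assms(1,2) _ assms(5)]) simp

lemma sum_lists_tsum:
  "(\<Sum>is\<in>{is. length is = k \<and> set is \<subseteq> {..<length e}}. F (map ((!) e) is)) = tsum k F e"
proof (induction k arbitrary: F)
  case 0
  have "{is. length is = 0 \<and> set is \<subseteq> {..<length e}} = {[]}" by auto
  then show ?case by simp
next
  case (Suc k)
  let ?A = "\<lambda>k. {is. length is = k \<and> set is \<subseteq> {..<length e}}"
  have "?A (Suc k) = (\<lambda>(i, is). i # is) ` ({..<length e} \<times> ?A k)"
    by (auto simp: image_iff length_Suc_conv)
  then have "(\<Sum>is\<in>?A (Suc k). F (map ((!) e) is))
      = (\<Sum>(i, is)\<in>{..<length e} \<times> ?A k. F (map ((!) e) (i # is)))"
    by (simp add: sum.reindex inj_on_def case_prod_beta')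
  also have "\<dots> = (\<Sum>i<length e. \<Sum>is\<in>?A k. F (e ! i # map ((!) e) is))"
    by (simp add: sum.cartesian_product)
  also have "\<dots> = (\<Sum>i<length e. tsum k (\<lambda>l. F (e ! i # l)) e)"
    by (intro sum.cong refl Suc.IH)
  also have "\<dots> = tsum (Suc k) F e"
    by (simp add: sum_list_sum_nth lessThan_atLeast0)
  finally show ?case .
qed

section \<open>Orthonormal bases and independence of their choice\<close>

lemma inner_on_sym:
  assumes "x \<in> S7" "inner_on x g"
  shows "g u v = g v u"
proof -
  have "g u v = g (proj x u) (proj x v)" "g v u = g (proj x v) (proj x u)"
    "g (proj x u) (proj x v) = g (proj x v) (proj x u)"
    using assms proj_in_tangent unfolding inner_on_def by blast+
  then show ?thesis by simp
qed

lemma inner_on_lin: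
  assumes "x \<in> S7" "inner_on x g"
  shows "g (a *\<^sub>R u + b *\<^sub>R v) w = a * g u w + b * g v w"
proof -
  have n: "g u w = g (proj x u) (proj x w)" for u w
    using assms unfolding inner_on_def by blast
  have "g (a *\<^sub>R proj x u + b *\<^sub>R proj x v) (proj x w) = a * g (proj x u) (proj x w) + b * g (proj x v) (proj x w)"
    using assms proj_in_tangent unfolding inner_on_def by blast
  then show ?thesis using n[of "a *\<^sub>R u + b *\<^sub>R v" w] n[of u w] n[of v w] by (simp add: proj_lin)
qed

lemma inner_on_linear:
  assumes "x \<in> S7" "inner_on x g"
  shows "linear (\<lambda>u. g u w)" "linear (g w)"
proof -
  show l: "linear (\<lambda>u. g u w)" 
    using inner_on_lin[OF assms, of 1 _ 1] inner_on_lin[OF assms, of _ _ 0 0 w]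
    by (intro linearI) simp_all
  have "(\<lambda>u. g u w) = g w" by (rule ext) (rule inner_on_sym[OF assms])
  then show "linear (g w)" using l by simp
qed

lemma onb_in: "onb x g e \<Longrightarrow> i < 7 \<Longrightarrow> e ! i \<in> tangent x"
  by (auto simp: onb_def tlists_def)

lemma onb_length: "onb x g e \<Longrightarrow> length e = 7"
  by (auto simp: onb_def tlists_def)

lemma onb_nth: "onb x g e \<Longrightarrow> i < 7 \<Longrightarrow> j < 7 \<Longrightarrow> g (e ! i) (e ! j) = (if i = j then 1 else 0)"
  by (simp add: onb_def)

lemma dim_tangent:
  assumes "x \<in> S7"
  shows "dim (tangent x) = 7"
proof -
  have "x \<noteq> 0" using assms by (auto simp: S7_def)
  moreover have "tangent x = {v. x \<bullet> v = 0}" by (auto simp: tangent_def inner_commute)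
  ultimately show ?thesis using dim_hyperplane[of x] by simp
qed

lemma onb_span:
  assumes x: "x \<in> S7" and g: "inner_on x g" and e: "onb x g e"
  shows "tangent x \<subseteq> span (set e)"
proof -
  have dist: "distinct e"
    unfolding distinct_conv_nth onb_length[OF e]
  proof (intro allI impI notI)
    fix i j assume "i < 7" "j < 7" "i \<noteq> j" "e ! i = e ! j"
    then show False using onb_nth[OF e, of i j] onb_nth[OF e, of j j] by simp
  qed
  have gS: "g w v = (if w = v then 1 else 0)" if vw: "v \<in> set e" "w \<in> set e" for v w
  proof -
    obtain i j where "i < 7" "w = e ! i" "j < 7" "v = e ! j"
      using vw onb_length[OF e] by (metis in_set_conv_nth)
    then show ?thesis using onb_nth[OF e, of i j] nth_eq_iff_index_eq[OF dist, of i j] onb_length[OF e] by simp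
  qed
  have "independent (set e)"
    unfolding dependent_finite[OF finite_set]
  proof (intro notI, elim exE conjE bexE)
    fix u v assume v: "v \<in> set e" "u v \<noteq> 0" and s: "(\<Sum>w\<in>set e. u w *\<^sub>R w) = 0"
    have "0 = g (\<Sum>w\<in>set e. u w *\<^sub>R w) v"
      unfolding s using linear_0[OF inner_on_linear(1)[OF x g]] by simp
    also have "\<dots> = (\<Sum>w\<in>set e. u w * g w v)"
      by (simp add: linear_sum[OF inner_on_linear(1)[OF x g]] linear_cmul[OF inner_on_linear(1)[OF x g]])
    also have "\<dots> = (\<Sum>w\<in>set e. if w = v then u v else 0)"
      using v by (intro sum.cong refl) (simp add: gS)
    also have "\<dots> = u v" using v by simp
    finally show False using v by simp
  qed
  moreover have "set e \<subseteq> tangent x" using e by (auto simp: onb_def tlists_def)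
  moreover have "dim (tangent x) \<le> card (set e)"
    using dim_tangent[OF x] distinct_card[OF dist] onb_length[OF e] by simp
  ultimately show ?thesis using card_ge_dim_independent[of "set e" "tangent x"] by blast
qed

lemma onb_expand:
  assumes x: "x \<in> S7" and g: "inner_on x g" and e: "onb x g e" and v: "v \<in> tangent x"
  shows "v = (\<Sum>i<7. g v (e ! i) *\<^sub>R e ! i)"
proof -
  note L = inner_on_linear[OF x g]
  define w where "w = v - (\<Sum>i<7. g v (e ! i) *\<^sub>R e ! i)"
  have wt: "w \<in> tangent x" unfolding w_def
    by (intro subspace_diff[OF subspace_tangent] v subspace_sum[OF subspace_tangent]
        subspace_scale[OF subspace_tangent] onb_in[OF e]) auto
  have "g w (e ! j) = 0" if "j < 7" for j
    using that by (simp add: w_def linear_diff[OF L(1)] linear_sum[OF L(1)] linear_cmul[OF L(1)] onb_nth[OF e] if_distrib cong: if_cong)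
  then have "set e \<subseteq> {u. g w u = 0}"
    using onb_length[OF e] by (metis (mono_tags, lifting) in_set_conv_nth mem_Collect_eq subsetI)
  moreover have "subspace {u. g w u = 0}"
    by (auto simp: subspace_def linear_0[OF L(2)] linear_add[OF L(2)] linear_cmul[OF L(2)])
  ultimately have "span (set e) \<subseteq> {u. g w u = 0}" by (rule span_minimal)
  then have "g w w = 0" using onb_span[OF x g e] wt by auto
  then have "w = 0" using g wt unfolding inner_on_def by (metis less_irrefl)
  then show ?thesis by (simp add: w_def)
qed

text \<open>This is the basis independence of the trace of a bilinear form.\<close>

lemma onb_trace:
  assumes x: "x \<in> S7" and g: "inner_on x g" and e: "onb x g e" and f: "onb x g f"
    and F: "\<And>v. linear (\<lambda>u. F u v)" "\<And>u. linear (F u)"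
  shows "(\<Sum>v\<leftarrow>e. F v v) = (\<Sum>v\<leftarrow>f. F v v :: real)"
proof -
  note L = inner_on_linear[OF x g]
  have exp: "F (f ! j) (f ! j) = (\<Sum>i<7. \<Sum>l<7. g (f ! j) (e ! i) * g (f ! j) (e ! l) * F (e ! i) (e ! l))"
    if "j < 7" for j
  proof -
    have E: "f ! j = (\<Sum>i<7. g (f ! j) (e ! i) *\<^sub>R e ! i)" using onb_expand[OF x g e onb_in[OF f that]] .
    have "F (f ! j) (f ! j) = (\<Sum>i<7. g (f ! j) (e ! i) * F (e ! i) (f ! j))"
      by (subst (1) E) (simp add: linear_sum[OF F(1)] linear_cmul[OF F(1)])
    also have "\<dots> = (\<Sum>i<7. g (f ! j) (e ! i) * (\<Sum>l<7. g (f ! j) (e ! l) * F (e ! i) (e ! l)))"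
    proof (rule sum.cong[OF refl])
      fix i
      have "F (e ! i) (f ! j) = (\<Sum>l<7. g (f ! j) (e ! l) * F (e ! i) (e ! l))"
        by (subst E) (simp add: linear_sum[OF F(2)] linear_cmul[OF F(2)])
      then show "g (f ! j) (e ! i) * F (e ! i) (f ! j) = g (f ! j) (e ! i) * (\<Sum>l<7. g (f ! j) (e ! l) * F (e ! i) (e ! l))"
        by simp
    qed
    finally show ?thesis by (simp add: sum_distrib_left mult.assoc)
  qed
  \<comment> \<open>Parseval: the coefficients relating two orthonormal bases form an orthogonal
    matrix.\<close>
  have par: "(\<Sum>j<7. g (f ! j) (e ! i) * g (f ! j) (e ! l)) = (if i = l then 1 else 0)"
    if "i < 7" "l < 7" for i l
  proof -
    have "g (e ! i) (e ! l) = g (\<Sum>j<7. g (e ! i) (f ! j) *\<^sub>R f ! j) (e ! l)"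
      using onb_expand[OF x g f onb_in[OF e that(1)]] by simp
    also have "\<dots> = (\<Sum>j<7. g (f ! j) (e ! i) * g (f ! j) (e ! l))"
      by (simp add: linear_sum[OF L(1)] linear_cmul[OF L(1)] inner_on_sym[OF x g, of "e ! i"])
    finally show ?thesis using onb_nth[OF e that] by simp
  qed
  have "(\<Sum>v\<leftarrow>f. F v v) = (\<Sum>j<7. \<Sum>i<7. \<Sum>l<7. g (f ! j) (e ! i) * g (f ! j) (e ! l) * F (e ! i) (e ! l))"
    by (simp add: sum_list_sum_nth onb_length[OF f] lessThan_atLeast0[symmetric] exp)
  also have "\<dots> = (\<Sum>i<7. \<Sum>l<7. (\<Sum>j<7. g (f ! j) (e ! i) * g (f ! j) (e ! l)) * F (e ! i) (e ! l))"
    unfolding sum_distrib_right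
    by (subst sum.swap, rule sum.cong[OF refl], rule sum.swap)
  also have "\<dots> = (\<Sum>i<7. F (e ! i) (e ! i))"
    by (simp add: par if_distrib[of "\<lambda>c. c * _"] cong: if_cong)
  finally show ?thesis
    by (simp add: sum_list_sum_nth onb_length[OF e] lessThan_atLeast0[symmetric])
qed

lemma tsum_lin: "tsum k (\<lambda>l. a * F l + b * G l) e = a * tsum k F e + b * tsum k G e"
proof (induction k arbitrary: F G)
  case (Suc k)
  then show ?case
    using sum_list_const_mult[of a "\<lambda>x. tsum k (\<lambda>l. F (x # l)) e" e]
      sum_list_const_mult[of b "\<lambda>x. tsum k (\<lambda>l. G (x # l)) e" e]
    by (simp add: sum_list_addf)
qed simp

text \<open>The trace argument is applied in one slot after the other.\<close>

lemma tsum_onb: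
  assumes x: "x \<in> S7" and g: "inner_on x g" and e: "onb x g e" and f: "onb x g f"
    and "malt n \<alpha>" "malt m \<beta>"
  shows "tsum k (\<lambda>l. \<alpha> l * \<beta> l) e = tsum k (\<lambda>l. \<alpha> l * \<beta> l) f"
  using assms(5,6)
proof (induction k arbitrary: n m \<alpha> \<beta>)
  case (Suc k)
  have a: "\<alpha> ((u + w) # l) = \<alpha> (u # l) + \<alpha> (w # l)" "\<alpha> (c *\<^sub>R u # l) = c * \<alpha> (u # l)" for u w c l
    using malt_add[OF Suc.prems(1), of "[]"] malt_scale[OF Suc.prems(1), of "[]"] by auto
  have b: "\<beta> ((u + w) # l) = \<beta> (u # l) + \<beta> (w # l)" "\<beta> (c *\<^sub>R u # l) = c * \<beta> (u # l)" for u w c l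
    using malt_add[OF Suc.prems(2), of "[]"] malt_scale[OF Suc.prems(2), of "[]"] by auto
  have "tsum (Suc k) (\<lambda>l. \<alpha> l * \<beta> l) e = (\<Sum>v\<leftarrow>e. tsum k (\<lambda>l. \<alpha> (v # l) * \<beta> (v # l)) f)"
    using Suc.IH[OF malt_interior[OF Suc.prems(1)] malt_interior[OF Suc.prems(2)]] by simp
  also have "\<dots> = (\<Sum>v\<leftarrow>f. tsum k (\<lambda>l. \<alpha> (v # l) * \<beta> (v # l)) f)"
  proof (rule onb_trace[OF x g e f, where F = "\<lambda>u v. tsum k (\<lambda>l. \<alpha> (u # l) * \<beta> (v # l)) f"])
    fix v
    show "linear (\<lambda>u. tsum k (\<lambda>l. \<alpha> (u # l) * \<beta> (v # l)) f)"
      using tsum_lin[where a = 1 and b = 1 and k = k and e = f] tsum_lin[where b = 0 and k = k and e = f]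
      by (intro linearI) (simp_all add: a distrib_right mult.assoc)
    show "linear (\<lambda>u. tsum k (\<lambda>l. \<alpha> (v # l) * \<beta> (u # l)) f)"
      using tsum_lin[where a = 1 and b = 1 and k = k and e = f] tsum_lin[where b = 0 and k = k and e = f]
      by (intro linearI) (simp_all add: b distrib_left mult.left_commute)
  qed
  finally show ?case by simp
qed simp

text \<open>This replaces the basis chosen by \<open>SOME\<close> in \<open>form_inner\<close> by
  any orthonormal basis at hand.\<close>

lemma form_inner_ssum:
  assumes x: "x \<in> S7" and g: "inner_on x g" and p: "onb x g p" and \<alpha>: "malt k \<alpha>" and \<beta>: "malt k \<beta>"
  shows "form_inner x g k \<alpha> \<beta> = ssum k (\<lambda>l. \<alpha> l * \<beta> l) p"
proof -
  define e where "e = (SOME e. onb x g e)"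
  have e: "onb x g e" unfolding e_def using p by (rule someI)
  have "form_inner x g k \<alpha> \<beta> = tsum k (\<lambda>l. \<alpha> l * \<beta> l) e / fact k"
    using sum_lists_tsum[where k = k and e = e and F = "\<lambda>l. \<alpha> l * \<beta> l"]
    by (simp add: form_inner_def e_def[symmetric] onb_length[OF e])
  also have "\<dots> = tsum k (\<lambda>l. \<alpha> l * \<beta> l) p / fact k"
    by (simp only: tsum_onb[OF x g e p \<alpha> \<beta>])
  also have "\<dots> = ssum k (\<lambda>l. \<alpha> l * \<beta> l) p"
    by (simp add: tsum_ssum[OF sym_fun_malt_mult[OF \<alpha> \<beta>]])
  finally show ?thesis .
qed

text \<open>In degree 7 the basis-independent sum of squares is \<open>fact 7\<close> times the
  square of the value on the basis, so all orthonormal bases give the same absolute value.\<close>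

lemma vol_form_onb:
  assumes x: "x \<in> S7" and g: "inner_on x g" and p: "onb x g p" and \<mu>: "vol_form x g \<mu>"
  shows "\<bar>\<mu> p\<bar> = 1"
proof -
  obtain e where e: "onb x g e" "\<bar>\<mu> e\<bar> = 1" and m: "malt 7 \<mu>"
    using \<mu> alt_form_malt[OF x] unfolding vol_form_def by blast
  have "\<mu> p * \<mu> p = \<mu> e * \<mu> e"
    using tsum_onb[OF x g p e(1) m m, of 7] tsum_ssum[OF sym_fun_malt_mult[OF m m], of 7 p] tsum_ssum[OF sym_fun_malt_mult[OF m m], of 7 e]
      ssum_full[where F = "\<lambda>l. \<mu> l * \<mu> l" and e = p] ssum_full[where F = "\<lambda>l. \<mu> l * \<mu> l" and e = e] onb_length[OF e(1)] onb_length[OF p]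
    by simp
  then show ?thesis using e(2) by (metis square_eq_iff abs_minus_cancel)
qed

text \<open>Equality of the products \<open>g * \<mu>\<close> only gives \<open>g' = c g\<close> and
  \<open>\<mu> = c \<mu>'\<close>. The normalisation of the volume form fixes the scale:
  \<open>\<bar>\<mu>' e\<bar>\<close> equals both \<open>c\<close> to the power 7/2 and
  \<open>1 / c\<close>, so \<open>sqrt c ^ 9 = 1\<close> and \<open>c = 1\<close>.\<close>

lemma pos_data_unique:
  assumes x: "x \<in> S7" and 1: "pos_data x \<phi> g \<mu>" and 2: "pos_data x \<phi> g' \<mu>'"
  shows "g = g' \<and> \<mu> = \<mu>'"
proof -
  have g: "inner_on x g" and g': "inner_on x g'" and v: "vol_form x g \<mu>" and v': "vol_form x g' \<mu>'"
    using 1 2 by (auto simp: pos_data_def)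
  have m: "malt 7 \<mu>" "malt 7 \<mu>'" using v v' alt_form_malt[OF x] by (auto simp: vol_form_def)
  have eq: "g X Y * \<mu> vs = g' X Y * \<mu>' vs" if "X \<in> tangent x" "Y \<in> tangent x" "vs \<in> tlists x 7" for X Y vs
    using 1 2 that unfolding pos_data_def by metis
  obtain e where e: "onb x g e" "\<bar>\<mu> e\<bar> = 1" using v by (auto simp: vol_form_def)
  have et: "e \<in> tlists x 7" using e by (simp add: onb_def)
  define c where "c = \<mu> e / \<mu>' e"
  have ne: "\<mu> e \<noteq> 0" using e(2) by auto
  have ne': "\<mu>' e \<noteq> 0"
    using eq[OF onb_in[OF e(1)] onb_in[OF e(1)] et, of 0 0] onb_nth[OF e(1), of 0 0] ne by auto
  have gc: "g' (e ! i) (e ! j) = (if i = j then c else 0)" if "i < 7" "j < 7" for i j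
    using eq[OF onb_in[OF e(1)] onb_in[OF e(1)] et, of i j] that ne' onb_nth[OF e(1), of i j]
    by (auto simp: c_def field_simps split: if_splits)
  have cpos: "c > 0"
  proof -
    have "e ! 0 \<noteq> 0"
      using onb_nth[OF e(1), of 0 0] linear_0[OF inner_on_linear(2)[OF x g, of "e ! 0"]] by auto
    then have "g' (e ! 0) (e ! 0) > 0" using g' onb_in[OF e(1), of 0] by (auto simp: inner_on_def)
    then show ?thesis using gc[of 0 0] by simp
  qed
  \<comment> \<open>The \<open>g\<close>-orthonormal basis, rescaled to be orthonormal for
    \<open>g'\<close>.\<close>
  define e' where "e' = map (\<lambda>v. (1 / sqrt c) *\<^sub>R v) e"
  have len': "length e' = 7" by (simp add: e'_def onb_length[OF e(1)])
  have nth': "e' ! i = (1 / sqrt c) *\<^sub>R e ! i" if "i < 7" for i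
    using that by (simp add: e'_def onb_length[OF e(1)])
  have "set e' \<subseteq> tangent x"
    using nth' len' subspace_scale[OF subspace_tangent onb_in[OF e(1)]]
    by (metis in_set_conv_nth subsetI)
  moreover have "g' (e' ! i) (e' ! j) = (if i = j then 1 else 0)" if "i < 7" "j < 7" for i j
    using that gc[OF that] cpos
    by (simp add: nth' linear_cmul[OF inner_on_linear(1)[OF x g']] linear_cmul[OF inner_on_linear(2)[OF x g']])
  ultimately have "onb x g' e'" using len' by (simp add: onb_def tlists_def)
  then have "\<bar>\<mu>' e'\<bar> = 1" by (rule vol_form_onb[OF x g' _ v'])
  moreover have "\<mu>' e' = (1 / sqrt c) ^ 7 * \<mu>' e"
  proof -
    have "\<mu>' (map (\<lambda>v. s *\<^sub>R v) xs @ ys) = s ^ length xs * \<mu>' (xs @ ys)" for s xs ys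
    proof (induction xs arbitrary: ys rule: rev_induct)
      case (snoc z xs)
      then show ?case using malt_scale[OF m(2), of "map (\<lambda>v. s *\<^sub>R v) xs" s z ys] by simp
    qed simp
    from this[of "1 / sqrt c" e "[]"] show ?thesis by (simp add: e'_def onb_length[OF e(1)])
  qed
  ultimately have "(1 / sqrt c) ^ 7 * \<bar>\<mu>' e\<bar> = 1"
    using cpos by (simp add: abs_mult power_abs)
  moreover have "\<bar>\<mu>' e\<bar> * c = 1"
  proof -
    have "\<bar>c\<bar> = 1 / \<bar>\<mu>' e\<bar>" by (simp add: c_def e(2))
    then show ?thesis using cpos ne' by simp
  qed
  ultimately have "sqrt c ^ 9 = 1"
  proof -
    assume a: "(1 / sqrt c) ^ 7 * \<bar>\<mu>' e\<bar> = 1" and b: "\<bar>\<mu>' e\<bar> * c = 1"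
    have "sqrt c ^ 9 = sqrt c ^ 7 * c" using cpos by (simp add: power_numeral_reduce)
    also have "sqrt c ^ 7 = \<bar>\<mu>' e\<bar>" using a cpos by (simp add: field_simps)
    finally show ?thesis using b by simp
  qed
  then have "sqrt c = 1" using cpos power_eq_imp_eq_base[of "sqrt c" 9 1] by simp
  then have c1: "c = 1" by simp
  have \<mu>e: "\<mu> e = \<mu>' e" using c1 ne' by (simp add: c_def)
  have eqt: "\<mu> vs = \<mu>' vs" if "set vs \<subseteq> tangent x" for vs
    using that onb_span[OF x g e(1)] by (intro malt_top_eqI[OF m onb_length[OF e(1)] \<mu>e]) auto
  have "\<mu> = \<mu>'"
  proof
    fix vs show "\<mu> vs = \<mu>' vs"
    using eqt[OF set_map_proj[OF x], of vs] alt_form_proj[OF x, of 7 \<mu> vs] alt_form_proj[OF x, of 7 \<mu>' vs] v v'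
    by (simp add: vol_form_def)
  qed
  moreover have "g = g'"
  proof (intro ext)
    fix u w
    have "g u w = g (proj x u) (proj x w)" "g' u w = g' (proj x u) (proj x w)"
      using g g' unfolding inner_on_def by blast+
    then show "g u w = g' u w"
      using eq[OF proj_in_tangent[OF x] proj_in_tangent[OF x] et, of u w] \<mu>e ne by simp
  qed
  ultimately show ?thesis by simp
qed

lemma pos_data_metric_vol:
  assumes "x \<in> S7" "pos_data x \<phi> g \<mu>"
  shows "metric_of x \<phi> = g" "vol_of x \<phi> = \<mu>"
proof -
  have "(THE (g, \<mu>). pos_data x \<phi> g \<mu>) = (g, \<mu>)"
  proof (rule the_equality)
    show "case (g, \<mu>) of (g, \<mu>) \<Rightarrow> pos_data x \<phi> g \<mu>" using assms(2) by simp
    fix p assume "case p of (g, \<mu>) \<Rightarrow> pos_data x \<phi> g \<mu>"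
    then have "pos_data x \<phi> (fst p) (snd p)" by (simp add: case_prod_unfold)
    from pos_data_unique[OF assms(1) this assms(2)] show "p = (g, \<mu>)" by (simp add: prod_eq_iff)
  qed
  then show "metric_of x \<phi> = g" "vol_of x \<phi> = \<mu>"
    by (simp_all add: metric_of_def vol_of_def)
qed

text \<open>A component \<open>\<delta> J\<close> is detected by inserting \<open>J\<close> into the
  last slots of the volume form: the resulting test form kills every vector of \<open>J\<close>, so
  its product with \<open>\<delta>\<close> on the basis is a nonzero multiple of
  \<open>\<delta> J\<close>.\<close>

lemma wedge_nondegenerate:
  assumes x: "x \<in> S7" and g: "inner_on x g" and p: "onb x g p" and v: "vol_form x g \<mu>"
    and k: "k \<le> 7" and \<delta>: "alt_form x (7 - k) \<delta>"
    and z: "\<And>\<beta>. alt_form x k \<beta> \<Longrightarrow> wedge k (7 - k) \<beta> \<delta> p = 0"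
  shows "\<delta> vs = 0"
proof -
  have m: "malt 7 \<mu>" and md: "malt (7 - k) \<delta>" using v \<delta> alt_form_malt[OF x] by (auto simp: vol_form_def)
  have ne: "\<mu> p \<noteq> 0" using vol_form_onb[OF x g p v] by auto
  have "\<delta> J = 0" if J: "p \<in> shuffles I J" "length J = 7 - k" for I J
  proof -
    define \<beta> where "\<beta> vs = \<mu> (vs @ J)" for vs
    have "length I + length J = 7" using length_shuffles[OF J(1)] onb_length[OF p] by simp
    then have lI: "length I = k" using J(2) k by simp
    have mb: "malt k \<beta>"
    proof (rule maltI)
      show "\<beta> vs = 0" if "length vs \<noteq> k" for vs
        unfolding \<beta>_def using that J(2) k by (intro malt_length[OF m]) simp
      show "\<beta> (xs @ (a *\<^sub>R u + b *\<^sub>R w) # ys) = a * \<beta> (xs @ u # ys) + b * \<beta> (xs @ w # ys)" for xs ys u w a b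
        using malt_lin[OF m, of xs a u b w "ys @ J"] by (simp add: \<beta>_def)
      show "\<beta> (xs @ u # u # ys) = 0" for xs ys u
        using malt_rep[OF m, of xs u "ys @ J"] by (simp add: \<beta>_def)
    qed
    have "set p = set I \<union> set J" using set_shuffles[OF J(1)] by simp
    then have Jt: "set J \<subseteq> tangent x" using p by (auto simp: onb_def tlists_def)
    have "alt_form x k \<beta>"
    proof (rule alt_formI[OF mb])
      fix vs
      show "\<beta> (map (proj x) vs) = \<beta> vs"
        using v alt_form_proj[OF x, of 7 \<mu> "vs @ J"] by (simp add: \<beta>_def vol_form_def map_proj_tangent[OF Jt])
    qed
    from z[OF this] have "shuf k (7 - k) \<beta> \<delta> p = 0" by (simp add: wedge_shuf[OF mb md])
    moreover have "\<beta> (xs @ u # ys) = 0" if u: "u \<in> set J" for u xs ys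
    proof -
      obtain J1 J2 where "J = J1 @ u # J2" using split_list[OF u] by blast
      then show ?thesis using malt_eq_entries[OF m, of xs u "ys @ J1" J2] by (simp add: \<beta>_def)
    qed
    with shuf_single[OF J(1) lI J(2), of \<beta> \<delta>]
    obtain s where "s \<noteq> 0" "shuf k (7 - k) \<beta> \<delta> p = s * \<beta> I * \<delta> J" by blast
    moreover have "\<beta> I \<noteq> 0"
      using malt_shuffles[OF J(1) m] ne by (auto simp: \<beta>_def)
    ultimately show ?thesis by simp
  qed
  then have "ssum (7 - k) (\<lambda>l. (\<delta> l - 0) * (\<delta> l - 0)) p = 0" by (intro ssum_zero_shuffles) auto
  then have "\<delta> vs = 0" if "set vs \<subseteq> tangent x" for vs
    using malt_eqI[OF md malt_zero_form, of p vs] onb_span[OF x g p] that by auto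
  from this[OF set_map_proj[OF x], of vs] show ?thesis
    by (simp add: alt_form_proj[OF x \<delta>])
qed

text \<open>Turns the definite description into one identity in one orthonormal basis.
  \<open>E\<close> is asked for arbitrary functions \<open>\<beta>\<close>: both sides are linear in
  the values of \<open>\<beta>\<close> on the sublists of \<open>p\<close>, so comparing these
  coefficients suffices. Uniqueness is nondegeneracy applied to the difference of two
  candidates.\<close>

lemma hodge_at_eqI:
  assumes x: "x \<in> S7" and g: "inner_on x g" and p: "onb x g p" and v: "vol_form x g \<mu>"
    and k: "k \<le> 7" and \<alpha>: "alt_form x k \<alpha>" and \<gamma>: "alt_form x (7 - k) \<gamma>"
    and E: "\<And>\<beta>. shuf k (7 - k) \<beta> \<gamma> p = ssum k (\<lambda>l. \<beta> l * \<alpha> l) p * \<mu> p"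
  shows "hodge_at x g \<mu> k \<alpha> = \<gamma>"
  unfolding hodge_at_def
proof (rule the_equality)
  have m: "malt 7 \<mu>" using v alt_form_malt[OF x] by (auto simp: vol_form_def)
  have pt: "p \<in> tlists x 7" using p by (simp add: onb_def)
  have W: "wedge k (7 - k) \<beta> \<gamma> vs = form_inner x g k \<beta> \<alpha> * \<mu> vs"
    if \<beta>: "alt_form x k \<beta>" and vs: "vs \<in> tlists x 7" for \<beta> vs
  proof -
    note mm = alt_form_malt[OF x \<beta>] alt_form_malt[OF x \<gamma>] alt_form_malt[OF x \<alpha>]
    have 1: "malt 7 (wedge k (7 - k) \<beta> \<gamma>)" using malt_wedge[OF mm(1,2)] k by simp
    have 2: "malt 7 (\<lambda>vs. form_inner x g k \<beta> \<alpha> * \<mu> vs)" by (rule malt_cmult[OF m])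
    have 3: "wedge k (7 - k) \<beta> \<gamma> p = form_inner x g k \<beta> \<alpha> * \<mu> p"
      by (simp only: wedge_shuf[OF mm(1,2)] form_inner_ssum[OF x g p mm(1,3)] E)
    have "set vs \<subseteq> span (set p)" using vs onb_span[OF x g p] unfolding tlists_def by blast
    then show ?thesis by (rule malt_top_eqI[OF 1 2 onb_length[OF p] 3])
  qed
  then show "alt_form x (7 - k) \<gamma> \<and> (\<forall>\<beta>. alt_form x k \<beta> \<longrightarrow>
      (\<forall>vs\<in>tlists x 7. wedge k (7 - k) \<beta> \<gamma> vs = form_inner x g k \<beta> \<alpha> * \<mu> vs))"
    by (intro conjI allI impI ballI \<gamma>)
  fix \<gamma>' assume \<gamma>': "alt_form x (7 - k) \<gamma>' \<and> (\<forall>\<beta>. alt_form x k \<beta> \<longrightarrow>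
      (\<forall>vs\<in>tlists x 7. wedge k (7 - k) \<beta> \<gamma>' vs = form_inner x g k \<beta> \<alpha> * \<mu> vs))"
  let ?\<delta> = "\<lambda>l. 1 * \<gamma>' l + (-1) * \<gamma> l"
  have "alt_form x (7 - k) ?\<delta>"
  proof (rule alt_formI)
    show "malt (7 - k) ?\<delta>"
      using \<gamma>' by (intro malt_lincomb alt_form_malt[OF x] \<gamma>) blast
    show "?\<delta> (map (proj x) vs) = ?\<delta> vs" for vs
      using alt_form_proj[OF x \<gamma>, of vs] alt_form_proj[OF x conjunct1[OF \<gamma>'], of vs] by simp
  qed
  moreover have "wedge k (7 - k) \<beta> ?\<delta> p = 0" if "alt_form x k \<beta>" for \<beta>
  proof -
    have "wedge k (7 - k) \<beta> \<gamma>' p = form_inner x g k \<beta> \<alpha> * \<mu> p"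
      using conjunct2[OF \<gamma>'] that pt by blast
    then show ?thesis unfolding wedge_lin_right W[OF that pt] by simp
  qed
  ultimately have "?\<delta> vs = 0" for vs by (rule wedge_nondegenerate[OF x g p v k])
  then show "\<gamma>' = \<gamma>" by (intro ext) (simp add: algebra_simps)
qed

section \<open>The quaternionic hermitian product and the invariant forms\<close>

lemma qmul_assoc: "qmul (qmul p q) r = qmul p (qmul q r)"
  by (cases p; cases q; cases r) (simp add: qmul_def algebra_simps)

lemma qmul_add_left: "qmul (p + q) r = qmul p r + qmul q r"
  by (cases p; cases q; cases r) (simp add: qmul_def algebra_simps)

lemma qmul_add_right: "qmul r (p + q) = qmul r p + qmul r q"
  by (cases p; cases q; cases r) (simp add: qmul_def algebra_simps)

lemma qmul_scaleR_left: "qmul (c *\<^sub>R p) q = c *\<^sub>R qmul p q"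
  by (cases p; cases q) (simp add: qmul_def algebra_simps)

lemma qmul_scaleR_right: "qmul p (c *\<^sub>R q) = c *\<^sub>R qmul p q"
  by (cases p; cases q) (simp add: qmul_def algebra_simps)

lemma qconj_add: "qconj (p + q) = qconj p + qconj q"
  by (cases p; cases q) (simp add: qconj_def)

lemma qconj_scaleR: "qconj (c *\<^sub>R p) = c *\<^sub>R qconj p"
  by (cases p) (simp add: qconj_def)

lemma qconj_qmul: "qconj (qmul p q) = qmul (qconj q) (qconj p)"
  by (cases p; cases q) (simp add: qmul_def qconj_def algebra_simps)

lemma qconj_qconj: "qconj (qconj p) = p"
  by (cases p) (simp add: qconj_def)

lemma qmul_qone: "qmul qone p = p" "qmul p qone = p"
  by (cases p, simp add: qmul_def qone_def)+

lemma qmul_zero: "qmul 0 p = 0" "qmul p 0 = 0"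
  by (cases p, simp add: qmul_def zero_prod_def)+

lemma qzero_0: "qzero = 0"
  by (simp add: qzero_def zero_prod_def)

lemma qnorm_sq: "(norm (a, b, c, d))\<^sup>2 = a\<^sup>2 + b\<^sup>2 + c\<^sup>2 + d\<^sup>2" for a b c d :: real
  by (simp add: norm_Pair)

lemma qmul_qconj_self: "qmul (qconj q) q = (norm q)\<^sup>2 *\<^sub>R qone"
proof (cases q)
  case (fields a b c d)
  then show ?thesis
    unfolding fields qnorm_sq by (simp add: qmul_def qconj_def qone_def power2_eq_square algebra_simps)
qed

lemma norm_qconj: "norm (qconj q) = norm q"
  by (cases q) (simp add: qconj_def norm_Pair)

lemma norm_V_sq: "(norm x)\<^sup>2 = (norm (fst x))\<^sup>2 + (norm (snd x))\<^sup>2" for x :: V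
  by (cases x) (simp add: norm_Pair)

text \<open>Sp(2) preserves this product, and the Sp(1) factor conjugates its values. Hence the real
  part, the inner product, is fixed and the imaginary part is rotated; invariants are built from
  this.\<close>

definition hq :: "V \<Rightarrow> V \<Rightarrow> quat" where
  "hq u v = qmul (qconj (fst u)) (fst v) + qmul (qconj (snd u)) (snd v)"

lemma hq_add: "hq (u + w) v = hq u v + hq w v" "hq v (u + w) = hq v u + hq v w"
  by (simp_all add: hq_def qmul_add_left qmul_add_right qconj_add)

lemma hq_scaleR: "hq (c *\<^sub>R u) v = c *\<^sub>R hq u v" "hq v (c *\<^sub>R u) = c *\<^sub>R hq v u"
  by (simp_all add: hq_def qmul_scaleR_left qmul_scaleR_right qconj_scaleR scaleR_add_right)

lemma hq_swap: "hq v u = qconj (hq u v)"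
  by (simp add: hq_def qconj_add qconj_qmul qconj_qconj)

lemma hq_qmat_apply:
  assumes "A \<in> Sp2"
  shows "hq (qmat_apply A u) (qmat_apply A v) = hq u v"
proof -
  obtain a b c d where A: "A = (a, b, c, d)" by (metis surj_pair)
  obtain u1 u2 v1 v2 where uv: "u = (u1, u2)" "v = (v1, v2)" by (metis surj_pair)
  have S: "qmul (qconj a) a + qmul (qconj c) c = qone" "qmul (qconj a) b + qmul (qconj c) d = 0"
    "qmul (qconj b) a + qmul (qconj d) c = 0" "qmul (qconj b) b + qmul (qconj d) d = qone"
    using assms by (auto simp: Sp2_def A qzero_0)
  have "hq (qmat_apply A u) (qmat_apply A v) =
      qmul (qconj u1) (qmul (qmul (qconj a) a + qmul (qconj c) c) v1)
    + qmul (qconj u1) (qmul (qmul (qconj a) b + qmul (qconj c) d) v2)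
    + qmul (qconj u2) (qmul (qmul (qconj b) a + qmul (qconj d) c) v1)
    + qmul (qconj u2) (qmul (qmul (qconj b) b + qmul (qconj d) d) v2)"
    by (simp add: hq_def qmat_apply_def A uv qconj_add qconj_qmul qmul_add_left qmul_add_right qmul_assoc algebra_simps)
  then show ?thesis unfolding S by (simp add: qmul_qone qmul_zero hq_def uv)
qed

lemma hq_sp_act:
  assumes "A \<in> Sp2"
  shows "hq (sp_act A q u) (sp_act A q v) = qmul q (qmul (hq u v) (qconj q))"
proof -
  have "hq (sp_act A q u) (sp_act A q v) = qmul q (qmul (hq (qmat_apply A u) (qmat_apply A v)) (qconj q))"
    by (simp add: sp_act_def hq_def case_prod_beta qconj_qmul qconj_qconj qmul_assoc qmul_add_left qmul_add_right)
  then show ?thesis by (simp add: hq_qmat_apply[OF assms])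
qed

text \<open>The imaginary components of \<open>hq\<close>: \<open>s1 x\<close>, \<open>s2 x\<close>, \<open>s3 x\<close> are the contact forms \<open>\<eta>\<^sub>1, \<eta>\<^sub>2, \<eta>\<^sub>3\<close> of the
  3-Sasakian structure at \<open>x\<close>, and as constant 2-forms on the ambient space they are \<open>d\<eta>\<^sub>i / 2\<close>.\<close>

definition s1 :: "V \<Rightarrow> V \<Rightarrow> real" where "s1 u v = fst (snd (hq u v))"
definition s2 :: "V \<Rightarrow> V \<Rightarrow> real" where "s2 u v = fst (snd (snd (hq u v)))"
definition s3 :: "V \<Rightarrow> V \<Rightarrow> real" where "s3 u v = snd (snd (snd (hq u v)))"

lemmas s_defs = s1_def s2_def s3_def

lemma inner_hq: "inner u v = fst (hq u v)"
proof -
  obtain a b c d a' b' c' d' where u: "u = ((a, b, c, d), a', b', c', d')" by (metis surj_pair)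
  obtain e f g h e' f' g' h' where v: "v = ((e, f, g, h), e', f', g', h')" by (metis surj_pair)
  show ?thesis by (simp add: u v hq_def qmul_def qconj_def)
qed

lemma s_add:
  "s1 (u + w) v = s1 u v + s1 w v" "s2 (u + w) v = s2 u v + s2 w v" "s3 (u + w) v = s3 u v + s3 w v"
  "s1 v (u + w) = s1 v u + s1 v w" "s2 v (u + w) = s2 v u + s2 v w" "s3 v (u + w) = s3 v u + s3 v w"
  by (simp_all add: s_defs hq_add)

lemma s_scaleR:
  "s1 (c *\<^sub>R u) v = c * s1 u v" "s2 (c *\<^sub>R u) v = c * s2 u v" "s3 (c *\<^sub>R u) v = c * s3 u v"
  "s1 v (c *\<^sub>R u) = c * s1 v u" "s2 v (c *\<^sub>R u) = c * s2 v u" "s3 v (c *\<^sub>R u) = c * s3 v u"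
  by (simp_all add: s_defs hq_scaleR)

lemma s_self: "s1 u u = 0" "s2 u u = 0" "s3 u u = 0"
proof -
  have "qconj (hq u u) = hq u u" by (simp flip: hq_swap)
  then show "s1 u u = 0" "s2 u u = 0" "s3 u u = 0"
    by (cases "hq u u"; simp add: s_defs qconj_def)+
qed

lemma s_swap: "s1 v u = - s1 u v" "s2 v u = - s2 u v" "s3 v u = - s3 u v"
  unfolding s_defs hq_swap[of v u] by (cases "hq u v"; simp add: qconj_def)+

definition det3 :: "real \<times> real \<times> real \<Rightarrow> real \<times> real \<times> real \<Rightarrow> real \<times> real \<times> real \<Rightarrow> real" where
  "det3 p q r = (case p of (p1, p2, p3) \<Rightarrow> case q of (q1, q2, q3) \<Rightarrow> case r of (r1, r2, r3) \<Rightarrow>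
     p1 * (q2 * r3 - q3 * r2) - p2 * (q1 * r3 - q3 * r1) + p3 * (q1 * r2 - q2 * r1))"

definition sv :: "V \<Rightarrow> V \<Rightarrow> real \<times> real \<times> real" where
  "sv u v = (s1 u v, s2 u v, s3 u v)"

definition tq :: "V \<Rightarrow> V \<Rightarrow> V \<Rightarrow> V \<Rightarrow> real" where
  "tq x u v w = det3 (sv x u) (sv x v) (sv x w)"

text \<open>Half the sum of the squares \<open>s\<^sub>i \<and> s\<^sub>i\<close>. With the base
  point \<open>x\<close> in the first slot it is the 3-form given by the sum of
  \<open>\<eta>\<^sub>i \<and> s\<^sub>i\<close>.\<close>

definition kq :: "V \<Rightarrow> V \<Rightarrow> V \<Rightarrow> V \<Rightarrow> real" where
  "kq u v w z = inner (sv u v) (sv w z) - inner (sv u w) (sv v z) + inner (sv u z) (sv v w)"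

text \<open>The sum of \<open>\<eta>\<^sub>j\<^sub>k \<and> s\<^sub>i\<close> over cyclic
  \<open>(i, j, k)\<close>, the cross product of two values of \<open>\<eta>\<close> being paired
  with a value of \<open>s\<close>.\<close>

definition qq :: "V \<Rightarrow> V \<Rightarrow> V \<Rightarrow> V \<Rightarrow> V \<Rightarrow> real" where
  "qq x u v w z = det3 (sv x u) (sv x v) (sv w z) - det3 (sv x u) (sv x w) (sv v z) + det3 (sv x u) (sv x z) (sv v w)
     + det3 (sv x v) (sv x w) (sv u z) - det3 (sv x v) (sv x z) (sv u w) + det3 (sv x w) (sv x z) (sv u v)"

lemmas q_defs = tq_def kq_def qq_def det3_def sv_def

text \<open>With \<open>\<omega>\<^sub>i\<close> the horizontal part of \<open>d\<eta>\<^sub>i / 2\<close>, these are \<open>a \<eta>\<^sub>1\<^sub>2\<^sub>3 + b \<Sum> \<eta>\<^sub>i \<and> \<omega>\<^sub>i\<close> and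
  \<open>c \<Sum> \<eta>\<^sub>j\<^sub>k \<and> \<omega>\<^sub>i + d \<omega>\<^sub>1\<^sup>2 / 2\<close>.\<close>

definition Phi :: "real \<Rightarrow> real \<Rightarrow> V \<Rightarrow> V list \<Rightarrow> real" where
  "Phi a b x vs = (if x \<in> S7 then (case vs of [u, v, w] \<Rightarrow> (a + 3 * b) * tq x u v w + b * kq x u v w | _ \<Rightarrow> 0) else 0)"

definition Psi :: "real \<Rightarrow> real \<Rightarrow> V \<Rightarrow> V list \<Rightarrow> real" where
  "Psi c d x vs = (if x \<in> S7 then (case map (proj x) vs of [u, v, w, z] \<Rightarrow> (c + d / 3) * qq x u v w z + d / 3 * kq u v w z | _ \<Rightarrow> 0) else 0)"

lemma sv_proj: "sv x (proj x u) = sv x u"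
  using s_add(4-6)[of x "proj x u" "(inner u x) *\<^sub>R x"] by (simp add: sv_def proj_def s_scaleR s_self)

lemma length_eq_3_conv: "length vs = 3 \<longleftrightarrow> (\<exists>u v w. vs = [u, v, w])"
  by (auto simp: numeral_3_eq_3 length_Suc_conv)

lemma length_eq_4_conv: "length vs = 4 \<longleftrightarrow> (\<exists>u v w z. vs = [u, v, w, z])"
  by (auto simp: numeral_eq_Suc length_Suc_conv)

lemma Phi_3: "x \<in> S7 \<Longrightarrow> Phi a b x [u, v, w] = (a + 3 * b) * tq x u v w + b * kq x u v w"
  by (simp add: Phi_def)

lemma Phi_not_3: "length vs \<noteq> 3 \<Longrightarrow> Phi a b x vs = 0"
  by (auto simp add: Phi_def numeral_3_eq_3 split: list.splits)

lemma Psi_4: "x \<in> S7 \<Longrightarrow> Psi c d x [u, v, w, z] = (c + d / 3) * qq x (proj x u) (proj x v) (proj x w) (proj x z)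
    + d / 3 * kq (proj x u) (proj x v) (proj x w) (proj x z)"
  by (simp add: Psi_def)

lemma Psi_not_4: "length vs \<noteq> 4 \<Longrightarrow> Psi a b x vs = 0"
  by (auto simp add: Psi_def numeral_eq_Suc split: list.splits)

lemma sv_lin: "sv (a *\<^sub>R u + b *\<^sub>R w) v = a *\<^sub>R sv u v + b *\<^sub>R sv w v"
  "sv v (a *\<^sub>R u + b *\<^sub>R w) = a *\<^sub>R sv v u + b *\<^sub>R sv v w"
  by (simp_all add: sv_def s_add s_scaleR)

lemma sv_self: "sv u u = 0"
  by (simp add: sv_def s_self zero_prod_def)

lemma malt_Phi:
  assumes x: "x \<in> S7"
  shows "malt 3 (Phi a b x)"
proof (rule maltI)
  show "Phi a b x vs = 0" if "length vs \<noteq> 3" for vs using Phi_not_3[OF that] .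
next
  fix xs ys and u w :: V and c d
  let ?P = "\<lambda>v. Phi a b x (xs @ v # ys)"
  show "?P (c *\<^sub>R u + d *\<^sub>R w) = c * ?P u + d * ?P w"
  proof (cases "length (xs @ u # ys) = 3")
    case True
    then consider y z where "xs = []" "ys = [y, z]" | y z where "xs = [y]" "ys = [z]" | y z where "xs = [y, z]" "ys = []"
      unfolding length_eq_3_conv by (auto simp: append_eq_Cons_conv Cons_eq_append_conv)
    then show ?thesis
      by cases (simp_all add: Phi_3[OF x] q_defs s_add s_scaleR inner_add_left inner_add_right algebra_simps)
  qed (simp add: Phi_not_3)
next
  fix xs ys and u :: V
  show "Phi a b x (xs @ u # u # ys) = 0"
  proof (cases "length (xs @ u # u # ys) = 3")
    case True
    then consider z where "xs = []" "ys = [z]" | z where "xs = [z]" "ys = []"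
      unfolding length_eq_3_conv by (auto simp: append_eq_Cons_conv Cons_eq_append_conv)
    then show ?thesis
      by cases (simp_all add: Phi_3[OF x] q_defs s_self algebra_simps)
  qed (simp add: Phi_not_3)
qed

lemma malt_Psi:
  assumes x: "x \<in> S7"
  shows "malt 4 (Psi a b x)"
proof (rule maltI)
  show "Psi a b x vs = 0" if "length vs \<noteq> 4" for vs using Psi_not_4[OF that] .
next
  fix xs ys and u w :: V and c d
  let ?P = "\<lambda>v. Psi a b x (xs @ v # ys)"
  show "?P (c *\<^sub>R u + d *\<^sub>R w) = c * ?P u + d * ?P w"
  proof (cases "length (xs @ u # ys) = 4")
    case True
    then consider y z t where "xs = []" "ys = [y, z, t]" | y z t where "xs = [y]" "ys = [z, t]"
      | y z t where "xs = [y, z]" "ys = [t]" | y z t where "xs = [y, z, t]" "ys = []"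
      unfolding length_eq_4_conv by (auto simp: append_eq_Cons_conv Cons_eq_append_conv)
    then show ?thesis
      by cases (simp_all add: Psi_4[OF x] proj_lin q_defs s_add s_scaleR inner_add_left inner_add_right algebra_simps)
  qed (simp add: Psi_not_4)
next
  fix xs ys and u :: V
  show "Psi a b x (xs @ u # u # ys) = 0"
  proof (cases "length (xs @ u # u # ys) = 4")
    case True
    then consider z t where "xs = []" "ys = [z, t]" | z t where "xs = [z]" "ys = [t]" | z t where "xs = [z, t]" "ys = []"
      unfolding length_eq_4_conv by (auto simp: append_eq_Cons_conv Cons_eq_append_conv)
    then show ?thesis
      by cases (simp_all add: Psi_4[OF x] q_defs s_self algebra_simps)
  qed (simp add: Psi_not_4)
qed

lemma kq_alt: "kq u u v w = 0" "kq u v v w = 0" "kq u v w w = 0" "kq u v u w = 0" "kq u v w u = 0" "kq u v w v = 0"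
  using s_swap[of u v] s_swap[of u w] s_swap[of v w]
  by (simp_all add: q_defs s_self algebra_simps)

lemma kq_lin: "kq u (v + c *\<^sub>R z) w t = kq u v w t + c * kq u z w t"
  "kq u v (w + c *\<^sub>R z) t = kq u v w t + c * kq u v z t" "kq u v w (t + c *\<^sub>R z) = kq u v w t + c * kq u v w z"
  by (simp_all add: q_defs s_add s_scaleR algebra_simps)

text \<open>With \<open>x\<close> in one slot, a multiple of \<open>x\<close> added in another
  contributes nothing. This is why \<open>Phi\<close> can be written without \<open>proj\<close>,
  whereas \<open>Psi\<close> contains \<open>kq\<close> without the base point.\<close>

lemma kq_proj: "kq x (proj x u) (proj x v) (proj x w) = kq x u v w"
  using kq_lin[where z = x and u = x] unfolding proj_def
  by (metis (no_types, lifting) add_cancel_right_right diff_conv_add_uminus kq_alt(1,4,5) mult_zero_right scaleR_minus_left)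

lemma alt_form_Phi: "x \<in> S7 \<Longrightarrow> alt_form x 3 (Phi a b x)"
  by (intro alt_formI malt_Phi) (auto simp: length_eq_3_conv Phi_3 tq_def sv_proj kq_proj)

lemma alt_form_Psi: "x \<in> S7 \<Longrightarrow> alt_form x 4 (Psi a b x)"
  by (intro alt_formI malt_Psi) (auto simp: length_eq_4_conv Psi_4 proj_tangent proj_in_tangent)

section \<open>Invariance under the group and transitivity on the sphere\<close>

lemma Sp1_norm: "q \<in> Sp1 \<Longrightarrow> q = (a, b, c, d) \<Longrightarrow> a\<^sup>2 + b\<^sup>2 + c\<^sup>2 + d\<^sup>2 = 1"
  using qnorm_sq[of a b c d] by (simp add: Sp1_def)

text \<open>The Euler-Rodrigues matrix of the map sending an imaginary quaternion \<open>p\<close>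
  to \<open>q p\<close> times the conjugate of \<open>q\<close>.\<close>

definition rot :: "quat \<Rightarrow> real \<times> real \<times> real \<Rightarrow> real \<times> real \<times> real" where
  "rot q p = (case q of (a, b, c, d) \<Rightarrow> case p of (x, y, z) \<Rightarrow>
     ((a\<^sup>2 + b\<^sup>2 - c\<^sup>2 - d\<^sup>2) * x + 2 * (b * c - a * d) * y + 2 * (b * d + a * c) * z,
      2 * (b * c + a * d) * x + (a\<^sup>2 - b\<^sup>2 + c\<^sup>2 - d\<^sup>2) * y + 2 * (c * d - a * b) * z,
      2 * (b * d - a * c) * x + 2 * (c * d + a * b) * y + (a\<^sup>2 - b\<^sup>2 - c\<^sup>2 + d\<^sup>2) * z))"

lemma sv_sp_act:
  assumes "A \<in> Sp2"
  shows "sv (sp_act A q u) (sp_act A q v) = rot q (sv u v)"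
  by (cases q; cases "hq u v")
    (simp add: sv_def s_defs hq_sp_act[OF assms] rot_def qmul_def qconj_def power2_eq_square algebra_simps)

lemma inner_sp_act:
  assumes "A \<in> Sp2" "q \<in> Sp1"
  shows "inner (sp_act A q u) (sp_act A q v) = inner u v"
proof -
  obtain a b c d where q: "q = (a, b, c, d)" by (metis surj_pair)
  obtain r x y z where h: "hq u v = (r, x, y, z)" by (metis surj_pair)
  have "inner (sp_act A q u) (sp_act A q v) = (a\<^sup>2 + b\<^sup>2 + c\<^sup>2 + d\<^sup>2) * inner u v"
    unfolding inner_hq hq_sp_act[OF assms(1)] h q
    by (simp add: qmul_def qconj_def power2_eq_square algebra_simps)
  then show ?thesis by (simp add: Sp1_norm[OF assms(2) q])
qed

lemma inner_rot:
  assumes "q \<in> Sp1"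
  shows "inner (rot q p) (rot q p') = inner p p'"
proof -
  obtain a b c d where q: "q = (a, b, c, d)" by (metis surj_pair)
  obtain x y z x' y' z' where p: "p = (x, y, z)" "p' = (x', y', z')" by (metis surj_pair)
  have "inner (rot q p) (rot q p') = (a\<^sup>2 + b\<^sup>2 + c\<^sup>2 + d\<^sup>2)\<^sup>2 * inner p p'"
    unfolding p q rot_def by (simp add: power2_eq_square algebra_simps)
  then show ?thesis by (simp add: Sp1_norm[OF assms q])
qed

lemma det3_rot:
  assumes "q \<in> Sp1"
  shows "det3 (rot q p) (rot q p') (rot q p'') = det3 p p' p''"
proof -
  obtain a b c d where q: "q = (a, b, c, d)" by (metis surj_pair)
  obtain x y z x' y' z' x'' y'' z'' where p: "p = (x, y, z)" "p' = (x', y', z')" "p'' = (x'', y'', z'')" by (metis surj_pair)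
  \<comment> \<open>Multiplicativity of the determinant with symbolic matrix entries, which keeps
    the polynomials small; the entries of the rotation enter only through its determinant, the cube
    of the squared norm of \<open>q\<close>.\<close>
  have lin: "det3 (r11 * x + r12 * y + r13 * z, r21 * x + r22 * y + r23 * z, r31 * x + r32 * y + r33 * z)
     (r11 * x' + r12 * y' + r13 * z', r21 * x' + r22 * y' + r23 * z', r31 * x' + r32 * y' + r33 * z')
     (r11 * x'' + r12 * y'' + r13 * z'', r21 * x'' + r22 * y'' + r23 * z'', r31 * x'' + r32 * y'' + r33 * z'')
     = det3 (r11, r12, r13) (r21, r22, r23) (r31, r32, r33) * det3 p p' p''"
    for r11 r12 r13 r21 r22 r23 r31 r32 r33
    unfolding det3_def p by (simp add: algebra_simps)
  have "det3 (a\<^sup>2 + b\<^sup>2 - c\<^sup>2 - d\<^sup>2, 2 * (b * c - a * d), 2 * (b * d + a * c))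
     (2 * (b * c + a * d), a\<^sup>2 - b\<^sup>2 + c\<^sup>2 - d\<^sup>2, 2 * (c * d - a * b))
     (2 * (b * d - a * c), 2 * (c * d + a * b), a\<^sup>2 - b\<^sup>2 - c\<^sup>2 + d\<^sup>2)
     = (a\<^sup>2 + b\<^sup>2 + c\<^sup>2 + d\<^sup>2) ^ 3"
    unfolding det3_def by (simp add: power2_eq_square power3_eq_cube algebra_simps)
  then have "det3 (rot q p) (rot q p') (rot q p'') = (a\<^sup>2 + b\<^sup>2 + c\<^sup>2 + d\<^sup>2) ^ 3 * det3 p p' p''"
    using lin[of "a\<^sup>2 + b\<^sup>2 - c\<^sup>2 - d\<^sup>2" "2 * (b * c - a * d)" "2 * (b * d + a * c)"
      "2 * (b * c + a * d)" "a\<^sup>2 - b\<^sup>2 + c\<^sup>2 - d\<^sup>2" "2 * (c * d - a * b)"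
      "2 * (b * d - a * c)" "2 * (c * d + a * b)" "a\<^sup>2 - b\<^sup>2 - c\<^sup>2 + d\<^sup>2"]
    by (simp add: rot_def q p)
  then show ?thesis by (simp add: Sp1_norm[OF assms q])
qed

lemma sp_act_S7:
  assumes "A \<in> Sp2" "q \<in> Sp1"
  shows "sp_act A q x \<in> S7 \<longleftrightarrow> x \<in> S7"
  using inner_sp_act[OF assms, of x x] by (simp add: S7_def norm_eq_sqrt_inner)

lemma Phi_sp_act:
  assumes "A \<in> Sp2" "q \<in> Sp1" "x \<in> S7"
  shows "Phi a b (sp_act A q x) (map (sp_act A q) vs) = Phi a b x vs"
proof (cases "length vs = 3")
  case True
  then obtain u v w where vs: "vs = [u, v, w]" unfolding length_eq_3_conv by blast
  have "sp_act A q x \<in> S7" using assms sp_act_S7 by blast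
  then show ?thesis
    by (simp add: vs Phi_3 assms(3) tq_def kq_def sv_sp_act[OF assms(1)] inner_rot[OF assms(2)] det3_rot[OF assms(2)])
qed (simp add: Phi_not_3)

lemma invariant_Phi: "invariant (Phi a b)"
  unfolding invariant_def by (intro ballI allI Phi_sp_act)

lemma qconj_0: "qconj 0 = 0" and qconj_qone: "qconj qone = qone"
  by (simp_all add: qconj_def zero_prod_def qone_def)

lemma norm_qone: "norm qone = 1"
  by (simp add: qone_def norm_Pair)

definition x0 :: V where "x0 = ((1, 0, 0, 0), (0, 0, 0, 0))"

lemma x0_S7: "x0 \<in> S7"
  by (simp add: x0_def S7_def norm_Pair)

lemma Sp2_transitive:
  assumes x: "x \<in> S7"
  shows "\<exists>A\<in>Sp2. qmat_apply A x0 = x"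
proof -
  obtain x1 x2 where xx: "x = (x1, x2)" by (metis surj_pair)
  have n: "(norm x1)\<^sup>2 + (norm x2)\<^sup>2 = 1" using norm_V_sq[of x] x by (simp add: xx S7_def)
  have x0: "qmat_apply (x1, b, x2, d) x0 = x" for b d
    using qmul_qone qmul_zero by (simp add: qmat_apply_def x0_def xx qone_def zero_prod_def)
  show ?thesis
  proof (cases "x2 = 0")
    case True
    then have "(x1, 0, x2, qone) \<in> Sp2"
      using n by (simp add: Sp2_def qmul_zero qzero_0 qmul_qone qmul_qconj_self qconj_0 qconj_qone norm_qone)
    then show ?thesis using x0 by blast
  next
    case False
    define m where "m = norm x2"
    have m: "m > 0" using False by (simp add: m_def)
    \<comment> \<open>The second column is \<open>m\<close> above a multiple of
      \<open>qmul x2 (qconj x1)\<close>. Orthogonality to the first column reads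
      \<open>m + k * m\<^sup>2 = 0\<close>, and this \<open>k\<close> also gives the column unit
      length.\<close>
    define k where "k = - 1 / m"
    have km: "m + k * m\<^sup>2 = 0" "k\<^sup>2 * m\<^sup>2 = 1"
      using m by (simp_all add: k_def power2_eq_square)
    define y2 where "y2 = k *\<^sub>R qmul x2 (qconj x1)"
    have c: "qconj y2 = k *\<^sub>R qmul x1 (qconj x2)"
      by (simp add: y2_def qconj_scaleR qconj_qmul qconj_qconj)
    have 22: "qmul (qconj x2) (qmul x2 z) = m\<^sup>2 *\<^sub>R z" for z
      by (simp add: qmul_assoc[symmetric] qmul_qconj_self m_def qmul_scaleR_left qmul_qone)
    have 11: "qmul x1 (qmul (qconj x1) z) = (norm x1)\<^sup>2 *\<^sub>R z" for z
      using qmul_qconj_self[of "qconj x1"]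
      by (simp add: qmul_assoc[symmetric] qconj_qconj norm_qconj qmul_scaleR_left qmul_qone)
    have "qmul (qconj x1) x1 + qmul (qconj x2) x2 = qone"
      using n by (simp add: qmul_qconj_self flip: scaleR_add_left)
    moreover have e1: "qmul (qconj x1) (m *\<^sub>R qone) + qmul (qconj x2) y2 = 0"
      using km(1) by (simp add: y2_def qmul_scaleR_right qmul_qone 22 flip: scaleR_add_left)
    moreover have "qmul (qconj (m *\<^sub>R qone)) x1 + qmul (qconj y2) x2 = 0"
    proof -
      have "qmul (qconj (m *\<^sub>R qone)) x1 + qmul (qconj y2) x2
          = qconj (qmul (qconj x1) (m *\<^sub>R qone) + qmul (qconj x2) y2)"
        by (simp add: qconj_add qconj_qmul qconj_qconj)
      then show ?thesis unfolding e1 by (simp add: qconj_def zero_prod_def)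
    qed
    moreover have "qmul (qconj (m *\<^sub>R qone)) (m *\<^sub>R qone) + qmul (qconj y2) y2 = qone"
    proof -
      have "qmul (qconj y2) y2 = k\<^sup>2 *\<^sub>R qmul x1 (qmul (qconj x2) (qmul x2 (qconj x1)))"
        unfolding c by (simp add: y2_def qmul_scaleR_left qmul_scaleR_right qmul_assoc power2_eq_square)
      also have "\<dots> = (norm x1)\<^sup>2 *\<^sub>R qone"
        using km(2) 11[of qone] by (simp add: 22 qmul_scaleR_right qmul_qone)
      finally show ?thesis
        using n by (simp add: qconj_scaleR qconj_qone qmul_scaleR_left qmul_scaleR_right qmul_qone m_def
            power2_eq_square algebra_simps flip: scaleR_add_left)
    qed
    ultimately have "(x1, m *\<^sub>R qone, x2, y2) \<in> Sp2" by (simp add: Sp2_def qzero_0)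
    then show ?thesis using x0 by blast
  qed
qed

text \<open>The model is \<open>x = (1, 0)\<close> with \<open>e1, e2, e3\<close> the multiples by \<open>lam\<close> of \<open>(i, 0), (j, 0), (k, 0)\<close> and
  \<open>e4, \<dots>, e7\<close> the multiples by \<open>tau\<close> of \<open>(0, 1), (0, i), (0, j), (0, k)\<close>.\<close>

locale frame =
  fixes x e1 e2 e3 e4 e5 e6 e7 :: V and lam tau :: real
  assumes x: "x \<in> S7"
    and hq_x: "hq x e1 = (0, lam, 0, 0)" "hq x e2 = (0, 0, lam, 0)" "hq x e3 = (0, 0, 0, lam)"
      "hq x e4 = (0, 0, 0, 0)" "hq x e5 = (0, 0, 0, 0)" "hq x e6 = (0, 0, 0, 0)" "hq x e7 = (0, 0, 0, 0)"
    and hq_diag: "hq e1 e1 = (lam\<^sup>2, 0, 0, 0)" "hq e2 e2 = (lam\<^sup>2, 0, 0, 0)" "hq e3 e3 = (lam\<^sup>2, 0, 0, 0)"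
      "hq e4 e4 = (tau\<^sup>2, 0, 0, 0)" "hq e5 e5 = (tau\<^sup>2, 0, 0, 0)" "hq e6 e6 = (tau\<^sup>2, 0, 0, 0)" "hq e7 e7 = (tau\<^sup>2, 0, 0, 0)"
    and hq_ver: "hq e1 e2 = (0, 0, 0, - (lam\<^sup>2))" "hq e1 e3 = (0, 0, lam\<^sup>2, 0)" "hq e2 e3 = (0, - (lam\<^sup>2), 0, 0)"
    and hq_mix: "hq e1 e4 = (0, 0, 0, 0)" "hq e1 e5 = (0, 0, 0, 0)" "hq e1 e6 = (0, 0, 0, 0)" "hq e1 e7 = (0, 0, 0, 0)"
      "hq e2 e4 = (0, 0, 0, 0)" "hq e2 e5 = (0, 0, 0, 0)" "hq e2 e6 = (0, 0, 0, 0)" "hq e2 e7 = (0, 0, 0, 0)"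
      "hq e3 e4 = (0, 0, 0, 0)" "hq e3 e5 = (0, 0, 0, 0)" "hq e3 e6 = (0, 0, 0, 0)" "hq e3 e7 = (0, 0, 0, 0)"
    and hq_hor: "hq e4 e5 = (0, tau\<^sup>2, 0, 0)" "hq e4 e6 = (0, 0, tau\<^sup>2, 0)" "hq e4 e7 = (0, 0, 0, tau\<^sup>2)"
      "hq e5 e6 = (0, 0, 0, - (tau\<^sup>2))" "hq e5 e7 = (0, 0, tau\<^sup>2, 0)" "hq e6 e7 = (0, - (tau\<^sup>2), 0, 0)"

text \<open>The frame conditions involve only \<open>hq\<close>, which Sp(2) preserves, so the model
  frame at \<open>x0\<close> can be carried to any point.\<close>

lemma frame_qmat_apply:
  fixes lam tau :: real
  assumes x: "x \<in> S7" and A: "A \<in> Sp2" "qmat_apply A x0 = x"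
  shows "frame x (qmat_apply A ((0, lam, 0, 0), 0)) (qmat_apply A ((0, 0, lam, 0), 0)) (qmat_apply A ((0, 0, 0, lam), 0))
      (qmat_apply A (0, (tau, 0, 0, 0))) (qmat_apply A (0, (0, tau, 0, 0))) (qmat_apply A (0, (0, 0, tau, 0)))
      (qmat_apply A (0, (0, 0, 0, tau))) lam tau"
proof -
  have H: "hq x (qmat_apply A v) = hq x0 v" for v
    using hq_qmat_apply[OF A(1), of x0 v] by (simp add: A(2))
  show ?thesis
    unfolding frame_def H hq_qmat_apply[OF A(1)]
    by (simp add: x hq_def x0_def qmul_def qconj_def zero_prod_def power2_eq_square)
qed

lemma frame_exists: "x \<in> S7 \<Longrightarrow> \<exists>e1 e2 e3 e4 e5 e6 e7. frame x e1 e2 e3 e4 e5 e6 e7 lam tau"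
  using Sp2_transitive frame_qmat_apply by blast

lemma inner_hq_swap: "inner u v = fst (hq v u)"
  by (metis inner_commute inner_hq)

context frame
begin

lemmas hq_table = hq_x hq_diag hq_ver hq_mix hq_hor

lemma hq_table_swap:
  "hq e2 e1 = (0, 0, 0, lam\<^sup>2)" "hq e3 e1 = (0, 0, - (lam\<^sup>2), 0)" "hq e3 e2 = (0, lam\<^sup>2, 0, 0)"
  "hq e4 e1 = (0, 0, 0, 0)" "hq e5 e1 = (0, 0, 0, 0)" "hq e6 e1 = (0, 0, 0, 0)" "hq e7 e1 = (0, 0, 0, 0)"
  "hq e4 e2 = (0, 0, 0, 0)" "hq e5 e2 = (0, 0, 0, 0)" "hq e6 e2 = (0, 0, 0, 0)" "hq e7 e2 = (0, 0, 0, 0)"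
  "hq e4 e3 = (0, 0, 0, 0)" "hq e5 e3 = (0, 0, 0, 0)" "hq e6 e3 = (0, 0, 0, 0)" "hq e7 e3 = (0, 0, 0, 0)"
  "hq e5 e4 = (0, - (tau\<^sup>2), 0, 0)" "hq e6 e4 = (0, 0, - (tau\<^sup>2), 0)" "hq e7 e4 = (0, 0, 0, - (tau\<^sup>2))"
  "hq e6 e5 = (0, 0, 0, tau\<^sup>2)" "hq e7 e5 = (0, 0, - (tau\<^sup>2), 0)" "hq e7 e6 = (0, tau\<^sup>2, 0, 0)"
  by (simp_all add: hq_swap[of e2 e1] hq_swap[of e3 e1] hq_swap[of e3 e2] hq_swap[of e4 e1] hq_swap[of e5 e1]
      hq_swap[of e6 e1] hq_swap[of e7 e1] hq_swap[of e4 e2] hq_swap[of e5 e2] hq_swap[of e6 e2] hq_swap[of e7 e2]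
      hq_swap[of e4 e3] hq_swap[of e5 e3] hq_swap[of e6 e3] hq_swap[of e7 e3] hq_swap[of e5 e4] hq_swap[of e6 e4]
      hq_swap[of e7 e4] hq_swap[of e6 e5] hq_swap[of e7 e5] hq_swap[of e7 e6] hq_table qconj_def)

lemma frame_tangent: "e1 \<in> tangent x" "e2 \<in> tangent x" "e3 \<in> tangent x" "e4 \<in> tangent x"
  "e5 \<in> tangent x" "e6 \<in> tangent x" "e7 \<in> tangent x"
  by (simp_all add: tangent_def inner_hq_swap hq_table)

text \<open>On the vertical triple \<open>kq\<close> contributes \<open>- 3 * b * lam ^ 3\<close>,
  which the \<open>3 * b\<close> in the coefficient of \<open>tq\<close> compensates.\<close>

lemma Phi_frame:
  "Phi a b x [e1, e2, e3] = a * lam ^ 3" "Phi a b x [e1, e2, e4] = 0" "Phi a b x [e1, e2, e5] = 0"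
  "Phi a b x [e1, e2, e6] = 0" "Phi a b x [e1, e2, e7] = 0" "Phi a b x [e1, e3, e4] = 0"
  "Phi a b x [e1, e3, e5] = 0" "Phi a b x [e1, e3, e6] = 0" "Phi a b x [e1, e3, e7] = 0"
  "Phi a b x [e1, e4, e5] = b * lam * tau\<^sup>2" "Phi a b x [e1, e4, e6] = 0" "Phi a b x [e1, e4, e7] = 0"
  "Phi a b x [e1, e5, e6] = 0" "Phi a b x [e1, e5, e7] = 0"
  "Phi a b x [e1, e6, e7] = - (b * lam * tau\<^sup>2)" "Phi a b x [e2, e3, e4] = 0"
  "Phi a b x [e2, e3, e5] = 0" "Phi a b x [e2, e3, e6] = 0" "Phi a b x [e2, e3, e7] = 0"
  "Phi a b x [e2, e4, e5] = 0" "Phi a b x [e2, e4, e6] = b * lam * tau\<^sup>2" "Phi a b x [e2, e4, e7] = 0"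
  "Phi a b x [e2, e5, e6] = 0" "Phi a b x [e2, e5, e7] = b * lam * tau\<^sup>2" "Phi a b x [e2, e6, e7] = 0"
  "Phi a b x [e3, e4, e5] = 0" "Phi a b x [e3, e4, e6] = 0" "Phi a b x [e3, e4, e7] = b * lam * tau\<^sup>2"
  "Phi a b x [e3, e5, e6] = - (b * lam * tau\<^sup>2)" "Phi a b x [e3, e5, e7] = 0"
  "Phi a b x [e3, e6, e7] = 0" "Phi a b x [e4, e5, e6] = 0" "Phi a b x [e4, e5, e7] = 0"
  "Phi a b x [e4, e6, e7] = 0" "Phi a b x [e5, e6, e7] = 0"
  by (simp_all add: Phi_3[OF x] q_defs s_defs hq_table power2_eq_square power3_eq_cube algebra_simps)

text \<open>The minus sign in the last value comes from \<open>\<omega>\<^sub>1\<close> having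
  opposite values on \<open>(e4, e5)\<close> and \<open>(e6, e7)\<close>: its square is negative in
  the order of the frame. The sign of \<open>Vol\<close> has the same origin.\<close>

lemma Psi_frame:
  "Psi c d x [e1, e2, e3, e4] = 0" "Psi c d x [e1, e2, e3, e5] = 0" "Psi c d x [e1, e2, e3, e6] = 0"
  "Psi c d x [e1, e2, e3, e7] = 0" "Psi c d x [e1, e2, e4, e5] = 0" "Psi c d x [e1, e2, e4, e6] = 0"
  "Psi c d x [e1, e2, e4, e7] = c * lam\<^sup>2 * tau\<^sup>2"
  "Psi c d x [e1, e2, e5, e6] = - (c * lam\<^sup>2 * tau\<^sup>2)" "Psi c d x [e1, e2, e5, e7] = 0"
  "Psi c d x [e1, e2, e6, e7] = 0" "Psi c d x [e1, e3, e4, e5] = 0"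
  "Psi c d x [e1, e3, e4, e6] = - (c * lam\<^sup>2 * tau\<^sup>2)" "Psi c d x [e1, e3, e4, e7] = 0"
  "Psi c d x [e1, e3, e5, e6] = 0" "Psi c d x [e1, e3, e5, e7] = - (c * lam\<^sup>2 * tau\<^sup>2)"
  "Psi c d x [e1, e3, e6, e7] = 0" "Psi c d x [e1, e4, e5, e6] = 0" "Psi c d x [e1, e4, e5, e7] = 0"
  "Psi c d x [e1, e4, e6, e7] = 0" "Psi c d x [e1, e5, e6, e7] = 0"
  "Psi c d x [e2, e3, e4, e5] = c * lam\<^sup>2 * tau\<^sup>2" "Psi c d x [e2, e3, e4, e6] = 0"
  "Psi c d x [e2, e3, e4, e7] = 0" "Psi c d x [e2, e3, e5, e6] = 0" "Psi c d x [e2, e3, e5, e7] = 0"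
  "Psi c d x [e2, e3, e6, e7] = - (c * lam\<^sup>2 * tau\<^sup>2)" "Psi c d x [e2, e4, e5, e6] = 0"
  "Psi c d x [e2, e4, e5, e7] = 0" "Psi c d x [e2, e4, e6, e7] = 0" "Psi c d x [e2, e5, e6, e7] = 0"
  "Psi c d x [e3, e4, e5, e6] = 0" "Psi c d x [e3, e4, e5, e7] = 0" "Psi c d x [e3, e4, e6, e7] = 0"
  "Psi c d x [e3, e5, e6, e7] = 0" "Psi c d x [e4, e5, e6, e7] = - (d * tau ^ 4)"
  by (simp_all add: Psi_4[OF x] frame_tangent proj_tangent q_defs s_defs hq_table power2_eq_square power4_eq_xxxx algebra_simps)

lemma Phi_contract:
  assumes X: "X = X1 *\<^sub>R e1 + X2 *\<^sub>R e2 + X3 *\<^sub>R e3 + X4 *\<^sub>R e4 + X5 *\<^sub>R e5 + X6 *\<^sub>R e6 + X7 *\<^sub>R e7"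
    and "lam = 1" "tau = 1"
  shows
    "Phi a b x [X, e1, e2] = a * X3" "Phi a b x [X, e1, e3] = - (a * X2)" "Phi a b x [X, e1, e4] = b * X5"
    "Phi a b x [X, e1, e5] = - (b * X4)" "Phi a b x [X, e1, e6] = - (b * X7)" "Phi a b x [X, e1, e7] = b * X6"
    "Phi a b x [X, e2, e3] = a * X1" "Phi a b x [X, e2, e4] = b * X6" "Phi a b x [X, e2, e5] = b * X7"
    "Phi a b x [X, e2, e6] = - (b * X4)" "Phi a b x [X, e2, e7] = - (b * X5)" "Phi a b x [X, e3, e4] = b * X7"
    "Phi a b x [X, e3, e5] = - (b * X6)" "Phi a b x [X, e3, e6] = b * X5" "Phi a b x [X, e3, e7] = - (b * X4)"
    "Phi a b x [X, e4, e5] = b * X1" "Phi a b x [X, e4, e6] = b * X2" "Phi a b x [X, e4, e7] = b * X3"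
    "Phi a b x [X, e5, e6] = - (b * X3)" "Phi a b x [X, e5, e7] = b * X2" "Phi a b x [X, e6, e7] = - (b * X1)"
  using assms(2,3)
  by (simp_all add: X Phi_3[OF x] q_defs s_defs hq_add hq_scaleR hq_table hq_table_swap algebra_simps)

end

section \<open>The metric induced by an invariant form\<close>

text \<open>\<open>\<eta>\<^sub>1\<^sub>2\<^sub>3\<close> wedge
  \<open>\<omega>\<^sub>1\<^sup>2 / 2\<close>: a volume form of the round metric, with value -1 on a
  unit frame.\<close>

definition Vol :: "V \<Rightarrow> V list \<Rightarrow> real" where
  "Vol x = wedge 3 4 (Phi 1 0 x) (Psi 0 1 x)"

text \<open>The components of the vertical part of a vector are given by \<open>sv x\<close>, so
  \<open>inner (sv x u) (sv x v)\<close> is the round metric along the Hopf fibres and the bracket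
  is its horizontal part.\<close>

definition gm :: "real \<Rightarrow> real \<Rightarrow> V \<Rightarrow> V \<Rightarrow> V \<Rightarrow> real" where
  "gm s t x u v = s\<^sup>2 * inner (sv x u) (sv x v) + t\<^sup>2 * (inner (proj x u) (proj x v) - inner (sv x u) (sv x v))"

lemma malt_Vol: "x \<in> S7 \<Longrightarrow> malt 7 (Vol x)"
  using malt_wedge[OF malt_Phi malt_Psi, of x x 1 0 0 1] by (simp add: Vol_def)

lemma alt_form_Vol:
  assumes x: "x \<in> S7"
  shows "alt_form x 7 (\<lambda>vs. m * Vol x vs)"
proof (rule alt_formI)
  show "malt 7 (\<lambda>vs. m * Vol x vs)" by (rule malt_cmult[OF malt_Vol[OF x]])
  show "m * Vol x (map (proj x) vs) = m * Vol x vs" for vs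
    unfolding Vol_def
    by (subst wedge_map_proj[OF malt_Phi[OF x] malt_Psi[OF x]
          alt_form_proj[OF x alt_form_Phi[OF x]] alt_form_proj[OF x alt_form_Psi[OF x]]]) simp
qed

lemma gm_1_1: "gm 1 1 x u v = inner (proj x u) (proj x v)"
  by (simp add: gm_def)

lemma inner_on_gm_1_1: 
  assumes x: "x \<in> S7"
  shows "inner_on x (gm 1 1 x)"
  unfolding inner_on_def gm_1_1
proof (intro conjI allI ballI impI)
  show "inner (proj x u) (proj x v) = inner (proj x (proj x u)) (proj x (proj x v))" for u v
    by (simp add: proj_tangent proj_in_tangent[OF x])
  show "inner (proj x u) (proj x v) = inner (proj x v) (proj x u)" for u v
    by (rule inner_commute)
  show "inner (proj x (a *\<^sub>R u + b *\<^sub>R v)) (proj x w) = a * inner (proj x u) (proj x w) + b * inner (proj x v) (proj x w)" for a b u v w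
    by (simp add: proj_lin inner_add_left)
  show "0 < inner (proj x u) (proj x u)" if "u \<in> tangent x" "u \<noteq> 0" for u
    using that by (simp add: proj_tangent)
qed

lemma all_less_7: "(\<forall>i<7. P i) \<longleftrightarrow> P 0 \<and> P 1 \<and> P 2 \<and> P 3 \<and> P 4 \<and> P 5 \<and> P (6::nat)"
  by (simp add: eval_nat_numeral All_less_Suc) blast

lemma sum_less_7: "(\<Sum>i<7. f i) = f 0 + f 1 + f 2 + f 3 + f 4 + f 5 + f (6::nat)"
  by (simp add: numeral_eq_Suc)

context frame
begin

abbreviation fr :: "V list" where "fr \<equiv> [e1, e2, e3, e4, e5, e6, e7]"

lemma fr_tlists: "fr \<in> tlists x 7"
  by (simp add: tlists_def frame_tangent)

lemma Vol_fr: "Vol x fr = - (lam ^ 3 * tau ^ 4)"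
  unfolding Vol_def
  by (simp add: wedge_shuf[OF malt_Phi[OF x] malt_Psi[OF x]] Phi_frame Psi_frame)

lemma onb_gm:
  assumes "s * lam = 1" "t * tau = 1"
  shows "onb x (gm s t x) fr"
proof -
  have st: "s\<^sup>2 * lam\<^sup>2 = 1" "t\<^sup>2 * tau\<^sup>2 = 1"
    using assms by (metis power_mult_distrib power_one)+
  show ?thesis
    unfolding onb_def all_less_7
    using fr_tlists st
    by (simp add: gm_def sv_def proj_tangent frame_tangent inner_hq s_defs hq_table hq_table_swap flip: power2_eq_square)
qed

lemma tangent_coords:
  assumes "lam = 1" "tau = 1" "v \<in> tangent x"
  shows "\<exists>X1 X2 X3 X4 X5 X6 X7. v = X1 *\<^sub>R e1 + X2 *\<^sub>R e2 + X3 *\<^sub>R e3 + X4 *\<^sub>R e4 + X5 *\<^sub>R e5 + X6 *\<^sub>R e6 + X7 *\<^sub>R e7"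
proof -
  have "onb x (gm 1 1 x) fr" using assms by (intro onb_gm) auto
  from onb_expand[OF x inner_on_gm_1_1[OF x] this assms(3)]
  have "v = gm 1 1 x v e1 *\<^sub>R e1 + gm 1 1 x v e2 *\<^sub>R e2 + gm 1 1 x v e3 *\<^sub>R e3 + gm 1 1 x v e4 *\<^sub>R e4
      + gm 1 1 x v e5 *\<^sub>R e5 + gm 1 1 x v e6 *\<^sub>R e6 + gm 1 1 x v e7 *\<^sub>R e7"
    unfolding sum_less_7 by simp
  then show ?thesis by blast
qed

lemma gm_coords:
  assumes "lam = 1" "tau = 1"
    and "X = X1 *\<^sub>R e1 + X2 *\<^sub>R e2 + X3 *\<^sub>R e3 + X4 *\<^sub>R e4 + X5 *\<^sub>R e5 + X6 *\<^sub>R e6 + X7 *\<^sub>R e7"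
    and "Y = Y1 *\<^sub>R e1 + Y2 *\<^sub>R e2 + Y3 *\<^sub>R e3 + Y4 *\<^sub>R e4 + Y5 *\<^sub>R e5 + Y6 *\<^sub>R e6 + Y7 *\<^sub>R e7"
  shows "gm s t x X Y = s\<^sup>2 * (X1 * Y1 + X2 * Y2 + X3 * Y3) + t\<^sup>2 * (X4 * Y4 + X5 * Y5 + X6 * Y6 + X7 * Y7)"
proof -
  have XY: "proj x X = X" "proj x Y = Y"
    unfolding assms(3,4) by (intro proj_tangent subspace_add[OF subspace_tangent] subspace_scale[OF subspace_tangent] frame_tangent)+
  show ?thesis
    unfolding gm_def XY
    by (simp add: assms sv_def inner_hq s_defs hq_add hq_scaleR hq_table hq_table_swap algebra_simps)
qed

text \<open>The eigenvalues explain the parameters \<open>s\<close> and \<open>t\<close>: for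
  \<open>a = \<epsilon> * s ^ 3\<close> and \<open>b = \<epsilon> * s * t\<^sup>2\<close> with
  \<open>\<epsilon>\<close> a sign, \<open>a * b\<^sup>2\<close> and \<open>b ^ 3\<close> are
  \<open>s\<^sup>2\<close> and \<open>t\<^sup>2\<close> times the common factor
  \<open>\<epsilon> * s ^ 3 * t ^ 4\<close> of the volume form. The minus sign matches the value of
  \<open>Vol\<close> on the unit frame.\<close>

lemma bryant_form:
  assumes u: "lam = 1" "tau = 1"
    and X: "X = X1 *\<^sub>R e1 + X2 *\<^sub>R e2 + X3 *\<^sub>R e3 + X4 *\<^sub>R e4 + X5 *\<^sub>R e5 + X6 *\<^sub>R e6 + X7 *\<^sub>R e7"
    and Y: "Y = Y1 *\<^sub>R e1 + Y2 *\<^sub>R e2 + Y3 *\<^sub>R e3 + Y4 *\<^sub>R e4 + Y5 *\<^sub>R e5 + Y6 *\<^sub>R e6 + Y7 *\<^sub>R e7"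
  shows "wedge 4 3 (wedge 2 2 (interior X (Phi a b x)) (interior Y (Phi a b x))) (Phi a b x) fr
     = - 6 * (a * b\<^sup>2 * (X1 * Y1 + X2 * Y2 + X3 * Y3) + b ^ 3 * (X4 * Y4 + X5 * Y5 + X6 * Y6 + X7 * Y7))"
proof -
  have m: "malt 2 (interior Z (Phi a b x))" for Z
    using malt_interior[OF malt_Phi[OF x], of a b Z] by (simp add: interior_def[abs_def])
  have m4: "malt 4 (wedge 2 2 (interior X (Phi a b x)) (interior Y (Phi a b x)))"
    using malt_wedge[OF m m] by simp
  show ?thesis
    by (simp add: wedge_shuf[OF m4 malt_Phi[OF x]] wedge_shuf[OF m m] interior_def
        Phi_contract[OF X u] Phi_contract[OF Y u] Phi_frame u)
      (simp add: algebra_simps power2_eq_square power3_eq_cube)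
qed

text \<open>In the frame rescaled by \<open>1 / s\<close> and \<open>1 / t\<close> the star
  exchanges the vertical volume with the horizontal one and the two mixed types with each other; the
  powers of \<open>s\<close> and \<open>t\<close> undo the rescaling.\<close>

lemma hodge_Psi:
  assumes st: "s * lam = 1" "t * tau = 1"
    and g: "inner_on x (gm s t x)" and v: "vol_form x (gm s t x) (\<lambda>vs. \<epsilon> * s ^ 3 * t ^ 4 * Vol x vs)"
  shows "hodge_at x (gm s t x) (\<lambda>vs. \<epsilon> * s ^ 3 * t ^ 4 * Vol x vs) 4 (Psi c d x) = Phi (\<epsilon> * d * s ^ 3 / t ^ 4) (\<epsilon> * c / s) x"
proof -
  have nz: "s \<noteq> 0" "t \<noteq> 0" using st by auto
  have lt: "lam = 1 / s" "tau = 1 / t" using st nz by (auto simp: field_simps)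
  show ?thesis
  proof (rule hodge_at_eqI[OF x g onb_gm[OF st] v])
    show "alt_form x 4 (Psi c d x)" by (rule alt_form_Psi[OF x])
    show "alt_form x (7 - 4) (Phi (\<epsilon> * d * s ^ 3 / t ^ 4) (\<epsilon> * c / s) x)" using alt_form_Phi[OF x] by simp
    show "shuf 4 (7 - 4) \<beta> (Phi (\<epsilon> * d * s ^ 3 / t ^ 4) (\<epsilon> * c / s) x) fr
       = ssum 4 (\<lambda>l. \<beta> l * Psi c d x l) fr * (\<epsilon> * s ^ 3 * t ^ 4 * Vol x fr)" for \<beta>
      using nz
      by (simp add: Phi_frame Psi_frame Vol_fr lt)
        (simp add: field_simps power2_eq_square power3_eq_cube power4_eq_xxxx)
  qed simp
qed

lemma hodge_Phi:
  assumes st: "s * lam = 1" "t * tau = 1"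
    and g: "inner_on x (gm s t x)" and v: "vol_form x (gm s t x) (\<lambda>vs. \<epsilon> * s ^ 3 * t ^ 4 * Vol x vs)"
  shows "hodge_at x (gm s t x) (\<lambda>vs. \<epsilon> * s ^ 3 * t ^ 4 * Vol x vs) 3 (Phi a b x) = Psi (\<epsilon> * b * s) (\<epsilon> * a * t ^ 4 / s ^ 3) x"
proof -
  have nz: "s \<noteq> 0" "t \<noteq> 0" using st by auto
  have lt: "lam = 1 / s" "tau = 1 / t" using st nz by (auto simp: field_simps)
  show ?thesis
  proof (rule hodge_at_eqI[OF x g onb_gm[OF st] v])
    show "alt_form x 3 (Phi a b x)" by (rule alt_form_Phi[OF x])
    show "alt_form x (7 - 3) (Psi (\<epsilon> * b * s) (\<epsilon> * a * t ^ 4 / s ^ 3) x)" using alt_form_Psi[OF x] by simp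
    show "shuf 3 (7 - 3) \<beta> (Psi (\<epsilon> * b * s) (\<epsilon> * a * t ^ 4 / s ^ 3) x) fr
       = ssum 3 (\<lambda>l. \<beta> l * Phi a b x l) fr * (\<epsilon> * s ^ 3 * t ^ 4 * Vol x fr)" for \<beta>
      using nz
      by (simp add: Phi_frame Psi_frame Vol_fr lt)
        (simp add: field_simps power2_eq_square power3_eq_cube power4_eq_xxxx)
  qed simp
qed

lemma hodge_zero:
  assumes st: "s * lam = 1" "t * tau = 1"
    and g: "inner_on x (gm s t x)" and v: "vol_form x (gm s t x) \<mu>"
  shows "hodge_at x (gm s t x) \<mu> 5 (\<lambda>_. 0) = (\<lambda>_. 0)"
proof (rule hodge_at_eqI[OF x g onb_gm[OF st] v])
  have z: "alt_form x k (\<lambda>_. 0)" for k by (intro alt_formI malt_zero_form refl)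
  show "alt_form x 5 (\<lambda>_. 0)" "alt_form x (7 - 5) (\<lambda>_. 0)" by (rule z)+
  show "shuf 5 (7 - 5) \<beta> (\<lambda>_. 0) fr = ssum 5 (\<lambda>l. \<beta> l * 0) fr * \<mu> fr" for \<beta>
    by (simp add: shuf_zero_right del: shuf.simps)
qed simp

end

lemma inner_on_gm:
  assumes x: "x \<in> S7" and st: "s > 0" "t > 0"
  shows "inner_on x (gm s t x)"
  unfolding inner_on_def
proof (intro conjI allI ballI impI)
  show "gm s t x u v = gm s t x (proj x u) (proj x v)" for u v
    by (simp add: gm_def sv_proj proj_tangent proj_in_tangent[OF x])
  show "gm s t x u v = gm s t x v u" for u v
    by (simp add: gm_def inner_commute)
  show "gm s t x (a *\<^sub>R u + b *\<^sub>R v) w = a * gm s t x u w + b * gm s t x v w" for a b u v w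
    by (simp add: gm_def proj_lin sv_lin inner_add_left algebra_simps)
  fix u assume u: "u \<in> tangent x" "u \<noteq> 0"
  obtain e1 e2 e3 e4 e5 e6 e7 where "frame x e1 e2 e3 e4 e5 e6 e7 1 1"
    using frame_exists[OF x] by blast
  then interpret frame x e1 e2 e3 e4 e5 e6 e7 1 1 .
  obtain X1 X2 X3 X4 X5 X6 X7 where X: "u = X1 *\<^sub>R e1 + X2 *\<^sub>R e2 + X3 *\<^sub>R e3 + X4 *\<^sub>R e4 + X5 *\<^sub>R e5 + X6 *\<^sub>R e6 + X7 *\<^sub>R e7"
    using tangent_coords[OF refl refl u(1)] by blast
  let ?A = "X1 * X1 + X2 * X2 + X3 * X3" and ?B = "X4 * X4 + X5 * X5 + X6 * X6 + X7 * X7"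
  have nn: "?A \<ge> 0" "?B \<ge> 0" by simp_all
  have "?A > 0 \<or> ?B > 0"
  proof (rule ccontr)
    assume "\<not> ?thesis"
    then have "?A = 0" "?B = 0" using nn by linarith+
    then have "X1 = 0 \<and> X2 = 0 \<and> X3 = 0" "X4 = 0 \<and> X5 = 0 \<and> X6 = 0 \<and> X7 = 0"
      by (auto simp: add_nonneg_eq_0_iff)
    then show False using X u(2) by simp
  qed
  then show "gm s t x u u > 0"
    unfolding gm_coords[OF refl refl X X] using nn st
    by (metis add_nonneg_pos add_pos_nonneg mult_nonneg_nonneg mult_pos_pos zero_le_power2 zero_less_power2 less_numeral_extra(3))
qed

lemma pos_data_Phi:
  assumes x: "x \<in> S7" and st: "s > 0" "t > 0" and e: "\<bar>\<epsilon>\<bar> = 1"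
  shows "pos_data x (Phi (\<epsilon> * s ^ 3) (\<epsilon> * s * t\<^sup>2) x) (gm s t x) (\<lambda>vs. \<epsilon> * s ^ 3 * t ^ 4 * Vol x vs)"
  unfolding pos_data_def
proof (intro conjI ballI)
  show "inner_on x (gm s t x)" by (rule inner_on_gm[OF x st])
  obtain p1 p2 p3 p4 p5 p6 p7 where "frame x p1 p2 p3 p4 p5 p6 p7 (1 / s) (1 / t)"
    using frame_exists[OF x] by blast
  then interpret p: frame x p1 p2 p3 p4 p5 p6 p7 "1 / s" "1 / t" .
  have "onb x (gm s t x) p.fr" using st by (intro p.onb_gm) auto
  moreover have "\<bar>\<epsilon> * s ^ 3 * t ^ 4 * Vol x p.fr\<bar> = 1"
    using st e by (simp add: p.Vol_fr abs_mult power_divide)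
  ultimately show "vol_form x (gm s t x) (\<lambda>vs. \<epsilon> * s ^ 3 * t ^ 4 * Vol x vs)"
    unfolding vol_form_def using alt_form_Vol[OF x] by blast
  fix X Y vs assume XY: "X \<in> tangent x" "Y \<in> tangent x" and vs: "vs \<in> tlists x 7"
  \<comment> \<open>The rescaled frame \<open>p\<close> has settled the normalisation of the volume
    form; the defining identity is compared in a unit frame, where the coordinates of
    \<open>X\<close> and \<open>Y\<close> enter directly.\<close>
  obtain e1 e2 e3 e4 e5 e6 e7 where "frame x e1 e2 e3 e4 e5 e6 e7 1 1"
    using frame_exists[OF x] by blast
  then interpret frame x e1 e2 e3 e4 e5 e6 e7 1 1 .
  obtain X1 X2 X3 X4 X5 X6 X7 where X: "X = X1 *\<^sub>R e1 + X2 *\<^sub>R e2 + X3 *\<^sub>R e3 + X4 *\<^sub>R e4 + X5 *\<^sub>R e5 + X6 *\<^sub>R e6 + X7 *\<^sub>R e7"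
    using tangent_coords[OF refl refl XY(1)] by blast
  obtain Y1 Y2 Y3 Y4 Y5 Y6 Y7 where Y: "Y = Y1 *\<^sub>R e1 + Y2 *\<^sub>R e2 + Y3 *\<^sub>R e3 + Y4 *\<^sub>R e4 + Y5 *\<^sub>R e5 + Y6 *\<^sub>R e6 + Y7 *\<^sub>R e7"
    using tangent_coords[OF refl refl XY(2)] by blast
  define \<phi> where "\<phi> = Phi (\<epsilon> * s ^ 3) (\<epsilon> * s * t\<^sup>2) x"
  have m3: "malt 3 \<phi>" unfolding \<phi>_def by (rule malt_Phi[OF x])
  have m: "malt 2 (interior Z \<phi>)" for Z
    using malt_interior[OF m3, of Z] by (simp add: interior_def[abs_def])
  have m7: "malt 7 (wedge 4 3 (wedge 2 2 (interior X \<phi>) (interior Y \<phi>)) \<phi>)"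
    using malt_wedge[OF malt_wedge[OF m m] m3] by simp
  have "\<epsilon> * \<epsilon> = 1" using e by (metis abs_mult_self_eq mult_1)
  then have e3: "\<epsilon> * (\<epsilon> * z) = z" for z by (metis mult.assoc mult_1)
  have "1 / 6 * wedge 4 3 (wedge 2 2 (interior X \<phi>) (interior Y \<phi>)) \<phi> vs = gm s t x X Y * (\<epsilon> * s ^ 3 * t ^ 4) * Vol x vs"
  proof (rule malt_top_eqI)
    show "malt 7 (\<lambda>vs. 1 / 6 * wedge 4 3 (wedge 2 2 (interior X \<phi>) (interior Y \<phi>)) \<phi> vs)"
      by (rule malt_cmult[OF m7])
    show "malt 7 (\<lambda>vs. gm s t x X Y * (\<epsilon> * s ^ 3 * t ^ 4) * Vol x vs)"
      by (rule malt_cmult[OF malt_Vol[OF x]])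
    show "length fr = 7" by simp
    have "onb x (gm 1 1 x) fr" by (intro onb_gm) auto
    from onb_span[OF x inner_on_gm_1_1[OF x] this] vs
    show "set vs \<subseteq> span (set fr)" unfolding tlists_def by blast
    show "1 / 6 * wedge 4 3 (wedge 2 2 (interior X \<phi>) (interior Y \<phi>)) \<phi> fr
        = gm s t x X Y * (\<epsilon> * s ^ 3 * t ^ 4) * Vol x fr"
      unfolding \<phi>_def bryant_form[OF refl refl X Y] Vol_fr gm_coords[OF refl refl X Y]
      by (simp add: power2_eq_square power3_eq_cube power4_eq_xxxx e3 algebra_simps)
  qed
  then show "wedge 4 3 (wedge 2 2 (interior X (Phi (\<epsilon> * s ^ 3) (\<epsilon> * s * t\<^sup>2) x)) (interior Y (Phi (\<epsilon> * s ^ 3) (\<epsilon> * s * t\<^sup>2) x)))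
      (Phi (\<epsilon> * s ^ 3) (\<epsilon> * s * t\<^sup>2) x) vs / 6 = gm s t x X Y * (\<epsilon> * s ^ 3 * t ^ 4 * Vol x vs)"
    unfolding \<phi>_def by simp
qed

text \<open>Testing on \<open>e1\<close> and on \<open>e4\<close> shows that
  \<open>a * b\<^sup>2\<close> and \<open>b ^ 3\<close> are both negative multiples of
  \<open>\<mu> fr\<close>, so they have the same sign, and their product is \<open>a * b\<close>
  times a square.\<close>

lemma pos_data_Phi_sgn:
  assumes x: "x \<in> S7" and p: "pos_data x (Phi a b x) g \<mu>"
  shows "a * b > 0"
proof -
  obtain e1 e2 e3 e4 e5 e6 e7 where "frame x e1 e2 e3 e4 e5 e6 e7 1 1"
    using frame_exists[OF x] by blast
  then interpret frame x e1 e2 e3 e4 e5 e6 e7 1 1 .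
  have g: "inner_on x g" and v: "vol_form x g \<mu>" using p by (auto simp: pos_data_def)
  have B: "wedge 4 3 (wedge 2 2 (interior X (Phi a b x)) (interior X (Phi a b x))) (Phi a b x) fr / 6 = g X X * \<mu> fr"
    if "X \<in> tangent x" for X
    using p that fr_tlists unfolding pos_data_def by blast
  have c1: "e1 = 1 *\<^sub>R e1 + 0 *\<^sub>R e2 + 0 *\<^sub>R e3 + 0 *\<^sub>R e4 + 0 *\<^sub>R e5 + 0 *\<^sub>R e6 + 0 *\<^sub>R e7"
   and c4: "e4 = 0 *\<^sub>R e1 + 0 *\<^sub>R e2 + 0 *\<^sub>R e3 + 1 *\<^sub>R e4 + 0 *\<^sub>R e5 + 0 *\<^sub>R e6 + 0 *\<^sub>R e7" by simp_all
  have 1: "g e1 e1 * \<mu> fr = - (a * b\<^sup>2)"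
    using B[OF frame_tangent(1)] unfolding bryant_form[OF refl refl c1 c1] by simp
  have 4: "g e4 e4 * \<mu> fr = - (b ^ 3)"
    using B[OF frame_tangent(4)] unfolding bryant_form[OF refl refl c4 c4] by simp
  have "inner e1 e1 = 1" "inner e4 e4 = 1" unfolding inner_hq hq_diag by simp_all
  then have "e1 \<noteq> 0" "e4 \<noteq> 0" by auto
  then have gp: "g e1 e1 > 0" "g e4 e4 > 0" using g frame_tangent by (auto simp: inner_on_def)
  obtain e where e: "onb x g e" "\<bar>\<mu> e\<bar> = 1" and m: "malt 7 \<mu>"
    using v alt_form_malt[OF x] unfolding vol_form_def by blast
  have "\<mu> fr \<noteq> 0"
  proof
    assume z: "\<mu> fr = 0"
    have "onb x (gm 1 1 x) fr" by (intro onb_gm) auto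
    from onb_span[OF x inner_on_gm_1_1[OF x] this]
    have "set e \<subseteq> span (set fr)" using e(1) unfolding onb_def tlists_def by blast
    then have "\<mu> e = 0" using malt_top_eqI[OF m malt_zero_form, of fr e] z by simp
    then show False using e(2) by simp
  qed
  then have "\<mu> fr * \<mu> fr > 0" by (metis not_square_less_zero linorder_neqE_linordered_idom mult_eq_0_iff)
  then have "(g e1 e1 * \<mu> fr) * (g e4 e4 * \<mu> fr) > 0"
    using gp by (simp add: mult.assoc mult.left_commute[of "\<mu> fr"])
  then have "(a * b) * (b\<^sup>2 * b\<^sup>2) > 0"
    unfolding 1 4 by (simp add: power2_eq_square power3_eq_cube mult.assoc)
  then show ?thesis by (metis mult_less_cancel_right2 not_square_less_zero zero_less_mult_iff linorder_not_less mult_nonpos_nonneg zero_le_square)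
qed

lemma Phi_param:
  fixes a b :: real
  assumes "a * b > 0"
  shows "\<exists>\<epsilon> s t. \<bar>\<epsilon>\<bar> = 1 \<and> s > 0 \<and> t > 0 \<and> a = \<epsilon> * s ^ 3 \<and> b = \<epsilon> * s * t\<^sup>2"
proof -
  define s where "s = root 3 \<bar>a\<bar>"
  have s: "s > 0" "s ^ 3 = \<bar>a\<bar>" using assms by (auto simp: s_def)
  define t where "t = sqrt (\<bar>b\<bar> / s)"
  have "b \<noteq> 0" using assms by auto
  then have t: "t > 0" "t\<^sup>2 = \<bar>b\<bar> / s" using s by (simp_all add: t_def)
  have "sgn b = sgn a" using assms by (auto simp: zero_less_mult_iff)
  then have "b = sgn a * \<bar>b\<bar>" by (metis sgn_mult_abs)
  then have "b = sgn a * s * t\<^sup>2" using s t by simp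
  moreover have "a = sgn a * s ^ 3" using s by (simp add: sgn_mult_abs)
  moreover have "\<bar>sgn a\<bar> = 1" using assms by (auto simp: abs_sgn_eq)
  ultimately show ?thesis using s t by blast
qed

lemma positive_at_Phi:
  assumes "x \<in> S7"
  shows "positive_at x (Phi a b x) \<longleftrightarrow> a * b > 0"
proof
  assume "positive_at x (Phi a b x)"
  then show "a * b > 0" using pos_data_Phi_sgn[OF assms] by (auto simp: positive_at_def)
next
  assume "a * b > 0"
  then obtain \<epsilon> s t where "\<bar>\<epsilon>\<bar> = 1" "s > 0" "t > 0" and ab: "a = \<epsilon> * s ^ 3" "b = \<epsilon> * s * t\<^sup>2"
    using Phi_param by blast
  from pos_data_Phi[OF assms this(2,3,1)] show "positive_at x (Phi a b x)"
    unfolding positive_at_def ab using alt_form_Phi[OF assms] by blast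
qed

lemma Phi_off: "x \<notin> S7 \<Longrightarrow> Phi a b x = (\<lambda>_. 0)" and Psi_off: "x \<notin> S7 \<Longrightarrow> Psi a b x = (\<lambda>_. 0)"
  by (simp_all add: Phi_def[abs_def] Psi_def[abs_def])

lemma star_Phi:
  assumes st: "s > 0" "t > 0" and e: "\<bar>\<epsilon>\<bar> = 1"
  defines "\<phi> \<equiv> Phi (\<epsilon> * s ^ 3) (\<epsilon> * s * t\<^sup>2)"
  shows "star \<phi> 4 (Psi c d) = Phi (\<epsilon> * d * s ^ 3 / t ^ 4) (\<epsilon> * c / s)"
    and "star \<phi> 3 (Phi a b) = Psi (\<epsilon> * b * s) (\<epsilon> * a * t ^ 4 / s ^ 3)"
    and "star \<phi> 5 (\<lambda>_ _. 0) = (\<lambda>_ _. 0)"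
proof -
  have "star \<phi> 4 (Psi c d) x = Phi (\<epsilon> * d * s ^ 3 / t ^ 4) (\<epsilon> * c / s) x
     \<and> star \<phi> 3 (Phi a b) x = Psi (\<epsilon> * b * s) (\<epsilon> * a * t ^ 4 / s ^ 3) x
     \<and> star \<phi> 5 (\<lambda>_ _. 0) x = (\<lambda>_. 0)" for x
  proof (cases "x \<in> S7")
    case x: True
    note pd = pos_data_Phi[OF x st e, folded \<phi>_def]
    have gv: "inner_on x (gm s t x)" "vol_form x (gm s t x) (\<lambda>vs. \<epsilon> * s ^ 3 * t ^ 4 * Vol x vs)"
      using pd by (auto simp: pos_data_def)
    obtain e1 e2 e3 e4 e5 e6 e7 where "frame x e1 e2 e3 e4 e5 e6 e7 (1 / s) (1 / t)"
      using frame_exists[OF x] by blast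
    then interpret frame x e1 e2 e3 e4 e5 e6 e7 "1 / s" "1 / t" .
    have u: "s * (1 / s) = 1" "t * (1 / t) = 1"
      using st by simp_all
    show ?thesis
      using x hodge_Psi[OF u gv] hodge_Phi[OF u gv] hodge_zero[OF u gv]
      by (simp add: star_def pos_data_metric_vol[OF x pd])
  qed (simp add: star_def Phi_off Psi_off)
  then show "star \<phi> 4 (Psi c d) = Phi (\<epsilon> * d * s ^ 3 / t ^ 4) (\<epsilon> * c / s)"
    and "star \<phi> 3 (Phi a b) = Psi (\<epsilon> * b * s) (\<epsilon> * a * t ^ 4 / s ^ 3)"
    and "star \<phi> 5 (\<lambda>_ _. 0) = (\<lambda>_ _. 0)"
    by (intro ext, metis)+
qed

section \<open>Exterior derivatives\<close>

lemma det3_has_derivative: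
  assumes "(p has_vector_derivative p') (at t)" "(q has_vector_derivative q') (at t)" "(r has_vector_derivative r') (at t)"
  shows "((\<lambda>t. det3 (p t) (q t) (r t)) has_real_derivative
     det3 p' (q t) (r t) + det3 (p t) q' (r t) + det3 (p t) (q t) r') (at t)"
proof -
  have c: "((\<lambda>t. fst (f t)) has_real_derivative fst f') (at t)"
    "((\<lambda>t. fst (snd (f t))) has_real_derivative fst (snd f')) (at t)"
    "((\<lambda>t. snd (snd (f t))) has_real_derivative snd (snd f')) (at t)"
    if "(f has_vector_derivative f') (at t)" for f :: "real \<Rightarrow> real \<times> real \<times> real" and f'
    using bounded_linear.has_vector_derivative[OF bounded_linear_fst that]
      bounded_linear.has_vector_derivative[OF bounded_linear_fst bounded_linear.has_vector_derivative[OF bounded_linear_snd that]]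
      bounded_linear.has_vector_derivative[OF bounded_linear_snd bounded_linear.has_vector_derivative[OF bounded_linear_snd that]]
    by (simp_all add: has_real_derivative_iff_has_vector_derivative)
  show ?thesis
    unfolding det3_def case_prod_unfold
    by (rule derivative_eq_intros refl c assms)+ (simp add: algebra_simps)
qed

lemma inner_has_derivative:
  fixes p q :: "real \<Rightarrow> real \<times> real \<times> real"
  assumes "(p has_vector_derivative p') (at t)" "(q has_vector_derivative q') (at t)"
  shows "((\<lambda>t. inner (p t) (q t)) has_real_derivative inner p' (q t) + inner (p t) q') (at t)"
  using bounded_bilinear.has_vector_derivative[OF bounded_bilinear_inner assms]
  by (simp add: has_real_derivative_iff_has_vector_derivative add.commute)

lemma sv_add: "sv (u + w) v = sv u v + sv w v" "sv v (u + w) = sv v u + sv v w"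
  by (simp_all add: sv_def s_add)

lemma sv_scaleR: "sv (c *\<^sub>R u) v = c *\<^sub>R sv u v" "sv v (c *\<^sub>R u) = c *\<^sub>R sv v u"
  by (simp_all add: sv_def s_scaleR)

lemma sv_swap: "sv v u = - sv u v"
  unfolding sv_def s_swap[of v u] by simp

lemma det3_scaleR: "det3 (c *\<^sub>R p) q r = c * det3 p q r" "det3 p (c *\<^sub>R q) r = c * det3 p q r" "det3 p q (c *\<^sub>R r) = c * det3 p q r"
  by (simp_all add: det3_def case_prod_unfold algebra_simps)

lemma det3_diff: "det3 p q (r - r') = det3 p q r - det3 p q r'"
  by (simp add: det3_def case_prod_unfold algebra_simps)

lemma det3_minus: "det3 (- p) q r = - det3 p q r" "det3 p (- q) r = - det3 p q r" "det3 p q (- r) = - det3 p q r"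
  by (simp_all add: det3_def case_prod_unfold algebra_simps)

lemma det3_swap: "det3 q p r = - det3 p q r" "det3 p r q = - det3 p q r"
  by (simp_all add: det3_def case_prod_unfold algebra_simps)

lemma det3_cyc: "det3 q r p = det3 p q r"
  by (simp add: det3_def case_prod_unfold algebra_simps)

text \<open>The three ways in which terms cancel in \<open>d\<close> of the invariant 4-forms. Here \<open>y\<^sub>a\<close> stands for \<open>sv x u\<^sub>a\<close>,
  \<open>s\<^sub>a\<^sub>b\<close> for \<open>sv u\<^sub>a u\<^sub>b\<close> and \<open>i\<^sub>a\<^sub>b\<close> for \<open>inner u\<^sub>a u\<^sub>b\<close>; the latter come from differentiating the projection.\<close>

lemma closed_qq_sum:
  "(det3 sab yc sde + det3 yb sac sde) - (det3 sab yd sce + det3 yb sad sce) + (det3 sab ye scd +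
    det3 yb sae scd) + (det3 sac yd sbe + det3 yc sad sbe) - (det3 sac ye sbd + det3 yc sae sbd) +
    (det3 sad ye sbc + det3 yd sae sbc) - (det3 (- sab) yc sde + det3 ya sbc sde) + (det3 (- sab) yd sce +
    det3 ya sbd sce) - (det3 (- sab) ye scd + det3 ya sbe scd) - (det3 sbc yd sae + det3 yc sbd sae) +
    (det3 sbc ye sad + det3 yc sbe sad) - (det3 sbd ye sac + det3 yd sbe sac) + (det3 (- sac) yb sde +
    det3 ya (- sbc) sde) - (det3 (- sac) yd sbe + det3 ya scd sbe) + (det3 (- sac) ye sbd + det3 ya sce sbd)
    + (det3 (- sbc) yd sae + det3 yb scd sae) - (det3 (- sbc) ye sad + det3 yb sce sad) + (det3 scd ye sab +
    det3 yd sce sab) - (det3 (- sad) yb sce + det3 ya (- sbd) sce) + (det3 (- sad) yc sbe +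
    det3 ya (- scd) sbe) - (det3 (- sad) ye sbc + det3 ya sde sbc) - (det3 (- sbd) yc sae +
    det3 yb (- scd) sae) + (det3 (- sbd) ye sac + det3 yb sde sac) - (det3 (- scd) ye sab + det3 yc sde sab)
    + (det3 (- sae) yb scd + det3 ya (- sbe) scd) - (det3 (- sae) yc sbd + det3 ya (- sce) sbd) +
    (det3 (- sae) yd sbc + det3 ya (- sde) sbc) + (det3 (- sbe) yc sad + det3 yb (- sce) sad) -
    (det3 (- sbe) yd sac + det3 yb (- sde) sac) + (det3 (- sce) yd sab + det3 yc (- sde) sab) = (0::real)"
  by (simp add: det3_minus det3_swap(1)[of sbc ya sde] det3_swap(1)[of sde ya sbc]
    det3_swap(2)[of ya sde sbc] det3_swap(1)[of sbd ya sce] det3_swap(1)[of sce ya sbd]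
    det3_swap(2)[of ya sce sbd] det3_swap(1)[of sbe ya scd] det3_swap(1)[of scd ya sbe]
    det3_swap(2)[of ya scd sbe] det3_swap(1)[of sac yb sde] det3_swap(1)[of sde yb sac]
    det3_swap(2)[of yb sde sac] det3_swap(1)[of sad yb sce] det3_swap(1)[of sce yb sad]
    det3_swap(2)[of yb sce sad] det3_swap(1)[of sae yb scd] det3_swap(1)[of scd yb sae]
    det3_swap(2)[of yb scd sae] det3_swap(1)[of sab yc sde] det3_swap(1)[of sde yc sab]
    det3_swap(2)[of yc sde sab] det3_swap(1)[of sad yc sbe] det3_swap(1)[of sbe yc sad]
    det3_swap(2)[of yc sbe sad] det3_swap(1)[of sae yc sbd] det3_swap(1)[of sbd yc sae]
    det3_swap(2)[of yc sbd sae] det3_swap(1)[of sab yd sce] det3_swap(1)[of sce yd sab]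
    det3_swap(2)[of yd sce sab] det3_swap(1)[of sac yd sbe] det3_swap(1)[of sbe yd sac]
    det3_swap(2)[of yd sbe sac] det3_swap(1)[of sae yd sbc] det3_swap(1)[of sbc yd sae]
    det3_swap(2)[of yd sbc sae] det3_swap(1)[of sab ye scd] det3_swap(1)[of scd ye sab]
    det3_swap(2)[of ye scd sab] det3_swap(1)[of sac ye sbd] det3_swap(1)[of sbd ye sac]
    det3_swap(2)[of ye sbd sac] det3_swap(1)[of sad ye sbc] det3_swap(1)[of sbc ye sad]
    det3_swap(2)[of ye sbc sad])

lemma closed_kq_sum_radial:
  "(inner (iac *\<^sub>R yb - iab *\<^sub>R yc) sde + inner sbc (iae *\<^sub>R yd - iad *\<^sub>R ye)) -
    (inner (iad *\<^sub>R yb - iab *\<^sub>R yd) sce + inner sbd (iae *\<^sub>R yc - iac *\<^sub>R ye)) +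
    (inner (iae *\<^sub>R yb - iab *\<^sub>R ye) scd + inner sbe (iad *\<^sub>R yc - iac *\<^sub>R yd)) -
    (inner (ibc *\<^sub>R ya - iab *\<^sub>R yc) sde + inner sac (ibe *\<^sub>R yd - ibd *\<^sub>R ye)) +
    (inner (ibd *\<^sub>R ya - iab *\<^sub>R yd) sce + inner sad (ibe *\<^sub>R yc - ibc *\<^sub>R ye)) -
    (inner (ibe *\<^sub>R ya - iab *\<^sub>R ye) scd + inner sae (ibd *\<^sub>R yc - ibc *\<^sub>R yd)) +
    (inner (ibc *\<^sub>R ya - iac *\<^sub>R yb) sde + inner sab (ice *\<^sub>R yd - icd *\<^sub>R ye)) -
    (inner (icd *\<^sub>R ya - iac *\<^sub>R yd) sbe + inner sad (ice *\<^sub>R yb - ibc *\<^sub>R ye)) +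
    (inner (ice *\<^sub>R ya - iac *\<^sub>R ye) sbd + inner sae (icd *\<^sub>R yb - ibc *\<^sub>R yd)) -
    (inner (ibd *\<^sub>R ya - iad *\<^sub>R yb) sce + inner sab (ide *\<^sub>R yc - icd *\<^sub>R ye)) +
    (inner (icd *\<^sub>R ya - iad *\<^sub>R yc) sbe + inner sac (ide *\<^sub>R yb - ibd *\<^sub>R ye)) -
    (inner (ide *\<^sub>R ya - iad *\<^sub>R ye) sbc + inner sae (icd *\<^sub>R yb - ibd *\<^sub>R yc)) +
    (inner (ibe *\<^sub>R ya - iae *\<^sub>R yb) scd + inner sab (ide *\<^sub>R yc - ice *\<^sub>R yd)) -
    (inner (ice *\<^sub>R ya - iae *\<^sub>R yc) sbd + inner sac (ide *\<^sub>R yb - ibe *\<^sub>R yd)) +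
    (inner (ide *\<^sub>R ya - iae *\<^sub>R yd) sbc + inner sad (ice *\<^sub>R yb - ibe *\<^sub>R yc)) =
    (0::real)"
  by (simp add: inner_diff_left inner_diff_right inner_commute[of sab] inner_commute[of sac]
    inner_commute[of sad] inner_commute[of sae] inner_commute[of sbc] inner_commute[of sbd]
    inner_commute[of sbe] inner_commute[of scd] inner_commute[of sce] inner_commute[of sde] algebra_simps)

lemma closed_qq_sum_radial:
  "det3 yb yc (iae *\<^sub>R yd - iad *\<^sub>R ye) - det3 yb yd (iae *\<^sub>R yc - iac *\<^sub>R ye) +
    det3 yb ye (iad *\<^sub>R yc - iac *\<^sub>R yd) + det3 yc yd (iae *\<^sub>R yb - iab *\<^sub>R ye) -
    det3 yc ye (iad *\<^sub>R yb - iab *\<^sub>R yd) + det3 yd ye (iac *\<^sub>R yb - iab *\<^sub>R yc) -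
    det3 ya yc (ibe *\<^sub>R yd - ibd *\<^sub>R ye) + det3 ya yd (ibe *\<^sub>R yc - ibc *\<^sub>R ye) -
    det3 ya ye (ibd *\<^sub>R yc - ibc *\<^sub>R yd) - det3 yc yd (ibe *\<^sub>R ya - iab *\<^sub>R ye) +
    det3 yc ye (ibd *\<^sub>R ya - iab *\<^sub>R yd) - det3 yd ye (ibc *\<^sub>R ya - iab *\<^sub>R yc) +
    det3 ya yb (ice *\<^sub>R yd - icd *\<^sub>R ye) - det3 ya yd (ice *\<^sub>R yb - ibc *\<^sub>R ye) +
    det3 ya ye (icd *\<^sub>R yb - ibc *\<^sub>R yd) + det3 yb yd (ice *\<^sub>R ya - iac *\<^sub>R ye) -
    det3 yb ye (icd *\<^sub>R ya - iac *\<^sub>R yd) + det3 yd ye (ibc *\<^sub>R ya - iac *\<^sub>R yb) -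
    det3 ya yb (ide *\<^sub>R yc - icd *\<^sub>R ye) + det3 ya yc (ide *\<^sub>R yb - ibd *\<^sub>R ye) -
    det3 ya ye (icd *\<^sub>R yb - ibd *\<^sub>R yc) - det3 yb yc (ide *\<^sub>R ya - iad *\<^sub>R ye) +
    det3 yb ye (icd *\<^sub>R ya - iad *\<^sub>R yc) - det3 yc ye (ibd *\<^sub>R ya - iad *\<^sub>R yb) +
    det3 ya yb (ide *\<^sub>R yc - ice *\<^sub>R yd) - det3 ya yc (ide *\<^sub>R yb - ibe *\<^sub>R yd) +
    det3 ya yd (ice *\<^sub>R yb - ibe *\<^sub>R yc) + det3 yb yc (ide *\<^sub>R ya - iae *\<^sub>R yd) -
    det3 yb yd (ice *\<^sub>R ya - iae *\<^sub>R yc) + det3 yc yd (ibe *\<^sub>R ya - iae *\<^sub>R yb) =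
    (0::real)"
  by (simp add: det3_diff det3_scaleR det3_swap(2)[of ya yc yb] det3_cyc[of yb yc ya]
    det3_swap(2)[of ya yd yb] det3_cyc[of yb yd ya] det3_swap(2)[of ya ye yb] det3_cyc[of yb ye ya]
    det3_swap(2)[of ya yd yc] det3_cyc[of yc yd ya] det3_swap(2)[of ya ye yc] det3_cyc[of yc ye ya]
    det3_swap(2)[of ya ye yd] det3_cyc[of yd ye ya] det3_swap(2)[of yb yd yc] det3_cyc[of yc yd yb]
    det3_swap(2)[of yb ye yc] det3_cyc[of yc ye yb] det3_swap(2)[of yb ye yd] det3_cyc[of yd ye yb]
    det3_swap(2)[of yc ye yd] det3_cyc[of yd ye yc] algebra_simps)

section \<open>Derivatives of radially extended forms along tangent lines\<close>

lemma norm_line: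
  assumes "x \<in> S7" "u \<in> tangent x"
  shows "norm (x + t *\<^sub>R u) = sqrt (1 + t\<^sup>2 * inner u u)"
proof -
  have "inner x x = 1" "inner u x = 0" "inner x u = 0"
    using assms by (auto simp: S7_inner tangent_def inner_commute)
  then show ?thesis
    by (simp add: norm_eq_sqrt_inner inner_add_left inner_add_right power2_eq_square)
qed

text \<open>The inverse norm of \<open>x + t *\<^sub>R u\<close> for a point \<open>x\<close> of the
  sphere and tangent \<open>u\<close>. It is even in \<open>t\<close>, so the normalisations in
  \<open>radial_ext\<close> contribute nothing to first order.\<close>

definition rho :: "V \<Rightarrow> real \<Rightarrow> real" where
  "rho u t = inverse (sqrt (1 + t\<^sup>2 * inner u u))"

lemma rho_0: "rho u 0 = 1"
  by (simp add: rho_def)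

lemma rho_has_derivative: "(rho u has_real_derivative 0) (at 0)"
  unfolding rho_def[abs_def]
  by (auto intro!: derivative_eq_intros)

lemma line_sphere:
  assumes "x \<in> S7" "u \<in> tangent x"
  shows "(x + t *\<^sub>R u) /\<^sub>R norm (x + t *\<^sub>R u) = rho u t *\<^sub>R (x + t *\<^sub>R u)"
    "rho u t *\<^sub>R (x + t *\<^sub>R u) \<in> S7" "inverse (norm (x + t *\<^sub>R u)) = rho u t"
proof -
  have "1 + t\<^sup>2 * inner u u > 0" by (intro add_pos_nonneg) auto
  then have n: "norm (x + t *\<^sub>R u) > 0" by (simp add: norm_line[OF assms])
  show r: "inverse (norm (x + t *\<^sub>R u)) = rho u t" by (simp add: norm_line[OF assms] rho_def)
  then show e: "(x + t *\<^sub>R u) /\<^sub>R norm (x + t *\<^sub>R u) = rho u t *\<^sub>R (x + t *\<^sub>R u)" by simp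
  have "norm ((x + t *\<^sub>R u) /\<^sub>R norm (x + t *\<^sub>R u)) = 1" using n by simp
  then show "rho u t *\<^sub>R (x + t *\<^sub>R u) \<in> S7" unfolding e S7_def by simp
qed

lemma sv_line_deriv: "((\<lambda>t. sv (x + t *\<^sub>R u) w) has_vector_derivative sv u w) (at 0)"
  unfolding sv_add sv_scaleR
  by (auto intro!: derivative_eq_intros)

lemma kq_scale: "kq (c *\<^sub>R u) (c *\<^sub>R v) (c *\<^sub>R w) (c *\<^sub>R z) = c ^ 4 * kq u v w z"
  by (simp add: kq_def sv_scaleR power4_eq_xxxx algebra_simps)

text \<open>Each of the three contact forms in \<open>tq\<close> carries one factor from the base
  point and one from its argument, giving exponent 6; \<open>kq\<close> has the base point once and
  three arguments, giving 4. The projections disappear because \<open>x\<close> occupies a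
  slot.\<close>

lemma radial_ext_Phi:
  assumes x: "x \<in> S7" and u: "u \<in> tangent x"
  shows "radial_ext (Phi a b) (x + t *\<^sub>R u) [v, w, z] =
    (a + 3 * b) * (rho u t ^ 6 * tq (x + t *\<^sub>R u) v w z) + b * (rho u t ^ 4 * kq (x + t *\<^sub>R u) v w z)"
proof -
  define y where "y = x + t *\<^sub>R u"
  define r where "r = rho u t"
  have ry: "r *\<^sub>R y \<in> S7" unfolding y_def r_def by (rule line_sphere[OF x u])
  have "radial_ext (Phi a b) y [v, w, z] = Phi a b (r *\<^sub>R y) [r *\<^sub>R proj (r *\<^sub>R y) v, r *\<^sub>R proj (r *\<^sub>R y) w, r *\<^sub>R proj (r *\<^sub>R y) z]"
    unfolding radial_ext_def y_def r_def line_sphere[OF x u] by simp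
  also have "\<dots> = (a + 3 * b) * (r ^ 3 * tq (r *\<^sub>R y) v w z) + b * (r ^ 3 * kq (r *\<^sub>R y) (proj (r *\<^sub>R y) v) (proj (r *\<^sub>R y) w) (proj (r *\<^sub>R y) z))"
    by (simp add: Phi_3[OF ry] tq_def kq_def sv_scaleR(2) sv_proj det3_scaleR power3_eq_cube sv_scaleR(1)[of r "proj (r *\<^sub>R y) _"] algebra_simps)
  also have "\<dots> = (a + 3 * b) * (r ^ 6 * tq y v w z) + b * (r ^ 4 * kq y v w z)"
    unfolding kq_proj by (simp add: tq_def kq_def sv_scaleR det3_scaleR power_numeral_reduce algebra_simps)
  finally show ?thesis unfolding y_def r_def .
qed

lemma radial_ext_Phi_deriv:
  assumes x: "x \<in> S7" and u: "u \<in> tangent x"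
  shows "deriv (\<lambda>t. radial_ext (Phi a b) (x + t *\<^sub>R u) [v, w, z]) 0 =
    (a + 3 * b) * (det3 (sv u v) (sv x w) (sv x z) + det3 (sv x v) (sv u w) (sv x z) + det3 (sv x v) (sv x w) (sv u z))
    + b * kq u v w z"
proof (rule DERIV_imp_deriv)
  have T: "((\<lambda>t. tq (x + t *\<^sub>R u) v w z) has_real_derivative
      det3 (sv u v) (sv x w) (sv x z) + det3 (sv x v) (sv u w) (sv x z) + det3 (sv x v) (sv x w) (sv u z)) (at 0)"
    unfolding tq_def
    using det3_has_derivative[OF sv_line_deriv[of x u v] sv_line_deriv[of x u w] sv_line_deriv[of x u z]] by simp
  \<comment> \<open>\<open>kq\<close> is linear in its first slot, so its derivative along the line
    is its value at \<open>u\<close>.\<close>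
  have "kq (x + t *\<^sub>R u) v w z = kq x v w z + t * kq u v w z" for t
    by (simp add: kq_def sv_add sv_scaleR inner_add_left algebra_simps)
  then have K: "((\<lambda>t. kq (x + t *\<^sub>R u) v w z) has_real_derivative kq u v w z) (at 0)"
    by (auto intro!: derivative_eq_intros)
  show "((\<lambda>t. radial_ext (Phi a b) (x + t *\<^sub>R u) [v, w, z]) has_real_derivative
     (a + 3 * b) * (det3 (sv u v) (sv x w) (sv x z) + det3 (sv x v) (sv u w) (sv x z) + det3 (sv x v) (sv x w) (sv u z))
    + b * kq u v w z) (at 0)"
    unfolding radial_ext_Phi[OF x u]
    by (rule derivative_eq_intros refl T K rho_has_derivative)+ (simp add: rho_0)
qed

text \<open>As the \<open>s\<^sub>i\<close> are constant and \<open>\<eta>\<^sub>i\<close> has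
  differential \<open>2 s\<^sub>i\<close>, d takes \<open>tq\<close> to \<open>2 * qq\<close> and
  the 3-form \<open>kq x\<close> to \<open>4 * kq\<close>. The parameters solve
  \<open>c + d / 3 = 2 * (a + 3 * b)\<close> and \<open>d / 3 = 4 * b\<close>.\<close>

lemma ext_d_Phi: "ext_d 3 (Phi a b) = Psi (2 * (a + b)) (12 * b)"
proof (intro ext)
  fix x vs
  show "ext_d 3 (Phi a b) x vs = Psi (2 * (a + b)) (12 * b) x vs"
  proof (cases "x \<in> S7 \<and> length vs = 4")
    case True
    then have x: "x \<in> S7" by simp
    from True obtain v0 v1 v2 v3 where vs: "vs = [v0, v1, v2, v3]" unfolding length_eq_4_conv by blast
    define u0 u1 u2 u3 where u: "u0 = proj x v0" "u1 = proj x v1" "u2 = proj x v2" "u3 = proj x v3"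
    have ut: "u0 \<in> tangent x" "u1 \<in> tangent x" "u2 \<in> tangent x" "u3 \<in> tangent x"
      unfolding u by (rule proj_in_tangent[OF x])+
    have e: "ext_d 3 (Phi a b) x vs =
        deriv (\<lambda>t. radial_ext (Phi a b) (x + t *\<^sub>R u0) [u1, u2, u3]) 0
      - deriv (\<lambda>t. radial_ext (Phi a b) (x + t *\<^sub>R u1) [u0, u2, u3]) 0
      + deriv (\<lambda>t. radial_ext (Phi a b) (x + t *\<^sub>R u2) [u0, u1, u3]) 0
      - deriv (\<lambda>t. radial_ext (Phi a b) (x + t *\<^sub>R u3) [u0, u1, u2]) 0"
      using x by (simp add: ext_d_def vs u[symmetric] numeral_eq_Suc)
    show ?thesis
      unfolding e radial_ext_Phi_deriv[OF x ut(1)] radial_ext_Phi_deriv[OF x ut(2)]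
        radial_ext_Phi_deriv[OF x ut(3)] radial_ext_Phi_deriv[OF x ut(4)]
      unfolding vs Psi_4[OF x] u[symmetric] qq_def kq_def
        sv_swap[of u1 u0] sv_swap[of u2 u0] sv_swap[of u3 u0] sv_swap[of u2 u1] sv_swap[of u3 u1] sv_swap[of u3 u2]
      unfolding sv_def by (simp add: det3_def algebra_simps)
  next
    case False
    then have "Psi (2 * (a + b)) (12 * b) x vs = 0"
      using Psi_not_4[of vs "2 * (a + b)" "12 * b" x] Psi_off[of x "2 * (a + b)" "12 * b"] by auto
    then show ?thesis using False by (auto simp: ext_d_def)
  qed
qed

text \<open>Projecting subtracts multiples of the base point \<open>y\<close> of the line from both
  arguments; the term with both multiples drops out as \<open>sv y y = 0\<close>.\<close>

lemma sv_proj_line: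
  assumes w: "inner v x = 0" "inner w x = 0"
  shows "sv (proj (r *\<^sub>R (x + t *\<^sub>R u)) v) (proj (r *\<^sub>R (x + t *\<^sub>R u)) w) =
    sv v w - (r\<^sup>2 * t * inner v u) *\<^sub>R sv (x + t *\<^sub>R u) w + (r\<^sup>2 * t * inner w u) *\<^sub>R sv (x + t *\<^sub>R u) v"
proof -
  define y where "y = x + t *\<^sub>R u"
  have p: "proj (r *\<^sub>R y) z = z + (- (r\<^sup>2 * inner z y)) *\<^sub>R y" for z
    by (simp add: proj_def power2_eq_square)
  have i: "inner v y = t * inner v u" "inner w y = t * inner w u"
    using w by (simp_all add: y_def inner_add_right)
  show ?thesis
    unfolding y_def[symmetric] p sv_add sv_scaleR sv_self i sv_swap[of v y]
    by (simp add: algebra_simps)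
qed

text \<open>Here the projections stay inside \<open>S\<close>, because the \<open>s\<^sub>i\<close>
  have no slot for the base point. In \<open>qq\<close> two base points and four arguments give the
  exponent 6.\<close>

lemma radial_ext_Psi:
  assumes x: "x \<in> S7" and u: "u \<in> tangent x"
  defines "y \<equiv> \<lambda>t. x + t *\<^sub>R u"
  defines "P \<equiv> \<lambda>t. proj (rho u t *\<^sub>R y t)"
  defines "S \<equiv> \<lambda>t v w. sv (P t v) (P t w)"
  shows "radial_ext (Psi c d) (x + t *\<^sub>R u) [v0, v1, v2, v3] =
    (c + d / 3) * (rho u t ^ 6 *
      (det3 (sv (y t) v0) (sv (y t) v1) (S t v2 v3) - det3 (sv (y t) v0) (sv (y t) v2) (S t v1 v3)
     + det3 (sv (y t) v0) (sv (y t) v3) (S t v1 v2) + det3 (sv (y t) v1) (sv (y t) v2) (S t v0 v3)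
     - det3 (sv (y t) v1) (sv (y t) v3) (S t v0 v2) + det3 (sv (y t) v2) (sv (y t) v3) (S t v0 v1)))
    + d / 3 * (rho u t ^ 4 * (inner (S t v0 v1) (S t v2 v3) - inner (S t v0 v2) (S t v1 v3) + inner (S t v0 v3) (S t v1 v2)))"
proof -
  define z where "z = y t"
  define r where "r = rho u t"
  have rz: "r *\<^sub>R z \<in> S7" unfolding z_def r_def y_def by (rule line_sphere[OF x u])
  have P: "P t = proj (r *\<^sub>R z)" by (simp add: P_def r_def z_def)
  have pp: "proj (r *\<^sub>R z) (r *\<^sub>R proj (r *\<^sub>R z) v) = r *\<^sub>R proj (r *\<^sub>R z) v" for v
    using proj_lin[of "r *\<^sub>R z" r "proj (r *\<^sub>R z) v" 0 0] by (simp add: proj_tangent proj_in_tangent[OF rz])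
  have sz: "sv z (proj (r *\<^sub>R z) v) = sv z v" for v
    by (simp add: proj_def sv_def s_add s_scaleR s_self diff_conv_add_uminus del: add_uminus_conv_diff flip: scaleR_minus_left)
  have "radial_ext (Psi c d) z [v0, v1, v2, v3] = Psi c d (r *\<^sub>R z)
     [r *\<^sub>R proj (r *\<^sub>R z) v0, r *\<^sub>R proj (r *\<^sub>R z) v1, r *\<^sub>R proj (r *\<^sub>R z) v2, r *\<^sub>R proj (r *\<^sub>R z) v3]"
    unfolding radial_ext_def z_def y_def r_def line_sphere[OF x u] by simp
  also have "\<dots> = (c + d / 3) * qq (r *\<^sub>R z) (r *\<^sub>R P t v0) (r *\<^sub>R P t v1) (r *\<^sub>R P t v2) (r *\<^sub>R P t v3)
     + d / 3 * kq (r *\<^sub>R P t v0) (r *\<^sub>R P t v1) (r *\<^sub>R P t v2) (r *\<^sub>R P t v3)"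
    unfolding Psi_4[OF rz] pp P ..
  also have "qq (r *\<^sub>R z) (r *\<^sub>R P t v0) (r *\<^sub>R P t v1) (r *\<^sub>R P t v2) (r *\<^sub>R P t v3) = r ^ 6 *
      (det3 (sv z v0) (sv z v1) (S t v2 v3) - det3 (sv z v0) (sv z v2) (S t v1 v3)
     + det3 (sv z v0) (sv z v3) (S t v1 v2) + det3 (sv z v1) (sv z v2) (S t v0 v3)
     - det3 (sv z v1) (sv z v3) (S t v0 v2) + det3 (sv z v2) (sv z v3) (S t v0 v1))"
    unfolding qq_def S_def P sv_scaleR det3_scaleR sz by (simp add: power_numeral_reduce algebra_simps)
  also have "kq (r *\<^sub>R P t v0) (r *\<^sub>R P t v1) (r *\<^sub>R P t v2) (r *\<^sub>R P t v3) = r ^ 4 *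
     (inner (S t v0 v1) (S t v2 v3) - inner (S t v0 v2) (S t v1 v3) + inner (S t v0 v3) (S t v1 v2))"
    unfolding kq_scale by (simp add: kq_def S_def)
  finally show ?thesis unfolding z_def r_def y_def .
qed

text \<open>The derivative at \<open>t = 0\<close> of \<open>sv\<close> on the projections of \<open>v\<close> and \<open>w\<close> to the tangent space in direction \<open>x + t *\<^sub>R u\<close>.\<close>

definition dsv :: "V \<Rightarrow> V \<Rightarrow> V \<Rightarrow> V \<Rightarrow> real \<times> real \<times> real" where
  "dsv x u v w = inner w u *\<^sub>R sv x v - inner v u *\<^sub>R sv x w"

lemma radial_ext_Psi_deriv:
  assumes x: "x \<in> S7" and u: "u \<in> tangent x"
    and v: "v0 \<in> tangent x" "v1 \<in> tangent x" "v2 \<in> tangent x" "v3 \<in> tangent x"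
  shows "deriv (\<lambda>t. radial_ext (Psi c d) (x + t *\<^sub>R u) [v0, v1, v2, v3]) 0 =
    (c + d / 3) *
      (det3 (sv u v0) (sv x v1) (sv v2 v3) + det3 (sv x v0) (sv u v1) (sv v2 v3) + det3 (sv x v0) (sv x v1) (dsv x u v2 v3)
     - (det3 (sv u v0) (sv x v2) (sv v1 v3) + det3 (sv x v0) (sv u v2) (sv v1 v3) + det3 (sv x v0) (sv x v2) (dsv x u v1 v3))
     + (det3 (sv u v0) (sv x v3) (sv v1 v2) + det3 (sv x v0) (sv u v3) (sv v1 v2) + det3 (sv x v0) (sv x v3) (dsv x u v1 v2))
     + (det3 (sv u v1) (sv x v2) (sv v0 v3) + det3 (sv x v1) (sv u v2) (sv v0 v3) + det3 (sv x v1) (sv x v2) (dsv x u v0 v3))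
     - (det3 (sv u v1) (sv x v3) (sv v0 v2) + det3 (sv x v1) (sv u v3) (sv v0 v2) + det3 (sv x v1) (sv x v3) (dsv x u v0 v2))
     + (det3 (sv u v2) (sv x v3) (sv v0 v1) + det3 (sv x v2) (sv u v3) (sv v0 v1) + det3 (sv x v2) (sv x v3) (dsv x u v0 v1)))
    + d / 3 * (inner (dsv x u v0 v1) (sv v2 v3) + inner (sv v0 v1) (dsv x u v2 v3)
       - (inner (dsv x u v0 v2) (sv v1 v3) + inner (sv v0 v2) (dsv x u v1 v3))
       + (inner (dsv x u v0 v3) (sv v1 v2) + inner (sv v0 v3) (dsv x u v1 v2)))" (is "_ = ?R")
proof (rule DERIV_imp_deriv)
  have i: "inner v0 x = 0" "inner v1 x = 0" "inner v2 x = 0" "inner v3 x = 0"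
    using v by (auto simp: tangent_def)
  define S where "S t v w = sv (proj (rho u t *\<^sub>R (x + t *\<^sub>R u)) v) (proj (rho u t *\<^sub>R (x + t *\<^sub>R u)) w)" for t v w
  have S: "((\<lambda>t. S t v w) has_vector_derivative dsv x u v w) (at 0)" "S 0 v w = sv v w"
    if "inner v x = 0" "inner w x = 0" for v w
  proof -
    have k: "((\<lambda>t. (rho u t)\<^sup>2 * t * inner z u) has_real_derivative inner z u) (at 0)" for z
      by (rule derivative_eq_intros refl rho_has_derivative)+ (simp add: rho_0)
    have e: "S t v w = sv v w - ((rho u t)\<^sup>2 * t * inner v u) *\<^sub>R sv (x + t *\<^sub>R u) w
        + ((rho u t)\<^sup>2 * t * inner w u) *\<^sub>R sv (x + t *\<^sub>R u) v" for t
      unfolding S_def by (rule sv_proj_line[OF that])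
    show "S 0 v w = sv v w" unfolding e by simp
    have "((\<lambda>t. S t v w) has_vector_derivative
        (0 - (((rho u 0)\<^sup>2 * 0 * inner v u) *\<^sub>R sv u w + inner v u *\<^sub>R sv (x + 0 *\<^sub>R u) w)
         + (((rho u 0)\<^sup>2 * 0 * inner w u) *\<^sub>R sv u v + inner w u *\<^sub>R sv (x + 0 *\<^sub>R u) v))) (at 0)"
      unfolding e
      by (intro has_vector_derivative_add has_vector_derivative_diff has_vector_derivative_const
          has_vector_derivative_scaleR sv_line_deriv k)
    then show "((\<lambda>t. S t v w) has_vector_derivative dsv x u v w) (at 0)"
      by (simp add: dsv_def)
  qed
  note D = det3_has_derivative[OF sv_line_deriv sv_line_deriv S(1)]
  note I = inner_has_derivative[OF S(1) S(1)]
  show "((\<lambda>t. radial_ext (Psi c d) (x + t *\<^sub>R u) [v0, v1, v2, v3]) has_real_derivative ?R) (at 0)"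
    unfolding radial_ext_Psi[OF x u] S_def[symmetric]
    by (rule derivative_eq_intros refl rho_has_derivative D I i)+ (simp add: rho_0 S(2) i)
qed

text \<open>Differentiating the contact forms in \<open>qq\<close> yields terms
  \<open>\<eta>\<^sub>i \<and> s\<^sub>j \<and> s\<^sub>k\<close>, each with both signs, since
  2-forms commute. The derivative of the projection adds radial terms, which cancel separately; for
  the constant form \<open>kq\<close> they are the only ones. Keeping the values of
  \<open>sv\<close> opaque makes these cancellations linear.\<close>

lemma ext_d_Psi: "ext_d 4 (Psi c d) = (\<lambda>_ _. 0)"
proof (intro ext)
  fix x vs
  show "ext_d 4 (Psi c d) x vs = 0"
  proof (cases "x \<in> S7 \<and> length vs = 5")
    case True
    then have x: "x \<in> S7" by simp
    from True obtain v0 v1 v2 v3 v4 where vs: "vs = [v0, v1, v2, v3, v4]"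
      by (auto simp: numeral_eq_Suc length_Suc_conv)
    define u0 u1 u2 u3 u4 where u: "u0 = proj x v0" "u1 = proj x v1" "u2 = proj x v2" "u3 = proj x v3" "u4 = proj x v4"
    have ut: "u0 \<in> tangent x" "u1 \<in> tangent x" "u2 \<in> tangent x" "u3 \<in> tangent x" "u4 \<in> tangent x"
      unfolding u by (rule proj_in_tangent[OF x])+
    have e: "ext_d 4 (Psi c d) x vs =
        deriv (\<lambda>t. radial_ext (Psi c d) (x + t *\<^sub>R u0) [u1, u2, u3, u4]) 0
      - deriv (\<lambda>t. radial_ext (Psi c d) (x + t *\<^sub>R u1) [u0, u2, u3, u4]) 0
      + deriv (\<lambda>t. radial_ext (Psi c d) (x + t *\<^sub>R u2) [u0, u1, u3, u4]) 0
      - deriv (\<lambda>t. radial_ext (Psi c d) (x + t *\<^sub>R u3) [u0, u1, u2, u4]) 0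
      + deriv (\<lambda>t. radial_ext (Psi c d) (x + t *\<^sub>R u4) [u0, u1, u2, u3]) 0"
      using x by (simp add: ext_d_def vs u[symmetric] numeral_eq_Suc)
    note dd = radial_ext_Psi_deriv[OF x]
    \<comment> \<open>Separates the parts belonging to \<open>c + d / 3\<close> and to
      \<open>d / 3\<close>, which vanish independently.\<close>
    have comb: "(k * p0 + m * r0) - (k * p1 + m * r1) + (k * p2 + m * r2) - (k * p3 + m * r3) + (k * p4 + m * r4)
      = k * (p0 - p1 + p2 - p3 + p4) + m * (r0 - r1 + r2 - r3 + r4)" for k m p0 p1 p2 p3 p4 r0 r1 r2 r3 r4 :: real
      by (simp add: algebra_simps)
    have zero: "k * p + m * r = 0" if "p = 0" "r = 0" for k m p r :: real using that by simp
    show ?thesis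
      unfolding e dd[OF ut(1) ut(2) ut(3) ut(4) ut(5)] dd[OF ut(2) ut(1) ut(3) ut(4) ut(5)]
        dd[OF ut(3) ut(1) ut(2) ut(4) ut(5)] dd[OF ut(4) ut(1) ut(2) ut(3) ut(5)] dd[OF ut(5) ut(1) ut(2) ut(3) ut(4)]
        comb dsv_def sv_swap[of u1 u0] sv_swap[of u2 u0] sv_swap[of u3 u0] sv_swap[of u4 u0] sv_swap[of u2 u1]
        sv_swap[of u3 u1] sv_swap[of u4 u1] sv_swap[of u3 u2] sv_swap[of u4 u2] sv_swap[of u4 u3]
        inner_commute[of u1 u0] inner_commute[of u2 u0] inner_commute[of u3 u0] inner_commute[of u4 u0] inner_commute[of u2 u1]
        inner_commute[of u3 u1] inner_commute[of u4 u1] inner_commute[of u3 u2] inner_commute[of u4 u2] inner_commute[of u4 u3]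
    proof (rule zero, goal_cases)
      case 1
      show ?case
        using closed_qq_sum[where ya = "sv x u0" and yb = "sv x u1" and yc = "sv x u2" and yd = "sv x u3" and
          ye = "sv x u4" and sab = "sv u0 u1" and sac = "sv u0 u2" and sad = "sv u0 u3" and sae = "sv u0 u4"
          and sbc = "sv u1 u2" and sbd = "sv u1 u3" and sbe = "sv u1 u4" and scd = "sv u2 u3" and
          sce = "sv u2 u4" and sde = "sv u3 u4"]
          closed_qq_sum_radial[where ya = "sv x u0" and yb = "sv x u1" and yc = "sv x u2" and yd = "sv x u3" and
            ye = "sv x u4" and iab = "inner u0 u1" and iac = "inner u0 u2" and iad = "inner u0 u3" and
            iae = "inner u0 u4" and ibc = "inner u1 u2" and ibd = "inner u1 u3" and ibe = "inner u1 u4" and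
            icd = "inner u2 u3" and ice = "inner u2 u4" and ide = "inner u3 u4"]
        by linarith
    next
      case 2
      show ?case
        using closed_kq_sum_radial[where ya = "sv x u0" and yb = "sv x u1" and yc = "sv x u2" and yd = "sv x u3" and
          ye = "sv x u4" and sab = "sv u0 u1" and sac = "sv u0 u2" and sad = "sv u0 u3" and sae = "sv u0 u4"
          and sbc = "sv u1 u2" and sbd = "sv u1 u3" and sbe = "sv u1 u4" and scd = "sv u2 u3" and
          sce = "sv u2 u4" and sde = "sv u3 u4" and iab = "inner u0 u1" and iac = "inner u0 u2" and
          iad = "inner u0 u3" and iae = "inner u0 u4" and ibc = "inner u1 u2" and ibd = "inner u1 u3" and
          ibe = "inner u1 u4" and icd = "inner u2 u3" and ice = "inner u2 u4" and ide = "inner u3 u4"]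
        by linarith
    qed
  qed (auto simp: ext_d_def)
qed

lemma ext_d_zero: "ext_d k (\<lambda>_ _. 0) = (\<lambda>_ _. 0)"
  by (intro ext) (simp add: ext_d_def radial_ext_def[abs_def])

section \<open>Classification of invariant 3-forms and the Laplacian\<close>

definition f1 :: V where "f1 = ((0, 1, 0, 0), 0)"
definition f2 :: V where "f2 = ((0, 0, 1, 0), 0)"
definition f3 :: V where "f3 = ((0, 0, 0, 1), 0)"
definition f4 :: V where "f4 = (0, (1, 0, 0, 0))"
definition f5 :: V where "f5 = (0, (0, 1, 0, 0))"
definition f6 :: V where "f6 = (0, (0, 0, 1, 0))"
definition f7 :: V where "f7 = (0, (0, 0, 0, 1))"

lemmas f_defs = f1_def f2_def f3_def f4_def f5_def f6_def f7_def

lemma Sp2_one: "(qone, 0, 0, qone) \<in> Sp2" "qmat_apply (qone, 0, 0, qone) v = v"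
  by (simp_all add: Sp2_def qmul_qone qmul_zero qconj_0 qconj_qone qzero_0 qmat_apply_def split: prod.splits)

lemma sp_act_qone: "sp_act A qone v = qmat_apply A v"
  by (simp add: sp_act_def qconj_qone qmul_qone split: prod.splits)

lemma Sp1_qone: "qone \<in> Sp1"
  by (simp add: Sp1_def norm_qone)

lemma frame_f: "x \<in> S7 \<Longrightarrow> A \<in> Sp2 \<Longrightarrow> qmat_apply A x0 = x \<Longrightarrow>
    frame x (qmat_apply A f1) (qmat_apply A f2) (qmat_apply A f3) (qmat_apply A f4) (qmat_apply A f5) (qmat_apply A f6) (qmat_apply A f7) 1 1"
  unfolding f_defs by (rule frame_qmat_apply)

lemma ssum_map: "ssum k F (map P e) = ssum k (\<lambda>l. F (map P l)) e"
  by (induction e arbitrary: k F) auto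

lemma invariant_at_x0:
  assumes inv: "invariant \<phi>" and "A \<in> Sp2" "q \<in> Sp1" "sp_act A q x0 = x0"
  shows "\<phi> x0 (map (sp_act A q) vs) = \<phi> x0 vs"
proof -
  have "\<phi> (sp_act A q x0) (map (sp_act A q) vs) = \<phi> x0 vs"
    using inv assms(2,3) x0_S7 unfolding invariant_def by blast
  then show ?thesis by (simp add: assms(4))
qed

lemmas act_defs = sp_act_def qmat_apply_def qmul_def qconj_def zero_prod_def x0_def f_defs

text \<open>A diagonal \<open>A\<close> with entries \<open>p\<close>, \<open>p'\<close> together
  with \<open>q\<close> fixes \<open>x0\<close> iff \<open>p = q\<close>; it conjugates the vertical
  vectors by \<open>q\<close> and acts on the horizontal ones by \<open>p'\<close> from the left and
  the conjugate of \<open>q\<close> from the right. Six such elements permute the basis up to sign,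
  so every condition is a relation between two components.\<close>

lemma invariant_classify_x0:
  assumes alt: "alt_form x0 3 (\<phi> x0)" and inv: "invariant \<phi>"
  shows "\<phi> x0 = Phi (\<phi> x0 [f1, f2, f3]) (\<phi> x0 [f1, f4, f5]) x0"
proof -
  define \<alpha> where "\<alpha> = \<phi> x0"
  define a where "a = \<alpha> [f1, f2, f3]"
  define b where "b = \<alpha> [f1, f4, f5]"
  have m: "malt 3 \<alpha>" unfolding \<alpha>_def by (rule alt_form_malt[OF x0_S7 alt])
  have minus: "\<alpha> [- u, v, w] = - \<alpha> [u, v, w]" "\<alpha> [u, - v, w] = - \<alpha> [u, v, w]" "\<alpha> [u, v, - w] = - \<alpha> [u, v, w]" for u v w
    using malt_scale[OF m, of "[]" "-1" u "[v, w]"] malt_scale[OF m, of "[u]" "-1" v "[w]"]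
      malt_scale[OF m, of "[u, v]" "-1" w "[]"] by simp_all
  have I: "\<alpha> [sp_act A q u, sp_act A q v, sp_act A q w] = \<alpha> [u, v, w]"
    if "A \<in> Sp2" "q \<in> Sp1" "sp_act A q x0 = x0" for A q u v w
    using invariant_at_x0[OF inv that, of "[u, v, w]"] by (simp add: \<alpha>_def)
  let ?one = "(1, 0, 0, 0) :: quat" and ?i = "(0, 1, 0, 0) :: quat" and ?j = "(0, 0, 1, 0) :: quat"
    and ?w = "(1/2, 1/2, 1/2, 1/2) :: quat"
  \<comment> \<open>Minus the identity on the horizontal part: it kills all components with an odd
    number of horizontal entries.\<close>
  define n where "n = sp_act (?one, 0, 0, - ?one) ?one"
  have n: "n f1 = f1" "n f2 = f2" "n f3 = f3" "n f4 = - f4" "n f5 = - f5" "n f6 = - f6" "n f7 = - f7"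
    by (simp_all add: n_def act_defs)
  have nI: "\<alpha> [n u, n v, n w] = \<alpha> [u, v, w]" for u v w
    unfolding n_def by (rule I) (simp_all add: Sp2_def Sp1_def norm_Pair qone_def qzero_def act_defs)
  \<comment> \<open>Conjugation by \<open>i\<close> on both summands, and by \<open>j\<close> in
    \<open>d\<close>: the signs kill the components that pair a vertical direction with the wrong
    horizontal plane.\<close>
  define c where "c = sp_act (?i, 0, 0, ?i) ?i"
  have c: "c f1 = f1" "c f2 = - f2" "c f3 = - f3" "c f4 = f4" "c f5 = f5" "c f6 = - f6" "c f7 = - f7"
    by (simp_all add: c_def act_defs)
  have cI: "\<alpha> [c u, c v, c w] = \<alpha> [u, v, w]" for u v w
    unfolding c_def by (rule I) (simp_all add: Sp2_def Sp1_def norm_Pair qone_def qzero_def act_defs)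
  define d where "d = sp_act (?j, 0, 0, ?j) ?j"
  have d: "d f1 = - f1" "d f2 = f2" "d f3 = - f3" "d f4 = f4" "d f5 = - f5" "d f6 = f6" "d f7 = - f7"
    by (simp_all add: d_def act_defs)
  have dI: "\<alpha> [d u, d v, d w] = \<alpha> [u, v, w]" for u v w
    unfolding d_def by (rule I) (simp_all add: Sp2_def Sp1_def norm_Pair qone_def qzero_def act_defs)
  \<comment> \<open>Left multiplication by \<open>i\<close> on the horizontal part, and by
    \<open>j\<close> in \<open>h\<close>, with the vertical part fixed: these relate the two
    horizontal planes that belong to one vertical direction.\<close>
  define g where "g = sp_act (?one, 0, 0, ?i) ?one"
  have g: "g f1 = f1" "g f2 = f2" "g f3 = f3" "g f4 = f5" "g f5 = - f4" "g f6 = f7" "g f7 = - f6"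
    by (simp_all add: g_def act_defs)
  have gI: "\<alpha> [g u, g v, g w] = \<alpha> [u, v, w]" for u v w
    unfolding g_def by (rule I) (simp_all add: Sp2_def Sp1_def norm_Pair qone_def qzero_def act_defs)
  define h where "h = sp_act (?one, 0, 0, ?j) ?one"
  have h: "h f1 = f1" "h f2 = f2" "h f3 = f3" "h f4 = f6" "h f5 = - f7" "h f6 = - f4" "h f7 = f5"
    by (simp_all add: h_def act_defs)
  have hI: "\<alpha> [h u, h v, h w] = \<alpha> [u, v, w]" for u v w
    unfolding h_def by (rule I) (simp_all add: Sp2_def Sp1_def norm_Pair qone_def qzero_def act_defs)
  \<comment> \<open>Conjugation by \<open>(1 + i + j + k) / 2\<close> permutes \<open>i\<close>,
    \<open>j\<close>, \<open>k\<close> cyclically and so identifies the coefficients of the three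
    vertical directions.\<close>
  define k where "k = sp_act (?w, 0, 0, ?w) ?w"
  have k: "k f1 = f2" "k f2 = f3" "k f3 = f1" "k f4 = f4" "k f5 = f6" "k f6 = f7" "k f7 = f5"
    by (simp_all add: k_def act_defs)
  have kI: "\<alpha> [k u, k v, k w] = \<alpha> [u, v, w]" for u v w
    unfolding k_def by (rule I) (simp_all add: Sp2_def Sp1_def norm_Pair qone_def qzero_def act_defs power2_eq_square)
  have odd: "\<alpha> [f1, f2, f4] = 0" "\<alpha> [f1, f2, f5] = 0" "\<alpha> [f1, f2, f6] = 0" "\<alpha> [f1, f2, f7] = 0"
    "\<alpha> [f1, f3, f4] = 0" "\<alpha> [f1, f3, f5] = 0" "\<alpha> [f1, f3, f6] = 0" "\<alpha> [f1, f3, f7] = 0"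
    "\<alpha> [f2, f3, f4] = 0" "\<alpha> [f2, f3, f5] = 0" "\<alpha> [f2, f3, f6] = 0" "\<alpha> [f2, f3, f7] = 0"
    "\<alpha> [f4, f5, f6] = 0" "\<alpha> [f4, f5, f7] = 0" "\<alpha> [f4, f6, f7] = 0" "\<alpha> [f5, f6, f7] = 0"
    using nI[of f1 f2 f4] nI[of f1 f2 f5] nI[of f1 f2 f6] nI[of f1 f2 f7] nI[of f1 f3 f4] nI[of f1 f3 f5] nI[of f1 f3 f6]
      nI[of f1 f3 f7] nI[of f2 f3 f4] nI[of f2 f3 f5] nI[of f2 f3 f6] nI[of f2 f3 f7] nI[of f4 f5 f6] nI[of f4 f5 f7]
      nI[of f4 f6 f7] nI[of f5 f6 f7]
    by (simp_all add: n minus)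
  have mixed: "\<alpha> [f1, f4, f6] = 0" "\<alpha> [f1, f4, f7] = 0" "\<alpha> [f1, f5, f6] = 0" "\<alpha> [f1, f5, f7] = 0"
    "\<alpha> [f2, f4, f5] = 0" "\<alpha> [f2, f4, f7] = 0" "\<alpha> [f2, f5, f6] = 0" "\<alpha> [f2, f6, f7] = 0"
    "\<alpha> [f3, f4, f5] = 0" "\<alpha> [f3, f4, f6] = 0" "\<alpha> [f3, f5, f7] = 0" "\<alpha> [f3, f6, f7] = 0"
    using cI[of f1 f4 f6] cI[of f1 f4 f7] cI[of f1 f5 f6] cI[of f1 f5 f7] cI[of f2 f4 f5] dI[of f2 f4 f7] dI[of f2 f5 f6]
      cI[of f2 f6 f7] cI[of f3 f4 f5] dI[of f3 f4 f6] cI[of f3 f5 f7] dI[of f3 f5 f7] cI[of f3 f6 f7]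
    by (simp_all add: c d minus)
  have 2: "\<alpha> [f2, f4, f6] = b" and 3: "\<alpha> [f3, f4, f7] = b"
    using kI[of f1 f4 f5] kI[of f2 f4 f6] by (simp_all add: k b_def)
  have rest: "\<alpha> [f1, f6, f7] = - b" "\<alpha> [f2, f5, f7] = b" "\<alpha> [f3, f5, f6] = - b"
    using hI[of f1 f4 f5] gI[of f2 f4 f6] gI[of f3 f4 f7] by (simp_all add: h g minus 2 3 b_def)
  interpret frame x0 f1 f2 f3 f4 f5 f6 f7 1 1
    using frame_f[OF x0_S7 Sp2_one(1)] by (simp add: Sp2_one(2))
  have S: "ssum 3 (\<lambda>l. (\<alpha> l - Phi a b x0 l) * (\<alpha> l - Phi a b x0 l)) fr = 0"
    by (simp add: Phi_frame odd mixed 2 3 rest flip: a_def b_def)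
  have "\<alpha> vs = Phi a b x0 vs" for vs
  proof -
    have "onb x0 (gm 1 1 x0) fr" by (intro onb_gm) auto
    from onb_span[OF x0_S7 inner_on_gm_1_1[OF x0_S7] this]
    have "set (map (proj x0) vs) \<subseteq> span (set fr)" using set_map_proj[OF x0_S7] by blast
    from malt_eqI[OF m malt_Phi[OF x0_S7] S this] show ?thesis
      using alt_form_proj[OF x0_S7 alt] alt_form_proj[OF x0_S7 alt_form_Phi[OF x0_S7]] by (simp add: \<alpha>_def)
  qed
  then have "\<alpha> = Phi a b x0" by (rule ext)
  then show ?thesis unfolding \<alpha>_def a_def b_def .
qed

text \<open>Some element of Sp(2), taken with \<open>q = 1\<close>, moves \<open>x0\<close> to
  \<open>x\<close> and the model frame to a frame there; as \<open>\<phi>\<close> and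
  \<open>Phi a b\<close> are both invariant, their equality at \<open>x0\<close> is
  transported.\<close>

lemma invariant_classify:
  assumes df: "diff_form 3 \<phi>" and inv: "invariant \<phi>"
  shows "\<exists>a b. \<phi> = Phi a b"
proof -
  have alt: "alt_form x 3 (\<phi> x)" if "x \<in> S7" for x
    using df that unfolding diff_form_def by metis
  have off: "\<phi> x = (\<lambda>_. 0)" if "x \<notin> S7" for x
    using df that unfolding diff_form_def by metis
  define a b where "a = \<phi> x0 [f1, f2, f3]" and "b = \<phi> x0 [f1, f4, f5]"
  have 0: "\<phi> x0 = Phi a b x0"
    unfolding a_def b_def by (rule invariant_classify_x0[OF alt[OF x0_S7] inv])
  have "\<phi> x vs = Phi a b x vs" for x vs
  proof (cases "x \<in> S7")
    case x: True
    obtain A where A: "A \<in> Sp2" "qmat_apply A x0 = x" using Sp2_transitive[OF x] by blast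
    interpret frame x "qmat_apply A f1" "qmat_apply A f2" "qmat_apply A f3" "qmat_apply A f4"
      "qmat_apply A f5" "qmat_apply A f6" "qmat_apply A f7" 1 1
      by (rule frame_f[OF x A])
    have inv': "\<psi> x (map (qmat_apply A) l) = \<psi> x0 l" if "invariant \<psi>" for \<psi> l
    proof -
      have "\<psi> (sp_act A qone x0) (map (sp_act A qone) l) = \<psi> x0 l"
        using that A(1) Sp1_qone x0_S7 unfolding invariant_def by blast
      then show ?thesis by (simp add: sp_act_qone[abs_def] A(2))
    qed
    have fr: "fr = map (qmat_apply A) [f1, f2, f3, f4, f5, f6, f7]" by simp
    have "ssum 3 (\<lambda>l. (\<phi> x l - Phi a b x l) * (\<phi> x l - Phi a b x l)) fr = 0"
      unfolding fr ssum_map inv'[OF inv] inv'[OF invariant_Phi] 0 by simp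
    moreover have "onb x (gm 1 1 x) fr" by (intro onb_gm) auto
    from onb_span[OF x inner_on_gm_1_1[OF x] this]
    have "set (map (proj x) vs) \<subseteq> span (set fr)" using set_map_proj[OF x] by blast
    ultimately show ?thesis
      using malt_eqI[OF alt_form_malt[OF x alt[OF x]] malt_Phi[OF x], of a b fr "map (proj x) vs"]
      by (simp add: alt_form_proj[OF x alt[OF x]] alt_form_proj[OF x alt_form_Phi[OF x]])
  qed (simp add: off Phi_off)
  then have "\<phi> = Phi a b" by (intro ext)
  then show ?thesis by blast
qed

lemma diff_form_Phi: "diff_form 3 (Phi a b)"
  unfolding diff_form_def using alt_form_Phi Phi_off by metis

lemma Phi_in_pos_inv_3forms: "Phi a b \<in> pos_inv_3forms \<longleftrightarrow> a * b > 0"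
  unfolding pos_inv_3forms_def mem_Collect_eq
  using diff_form_Phi invariant_Phi positive_at_Phi x0_S7 by blast

lemma pos_inv_3forms_cases:
  assumes "\<phi> \<in> pos_inv_3forms"
  obtains a b where "\<phi> = Phi a b" "a * b > 0"
proof -
  have "diff_form 3 \<phi>" "invariant \<phi>" using assms by (simp_all add: pos_inv_3forms_def)
  then obtain a b where "\<phi> = Phi a b" using invariant_classify by blast
  with assms Phi_in_pos_inv_3forms that show thesis by blast
qed

section \<open>The Laplacian in the parameters of the invariant forms\<close>

lemma Phi_eq_iff: "Phi a b = Phi a' b' \<longleftrightarrow> a = a' \<and> b = b'"
proof
  assume e: "Phi a b = Phi a' b'"
  interpret frame x0 f1 f2 f3 f4 f5 f6 f7 1 1
    using frame_f[OF x0_S7 Sp2_one(1)] by (simp add: Sp2_one(2))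
  have "Phi a b x0 [f1, f2, f3] = Phi a' b' x0 [f1, f2, f3]" "Phi a b x0 [f1, f4, f5] = Phi a' b' x0 [f1, f4, f5]"
    by (simp_all add: e)
  then show "a = a' \<and> b = b'" by (simp add: Phi_frame)
qed simp

lemma Phi_param_ratio:
  fixes a b :: real
  assumes "a * b > 0"
  obtains \<epsilon> s r where "\<bar>\<epsilon>\<bar> = 1" "s > 0" "r > 0" "a = \<epsilon> * s ^ 3" "b = \<epsilon> * (s ^ 3 / r)"
proof -
  obtain \<epsilon> s t where *: "\<bar>\<epsilon>\<bar> = 1" "s > 0" "t > 0" "a = \<epsilon> * s ^ 3" "b = \<epsilon> * s * t\<^sup>2"
    using Phi_param[OF assms] by blast
  show thesis
    by (rule that[of \<epsilon> s "s\<^sup>2 / t\<^sup>2"]) (use * in \<open>auto simp: power2_eq_square power3_eq_cube\<close>)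
qed

text \<open>In terms of \<open>s\<close> and \<open>t\<close>, d yields \<open>Psi\<close> with
  \<open>2 \<epsilon> (s\<^sup>3 + s t\<^sup>2)\<close> and
  \<open>12 \<epsilon> s t\<^sup>2\<close>, and the star turns this into \<open>Phi\<close> with
  \<open>12 s\<^sup>4 / t\<^sup>2\<close> and \<open>2 (s\<^sup>2 + t\<^sup>2)\<close>. One more
  round and \<open>t\<^sup>2 = s\<^sup>2 / r\<close> give the result. The two stars and
  \<open>\<phi>\<close> itself contribute three factors \<open>\<epsilon>\<close>, so one
  survives.\<close>

lemma G2_laplacian_Phi:
  assumes e: "\<bar>\<epsilon>\<bar> = 1" and "s > 0" "r > 0"
  shows "G2_laplacian (Phi (\<epsilon> * s ^ 3) (\<epsilon> * (s ^ 3 / r)))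
    = Phi (\<epsilon> * (24 * s * r * (r + 1))) (\<epsilon> * (4 * s * (6 * r\<^sup>2 + r + 1) / r))"
proof -
  define t where "t = s / sqrt r"
  have t: "t > 0" "t\<^sup>2 = s\<^sup>2 / r" using assms by (auto simp: t_def power_divide)
  have t4: "t ^ 4 = s ^ 4 / r\<^sup>2" using t(2) by (metis power2_eq_square power_divide power_mult numeral_Bit0 mult_2 power_add)
  have ee: "\<epsilon> * \<epsilon> = 1" using e by (metis abs_mult_self_eq mult_1)
  then have ee': "\<epsilon> * (\<epsilon> * z) = z" for z by (metis mult.assoc mult_1)
  have b: "\<epsilon> * (s ^ 3 / r) = \<epsilon> * s * t\<^sup>2"
    using t(2) by (simp add: power2_eq_square power3_eq_cube)
  let ?\<phi> = "Phi (\<epsilon> * s ^ 3) (\<epsilon> * s * t\<^sup>2)"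
  note st = star_Phi[OF \<open>s > 0\<close> t(1) e]
  \<comment> \<open>The second summand dies because the star of \<open>\<phi>\<close> is some
    \<open>Psi\<close>, hence closed.\<close>
  have "G2_laplacian ?\<phi> = star ?\<phi> 4 (ext_d 3 (star ?\<phi> 4 (ext_d 3 ?\<phi>)))"
    by (intro ext) (simp add: G2_laplacian_def st(2,3) ext_d_Psi ext_d_zero)
  also have "\<dots> = Phi (\<epsilon> * (24 * s * r * (r + 1))) (\<epsilon> * (4 * s * (6 * r\<^sup>2 + r + 1) / r))"
    unfolding ext_d_Phi st(1) Phi_eq_iff unfolding t(2) t4
    using assms(2,3)
    by (simp add: field_simps power2_eq_square power3_eq_cube power4_eq_xxxx ee ee')
  finally show ?thesis unfolding b .
qed

lemma same_orientation_Phi: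
  assumes e: "\<bar>\<epsilon>\<bar> = 1" and s: "s > 0" "t > 0" "s' > 0" "t' > 0"
  shows "same_orientation (Phi (\<epsilon> * s ^ 3) (\<epsilon> * s * t\<^sup>2)) (Phi (\<epsilon> * s' ^ 3) (\<epsilon> * s' * t'\<^sup>2))"
  unfolding same_orientation_def
proof
  fix x assume x: "x \<in> S7"
  show "\<exists>c>0. \<forall>vs\<in>tlists x 7. vol_of x (Phi (\<epsilon> * s' ^ 3) (\<epsilon> * s' * t'\<^sup>2) x) vs
      = c * vol_of x (Phi (\<epsilon> * s ^ 3) (\<epsilon> * s * t\<^sup>2) x) vs"
    unfolding pos_data_metric_vol(2)[OF x pos_data_Phi[OF x s(1,2) e]] pos_data_metric_vol(2)[OF x pos_data_Phi[OF x s(3,4) e]]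
    using s by (intro exI[of _ "s' ^ 3 * t' ^ 4 / (s ^ 3 * t ^ 4)"]) simp
qed

lemma same_orientation_sgn:
  assumes "a * b > 0" "a' * b' > 0" "sgn a = sgn a'"
  shows "same_orientation (Phi a b) (Phi a' b')"
proof -
  obtain \<epsilon> s t where 1: "\<bar>\<epsilon>\<bar> = 1" "s > 0" "t > 0" "a = \<epsilon> * s ^ 3" "b = \<epsilon> * s * t\<^sup>2"
    using Phi_param[OF assms(1)] by blast
  obtain \<epsilon>' s' t' where 2: "\<bar>\<epsilon>'\<bar> = 1" "s' > 0" "t' > 0" "a' = \<epsilon>' * s' ^ 3" "b' = \<epsilon>' * s' * t'\<^sup>2"
    using Phi_param[OF assms(2)] by blast
  have "\<epsilon>' = \<epsilon>" using assms(3) 1 2 by (auto simp: sgn_mult abs_if split: if_splits)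
  then show ?thesis using same_orientation_Phi[OF 1(1-3) 2(2,3)] 1 2 by simp
qed

text \<open>Cross-multiplied injectivity of the map on ratios: the difference of the two sides is
  \<open>r - r'\<close> times a polynomial with positive coefficients.\<close>

lemma ratio_map_inj:
  fixes r r' :: real
  assumes "r > 0" "r' > 0" "r\<^sup>2 * (r + 1) * (6 * r'\<^sup>2 + r' + 1) = r'\<^sup>2 * (r' + 1) * (6 * r\<^sup>2 + r + 1)"
  shows "r = r'"
proof -
  have "(r - r') * (6 * r\<^sup>2 * r'\<^sup>2 + r * r' * (r + r') + (r\<^sup>2 + r * r' + r'\<^sup>2) + r * r' + (r + r')) = 0"
    using assms(3) by (simp add: power2_eq_square algebra_simps)
  moreover have "6 * r\<^sup>2 * r'\<^sup>2 + r * r' * (r + r') + (r\<^sup>2 + r * r' + r'\<^sup>2) + r * r' + (r + r') > 0"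
    using assms(1,2) by (intro add_nonneg_pos add_nonneg_nonneg mult_nonneg_nonneg) auto
  ultimately show ?thesis by simp
qed

lemma ratio_map_surj:
  fixes A B :: real
  assumes "A > 0" "B > 0"
  shows "\<exists>r>0. 6 * r\<^sup>2 * (r + 1) * B = A * (6 * r\<^sup>2 + r + 1)"
proof -
  define p where "p r = 6 * r\<^sup>2 * (r + 1) * B - A * (6 * r\<^sup>2 + r + 1)" for r
  \<comment> \<open>This bound satisfies \<open>B * R = B + A\<close>, which lets the leading terms
    of \<open>p R\<close> absorb the negative ones; the intermediate value theorem then applies on
    \<open>{0..R}\<close>.\<close>
  define R where "R = 1 + A / B"
  have R: "R > 1" "B * R = B + A" using assms by (simp_all add: R_def field_simps)
  have "p R = 6 * R * R * (B * R) + 6 * R * (B * R) - A * (6 * R * R + R + 1)"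
    by (simp add: p_def power2_eq_square algebra_simps)
  also have "\<dots> = 6 * (R * R * B) + 6 * (R * B) + 5 * (R * A) - A"
    unfolding R(2) by (simp add: algebra_simps)
  also have "\<dots> = 6 * (R * (B * R)) + 6 * (R * B) + 5 * (R * A) - A"
    by (simp add: ac_simps)
  also have "\<dots> = 12 * (R * B) + 11 * (R * A) - A" unfolding R(2) by (simp add: algebra_simps)
  also have "\<dots> \<ge> 0"
  proof -
    have "A \<le> R * A" "R * B > 0" using assms R by auto
    then show ?thesis using assms by linarith
  qed
  finally have pR: "p R \<ge> 0" .
  have p0: "p 0 < 0" using assms by (simp add: p_def)
  have "continuous_on {0..R} p" unfolding p_def by (intro continuous_intros)
  then obtain r where r: "0 \<le> r" "p r = 0" using IVT'[of p 0 0 R] pR p0 R by auto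
  with p0 have "r > 0" by (cases "r = 0") auto
  then show ?thesis using r(2) by (auto simp: p_def)
qed

theorem theorem5p10:
  shows "bij_betw G2_laplacian pos_inv_3forms pos_inv_3forms
       \<and> (\<forall>\<phi>\<in>pos_inv_3forms. same_orientation \<phi> (G2_laplacian \<phi>))
       \<and> card {\<phi>\<in>pos_inv_3forms. G2_laplacian \<phi> = \<phi>} = 2"
proof (intro conjI ballI)
  define \<Phi> where "\<Phi> \<epsilon> s r = Phi (\<epsilon> * s ^ 3) (\<epsilon> * (s ^ 3 / r))" for \<epsilon> s r :: real
  have L: "G2_laplacian (\<Phi> \<epsilon> s r) = Phi (\<epsilon> * (24 * s * r * (r + 1))) (\<epsilon> * (4 * s * (6 * r\<^sup>2 + r + 1) / r))"
    if "\<bar>\<epsilon>\<bar> = 1" "s > 0" "r > 0" for \<epsilon> s r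
    unfolding \<Phi>_def by (rule G2_laplacian_Phi[OF that])
  have e2: "\<epsilon> * a * (\<epsilon> * b) = a * b" if "\<bar>\<epsilon>\<bar> = 1" for \<epsilon> a b :: real
    using that by (auto simp: abs_if split: if_splits)
  have pos: "24 * s * r * (r + 1) > 0" "4 * s * (6 * r\<^sup>2 + r + 1) / r > 0" "s ^ 3 > 0" "s ^ 3 / r > 0"
    if "s > 0" "r > 0" for s r :: real
  proof -
    have "6 * r\<^sup>2 + r + 1 > 0" using that by (intro add_nonneg_pos) auto
    then show "24 * s * r * (r + 1) > 0" "4 * s * (6 * r\<^sup>2 + r + 1) / r > 0" "s ^ 3 > 0" "s ^ 3 / r > 0"
      using that by simp_all
  qed
  have mem: "\<Phi> \<epsilon> s r \<in> pos_inv_3forms" "G2_laplacian (\<Phi> \<epsilon> s r) \<in> pos_inv_3forms"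
    if "\<bar>\<epsilon>\<bar> = 1" "s > 0" "r > 0" for \<epsilon> s r
    unfolding L[OF that] unfolding \<Phi>_def Phi_in_pos_inv_3forms e2[OF that(1)]
    using pos[OF that(2,3)] mult_pos_pos by blast+
  have ex: "\<exists>\<epsilon> s r. \<bar>\<epsilon>\<bar> = 1 \<and> s > 0 \<and> r > 0 \<and> \<phi> = \<Phi> \<epsilon> s r" if "\<phi> \<in> pos_inv_3forms" for \<phi>
    using that unfolding \<Phi>_def by (metis pos_inv_3forms_cases Phi_param_ratio)

  show "bij_betw G2_laplacian pos_inv_3forms pos_inv_3forms"
  proof (rule bij_betw_imageI)
    show "inj_on G2_laplacian pos_inv_3forms"
    proof (rule inj_onI)
      fix \<phi> \<psi> assume "\<phi> \<in> pos_inv_3forms" "\<psi> \<in> pos_inv_3forms" and eq: "G2_laplacian \<phi> = G2_laplacian \<psi>"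
      then obtain \<epsilon> s r \<epsilon>' s' r' where 1: "\<bar>\<epsilon>\<bar> = 1" "s > 0" "r > 0" and \<phi>: "\<phi> = \<Phi> \<epsilon> s r"
        and 2: "\<bar>\<epsilon>'\<bar> = 1" "s' > 0" "r' > 0" and \<psi>: "\<psi> = \<Phi> \<epsilon>' s' r'"
        using ex by metis
      let ?A = "24 * s * r * (r + 1)" and ?A' = "24 * s' * r' * (r' + 1)"
      let ?B = "4 * s * (6 * r\<^sup>2 + r + 1) / r" and ?B' = "4 * s' * (6 * r'\<^sup>2 + r' + 1) / r'"
      have AB: "\<epsilon> * ?A = \<epsilon>' * ?A'" "\<epsilon> * ?B = \<epsilon>' * ?B'"
        using eq unfolding \<phi> \<psi> L[OF 1] L[OF 2] Phi_eq_iff by auto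
      \<comment> \<open>The coefficients without \<open>\<epsilon>\<close> are positive, so absolute
        values separate them from the sign.\<close>
      have "\<bar>\<epsilon> * ?A\<bar> = ?A" "\<bar>\<epsilon>' * ?A'\<bar> = ?A'" "\<bar>\<epsilon> * ?B\<bar> = ?B" "\<bar>\<epsilon>' * ?B'\<bar> = ?B'"
        using 1 2 pos[OF 1(2,3)] pos[OF 2(2,3)] unfolding abs_mult[of \<epsilon>] abs_mult[of \<epsilon>'] by (simp_all only: abs_of_pos mult_1)
      then have A: "?A = ?A'" and B: "?B = ?B'" using AB by metis+
      have \<epsilon>: "\<epsilon> = \<epsilon>'" using AB(1) A pos(1)[OF 2(2,3)] by (metis mult_cancel_right less_irrefl)
      have A0: "s * r * (r + 1) = s' * r' * (r' + 1)" using A by simp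
      have B0: "s * (6 * r\<^sup>2 + r + 1) * r' = s' * (6 * r'\<^sup>2 + r' + 1) * r"
        using B 1 2 by (simp add: field_simps)
      \<comment> \<open>Multiplying the two equations crosswise makes the scales cancel and leaves a
        condition on the ratios alone.\<close>
      have "(s * r * (r + 1)) * (s' * (6 * r'\<^sup>2 + r' + 1) * r) = (s' * r' * (r' + 1)) * (s * (6 * r\<^sup>2 + r + 1) * r')"
        unfolding A0 B0 ..
      then have "(s * s') * (r\<^sup>2 * (r + 1) * (6 * r'\<^sup>2 + r' + 1)) = (s * s') * (r'\<^sup>2 * (r' + 1) * (6 * r\<^sup>2 + r + 1))"
        by (simp add: power2_eq_square ac_simps)
      then have "r\<^sup>2 * (r + 1) * (6 * r'\<^sup>2 + r' + 1) = r'\<^sup>2 * (r' + 1) * (6 * r\<^sup>2 + r + 1)"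
        using 1 2 by (metis mult_cancel_left less_irrefl mult_eq_0_iff)
      then have r: "r = r'" by (rule ratio_map_inj[OF 1(3) 2(3)])
      then have "s = s'" using A0 1 2 by simp
      then show "\<phi> = \<psi>" using \<phi> \<psi> \<epsilon> r by simp
    qed
    show "G2_laplacian ` pos_inv_3forms = pos_inv_3forms"
    proof (intro equalityI subsetI)
      fix \<psi> assume "\<psi> \<in> G2_laplacian ` pos_inv_3forms"
      then show "\<psi> \<in> pos_inv_3forms" using ex mem(2) by (metis imageE)
    next
      fix \<psi> assume "\<psi> \<in> pos_inv_3forms"
      then obtain \<epsilon> s0 r0 where 1: "\<bar>\<epsilon>\<bar> = 1" "s0 > 0" "r0 > 0" and \<psi>: "\<psi> = \<Phi> \<epsilon> s0 r0"
        using ex by metis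
      define A B where "A = s0 ^ 3" and "B = s0 ^ 3 / r0"
      have AB: "A > 0" "B > 0" using 1 by (simp_all add: A_def B_def)
      obtain r where r: "r > 0" "6 * r\<^sup>2 * (r + 1) * B = A * (6 * r\<^sup>2 + r + 1)"
        using ratio_map_surj[OF AB] by blast
      \<comment> \<open>The scale that gives the first coefficient the prescribed value; the second
        coefficient is then right because \<open>r\<close> was chosen for the ratio.\<close>
      define s where "s = A / (24 * r * (r + 1))"
      have s: "s > 0" using AB r by (simp add: s_def)
      have sA: "24 * s * r * (r + 1) = A" using r by (simp add: s_def)
      have "4 * s * (6 * r\<^sup>2 + r + 1) / r = B"
      proof -
        have "(4 * s * (6 * r\<^sup>2 + r + 1)) * A = 4 * s * (6 * r\<^sup>2 * (r + 1) * B)"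
          unfolding r(2) by (simp only: ac_simps)
        also have "\<dots> = 24 * s * r * (r + 1) * (B * r)" by (simp add: power2_eq_square)
        finally have "(4 * s * (6 * r\<^sup>2 + r + 1)) * A = (B * r) * A" unfolding sA by (simp only: mult.commute[of A])
        then show ?thesis using AB r by simp
      qed
      then have "G2_laplacian (\<Phi> \<epsilon> s r) = \<psi>"
        unfolding L[OF 1(1) s r(1)] sA by (simp add: \<psi> \<Phi>_def A_def B_def)
      then show "\<psi> \<in> G2_laplacian ` pos_inv_3forms" using mem(1)[OF 1(1) s r(1)] by blast
    qed
  qed

  show "same_orientation \<phi> (G2_laplacian \<phi>)" if mem_\<phi>: "\<phi> \<in> pos_inv_3forms" for \<phi>
  proof -
    obtain \<epsilon> s r where 1: "\<bar>\<epsilon>\<bar> = 1" "s > 0" "r > 0" and \<phi>: "\<phi> = \<Phi> \<epsilon> s r" using ex[OF mem_\<phi>] by blast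
    show ?thesis
      unfolding \<phi> L[OF 1] unfolding \<Phi>_def
      using pos[OF 1(2,3)]
      by (intro same_orientation_sgn) (auto simp only: e2[OF 1(1)] sgn_mult[of \<epsilon>] sgn_pos intro!: mult_pos_pos)
  qed

  \<comment> \<open>The equations for \<open>s\<close> and \<open>r\<close> do not involve
    \<open>\<epsilon>\<close>, so their unique positive solution gives one fixed point for each
    orientation.\<close>
  have "{\<phi> \<in> pos_inv_3forms. G2_laplacian \<phi> = \<phi>} = {\<Phi> 1 (12 / 5) (1 / 5), \<Phi> (- 1) (12 / 5) (1 / 5)}"
  proof (intro equalityI subsetI)
    fix \<phi> assume "\<phi> \<in> {\<phi> \<in> pos_inv_3forms. G2_laplacian \<phi> = \<phi>}"
    then have "\<phi> \<in> pos_inv_3forms" and eq: "G2_laplacian \<phi> = \<phi>" by simp_all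
    then obtain \<epsilon> s r where 1: "\<bar>\<epsilon>\<bar> = 1" "s > 0" "r > 0" and \<phi>: "\<phi> = \<Phi> \<epsilon> s r"
      using ex by metis
    have "\<epsilon> \<noteq> 0" using 1 by auto
    then have "24 * s * r * (r + 1) = s ^ 3" "4 * s * (6 * r\<^sup>2 + r + 1) / r = s ^ 3 / r"
      using eq unfolding \<phi> L[OF 1] unfolding \<Phi>_def Phi_eq_iff by simp_all
    then have "s * (24 * r * (r + 1)) = s * s\<^sup>2" "s * (4 * (6 * r\<^sup>2 + r + 1)) = s * s\<^sup>2"
      using 1 by (simp_all add: power2_eq_square power3_eq_cube ac_simps)
    then have a: "24 * r * (r + 1) = s\<^sup>2" and b: "4 * (6 * r\<^sup>2 + r + 1) = s\<^sup>2" using 1 by simp_all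
    \<comment> \<open>Equating both expressions for \<open>s\<^sup>2\<close>, the quadratic terms
      cancel and \<open>20 * r = 4\<close> remains; then
      \<open>s\<^sup>2 = 144 / 25\<close>.\<close>
    have r: "r = 1 / 5" using a b by (simp add: power2_eq_square algebra_simps)
    have "s\<^sup>2 = (12 / 5)\<^sup>2" using a unfolding r by (simp add: power2_eq_square)
    then have s: "s = 12 / 5" using 1 by (simp add: power2_eq_iff_nonneg)
    have "\<epsilon> = 1 \<or> \<epsilon> = - 1" using 1 by auto
    then show "\<phi> \<in> {\<Phi> 1 (12 / 5) (1 / 5), \<Phi> (- 1) (12 / 5) (1 / 5)}" using \<phi> r s by auto
  next
    fix \<phi> assume "\<phi> \<in> {\<Phi> 1 (12 / 5) (1 / 5), \<Phi> (- 1) (12 / 5) (1 / 5)}"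
    then have "\<exists>\<epsilon>\<in>{1, - 1}. \<phi> = \<Phi> \<epsilon> (12 / 5) (1 / 5)" by simp
    then obtain \<epsilon> :: real where "\<epsilon> \<in> {1, - 1}" and \<phi>: "\<phi> = \<Phi> \<epsilon> (12 / 5) (1 / 5)" by blast
    then have e: "\<bar>\<epsilon>\<bar> = 1" by auto
    have "G2_laplacian \<phi> = \<phi>"
      unfolding \<phi> by (subst L[OF e]) (simp_all add: \<Phi>_def Phi_eq_iff power2_eq_square power3_eq_cube)
    then show "\<phi> \<in> {\<phi> \<in> pos_inv_3forms. G2_laplacian \<phi> = \<phi>}"
      using mem(1)[OF e, of "12 / 5" "1 / 5"] by (simp add: \<phi>)
  qed
  moreover have "\<Phi> 1 (12 / 5) (1 / 5) \<noteq> \<Phi> (- 1) (12 / 5) (1 / 5)"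
    by (simp add: \<Phi>_def Phi_eq_iff)
  ultimately show "card {\<phi> \<in> pos_inv_3forms. G2_laplacian \<phi> = \<phi>} = 2" by simp
qed

end
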